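(* Let $(Q_n)_{n\ge 0}$ be one of the queueing characteristics listed in the context, with known initial value $Q_0$, known rate $\alpha$, and unknown input distribution function $G$. Let $G_{\mathrm{emp}}(x,N)$ be the empirical distribution function of $N$ independent observations from $G$, and put $r_i=\int_0^\infty \mathrm{e}^{-\alpha x}\frac{(\alpha x)^i}{i!}\,\mathrm{d}G_{\mathrm{emp}}(x,N)$. The point estimator $\widehat Q_n$ of $Q_n$ is defined recurrently by $$\widehat Q_1=\frac{1}{r_0}Q_0,\qquad \widehat Q_2=\frac{1-r_1}{r_0}\widehat Q_1,$$ $$\widehat Q_n=\frac1{r_0}\left[(1-r_1)\widehat Q_{n-1}-r_2\widehat Q_{n-2}-\ldots-r_{n-1}\widehat Q_1\right],\quad n\ge 3.$$ Let $P\in(0,1)$ and let $\epsilon=\epsilon_N>0$ be determined by $K(\epsilon\sqrt N)=P$, where $K(z)=\sum_{j=-\infty}^{+\infty}(-1)^j\mathrm{e}^{-2j^2z^2}$ for $z>0$ and $K(z)=0$ for $z\le 0$. Define recurrently $$\widehat Q_1^{\mathrm{lower}}=\frac{1}{r_0+\epsilon}Q_0,\qquad \widehat Q_1^{\mathrm{upper}}=\frac{1}{r_0-\epsilon}Q_0,$$ $$\widehat Q_2^{\mathrm{lower}}=\frac{1-r_1-2\epsilon}{[r_0+\epsilon]^2}Q_0,\qquad \widehat Q_2^{\mathrm{upper}}=\frac{1-r_1+2\epsilon}{[r_0-\epsilon]^2}Q_0,$$ and, for $n\ge3$, $$\widehat Q_n^{\mathrm{lower}}=\frac{1}{r_0+\epsilon}\left[(1-r_1-2\epsilon)\widehat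 Q_{n-1}^{\mathrm{lower}}-(r_2+2\epsilon)\widehat Q_{n-2}^{\mathrm{upper}}-\ldots-(r_{n-1}+2\epsilon)\widehat Q_1^{\mathrm{upper}}\right],$$ $$\widehat Q_n^{\mathrm{upper}}=\frac{1}{r_0-\epsilon}\left[(1-r_1+2\epsilon)\widehat Q_{n-1}^{\mathrm{upper}}-(r_2-2\epsilon)\widehat Q_{n-2}^{\mathrm{lower}}-\ldots-(r_{n-1}-2\epsilon)\widehat Q_1^{\mathrm{lower}}\right].$$ Then for every $n\ge1$ these are interval estimators for $Q_n$ with confidence probability (for large samples) not smaller than $P$, that is, $$\liminf_{N\to\infty}\mathrm{Pr}\left\{\widehat Q_n^{\mathrm{lower}}<Q_n<\widehat Q_n^{\mathrm{upper}}\right\}\ge P.$$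
   Context: Characteristics. All of them satisfy $Q_n=\sum_{i=0}^nQ_{n-i+1}\int_0^\infty \mathrm{e}^{-\alpha x}\frac{(\alpha x)^i}{i!}\,\mathrm{d}G(x)$ for $n\ge 0$, which together with $Q_0$ determines $Q_1,Q_2,\ldots$; with $\rho_i=\int_0^\infty \mathrm{e}^{-\alpha x}\frac{(\alpha x)^i}{i!}\,\mathrm{d}G(x)$ this is equivalent to $Q_1=Q_0/\rho_0$, $Q_2=\frac{1-\rho_1}{\rho_0}Q_1$, $Q_n=\frac1{\rho_0}[(1-\rho_1)Q_{n-1}-\rho_2Q_{n-2}-\ldots-\rho_{n-1}Q_1]$ for $n\ge3$. Here $G$ is the distribution function of a positive random variable. (1) $M/GI/1/n$ queue: Poisson arrivals with known rate $\lambda$, service-time distribution function $B$ with known mean $b$, and $n$ waiting places (not counting the place in service). Here $\alpha=\lambda$, $G=B$, and $Q_n$ is one of: $\mathrm{E}T_n$, the expected length of a busy period ($Q_0=b$); $\mathrm{E}\nu_n$, the expected number of customers served during a busy period ($Q_0=1$); $\mathrm{E}L_n-1$, where $L_n$ is the number of customers lost during a busy period ($Q_0=\lambda b-1$). (2) $GI/M/1/n-1$ queue: interarrival distribution function $A$, exponential service times with known parameter $\mu$, $n-1$ waiting places (not counting the place in service), stationary loss probability $\pi_n$, $\pi_0=1$. Here $\alpha=\mu$, $G=A$, $Q_n=1/\pi_n$ ($Q_0=1$). The empirical distribution function $G_{\mathrm{emp}}(x,N)$ is the fraction of the $N$ observations that are less than or equal to $x$. Conventions. If $r_0\le\epsilon$,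 the upper bounds $\widehat Q_n^{\mathrm{upper}}$ are set equal to $+\infty$. If $1-r_1-2\epsilon$ is negative, $\widehat Q_2^{\mathrm{lower}}$ is set equal to $0$, and in $\widehat Q_n^{\mathrm{lower}}$, $n\ge3$, the term $1-r_1-2\epsilon$ is set to $0$. Known fact fixing the choice of $\epsilon$ (Kolmogorov's theorem): with $\delta_N=\sup_{x>0}|G(x)-G_{\mathrm{emp}}(x,N)|$, $\lim_{N\to\infty}\mathrm{Pr}\{\delta_N<z/\sqrt N\}=K(z)$.
   Formalization: The initial value Q_0 is assumed positive; this only restricts the case E L_n - 1 to λb > 1, since for λb = 1 both bounds and Q_n are 0 and for λb < 1 the lower bound eventually exceeds the upper one, so the claim fails. *)

theory Defs
  imports "HOL-Probability.Probability"
begin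

subsection \<open>Queueing characteristics\<close>

abbreviation exponential :: "real \<Rightarrow> real measure" where
  "exponential lam \<equiv> density lborel (\<lambda>x. ennreal (exponential_density lam x))"

text \<open>
  A busy period of the \<open>M/GI/1/n\<close> queue. At time 0 a customer arrives at the empty system and
  its service starts. The outcome is \<open>(s, e)\<close>: \<open>s k\<close> is the duration of the service number \<open>k\<close>
  (counted from 0) and \<open>e j\<close> are the interarrival times of the Poisson arrivals after time 0.
\<close>

definition mgi1_space :: "real \<Rightarrow> real measure \<Rightarrow> ((nat \<Rightarrow> real) \<times> (nat \<Rightarrow> real)) measure" where
  "mgi1_space lam B = (\<Pi>\<^sub>M k\<in>UNIV. B) \<Otimes>\<^sub>M (\<Pi>\<^sub>M j\<in>UNIV. exponential lam)"

definition arrivals_in_service :: "(nat \<Rightarrow> real) \<times> (nat \<Rightarrow> real) \<Rightarrow> nat \<Rightarrow> nat" where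
  "arrivals_in_service = (\<lambda>(s, e) k.
     card {j. (\<Sum>i<k. s i) < (\<Sum>i\<le>j. e i) \<and> (\<Sum>i\<le>j. e i) \<le> (\<Sum>i\<le>k. s i)})"

text \<open>
  \<open>mgi1_content n \<omega> k\<close> is the number of customers left in the system after \<open>k\<close> services. At most
  \<open>n + 1\<close> customers are present at any time (one in service, \<open>n\<close> waiting); the others are lost.
  The values are meaningful up to the first \<open>k\<close> with content 0, which ends the busy period.
\<close>

primrec mgi1_content :: "nat \<Rightarrow> (nat \<Rightarrow> real) \<times> (nat \<Rightarrow> real) \<Rightarrow> nat \<Rightarrow> nat" where
  "mgi1_content n \<omega> 0 = 1"
| "mgi1_content n \<omega> (Suc k) = min (mgi1_content n \<omega> k + arrivals_in_service \<omega> k) (n + 1) - 1"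

definition mgi1_served :: "nat \<Rightarrow> (nat \<Rightarrow> real) \<times> (nat \<Rightarrow> real) \<Rightarrow> nat" where
  "mgi1_served n \<omega> = (LEAST k. mgi1_content n \<omega> k = 0)"

definition mgi1_busy_period :: "nat \<Rightarrow> (nat \<Rightarrow> real) \<times> (nat \<Rightarrow> real) \<Rightarrow> real" where
  "mgi1_busy_period n \<omega> = (\<Sum>k<mgi1_served n \<omega>. fst \<omega> k)"

text \<open>The subtraction is truncated: it counts the arrivals that find all waiting places occupied.\<close>

definition mgi1_lost :: "nat \<Rightarrow> (nat \<Rightarrow> real) \<times> (nat \<Rightarrow> real) \<Rightarrow> nat" where
  "mgi1_lost n \<omega> =
     (\<Sum>k<mgi1_served n \<omega>. (mgi1_content n \<omega> k + arrivals_in_service \<omega> k) - (n + 1))"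

text \<open>
  The \<open>GI/M/1/n-1\<close> queue at arrival epochs. If an arriving customer finds \<open>i\<close> customers, then
  \<open>m = min (i + 1) n\<close> are present just after the arrival, since a customer who finds \<open>n\<close> is lost.
  During the next interarrival time \<open>x\<close> these are served one after another, with service times
  \<open>v 0, v 1, \<dots>\<close>; by lack of memory the residual time of a running service is exponential too.
\<close>

definition gim1_transition :: "real \<Rightarrow> real measure \<Rightarrow> nat \<Rightarrow> nat \<Rightarrow> nat \<Rightarrow> real" where
  "gim1_transition \<mu> A n i j =
     \<P>((x, v) in A \<Otimes>\<^sub>M (\<Pi>\<^sub>M k\<in>UNIV. exponential \<mu>).
        min (i + 1) n - card {k. k < min (i + 1) n \<and> (\<Sum>l\<le>k. v l) \<le> x} = j)"

definition gim1_stationary :: "real \<Rightarrow> real measure \<Rightarrow> nat \<Rightarrow> (nat \<Rightarrow> real) \<Rightarrow> bool" where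
  "gim1_stationary \<mu> A n p \<longleftrightarrow>
     (\<forall>j\<le>n. 0 \<le> p j) \<and> (\<Sum>j\<le>n. p j) = 1 \<and>
     (\<forall>j\<le>n. p j = (\<Sum>i\<le>n. p i * gim1_transition \<mu> A n i j))"

definition gim1_loss_prob :: "real \<Rightarrow> real measure \<Rightarrow> nat \<Rightarrow> real" where
  "gim1_loss_prob \<mu> A n =
     (if n = 0 then 1 else THE \<pi>. \<exists>p. gim1_stationary \<mu> A n p \<and> \<pi> = p n)"

text \<open>\<open>queueing_characteristic \<alpha> G Q0 Q\<close>: the sequence \<open>Q\<close> is one of the four characteristics of
  the queue with known rate \<open>\<alpha>\<close> and input distribution \<open>G\<close>, and \<open>Q0\<close> is its known initial value.\<close>

inductive queueing_characteristic ::
  "real \<Rightarrow> real measure \<Rightarrow> real \<Rightarrow> (nat \<Rightarrow> real) \<Rightarrow> bool" for \<alpha> G where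
  busy_period: "integrable G (\<lambda>x. x) \<Longrightarrow> b = (\<integral>x. x \<partial>G) \<Longrightarrow>
    queueing_characteristic \<alpha> G b
      (\<lambda>n. \<integral>\<omega>. mgi1_busy_period n \<omega> \<partial>mgi1_space \<alpha> G)"
| served: "integrable G (\<lambda>x. x) \<Longrightarrow>
    queueing_characteristic \<alpha> G 1
      (\<lambda>n. \<integral>\<omega>. real (mgi1_served n \<omega>) \<partial>mgi1_space \<alpha> G)"
| lost: "integrable G (\<lambda>x. x) \<Longrightarrow> b = (\<integral>x. x \<partial>G) \<Longrightarrow>
    queueing_characteristic \<alpha> G (\<alpha> * b - 1)
      (\<lambda>n. (\<integral>\<omega>. real (mgi1_lost n \<omega>) \<partial>mgi1_space \<alpha> G) - 1)"
| loss_prob: "queueing_characteristic \<alpha> G 1 (\<lambda>n. 1 / gim1_loss_prob \<alpha> G n)"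


subsection \<open>Estimators\<close>

definition emp_cdf :: "(nat \<Rightarrow> real) \<Rightarrow> nat \<Rightarrow> real \<Rightarrow> real" where
  "emp_cdf x N t = real (card {k. k < N \<and> x k \<le> t}) / real N"

definition emp_weight :: "real \<Rightarrow> (nat \<Rightarrow> real) \<Rightarrow> nat \<Rightarrow> nat \<Rightarrow> real" where
  "emp_weight \<alpha> x N i =
     (LINT t:{0..}|interval_measure (emp_cdf x N). exp (- \<alpha> * t) * ((\<alpha> * t) ^ i / fact i))"

definition kolmogorov_K :: "real \<Rightarrow> real" where
  "kolmogorov_K z =
     (if z > 0 then \<Sum>\<^sub>\<infinity>j\<in>(UNIV :: int set). (- 1) powi j * exp (- 2 * (of_int j)\<^sup>2 * z\<^sup>2) else 0)"

function Q_point :: "(nat \<Rightarrow> real) \<Rightarrow> real \<Rightarrow> nat \<Rightarrow> real" where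
  "Q_point r Q0 n =
     (if n = 0 then Q0
      else if n = 1 then 1 / r 0 * Q0
      else if n = 2 then (1 - r 1) / r 0 * Q_point r Q0 1
      else 1 / r 0 * ((1 - r 1) * Q_point r Q0 (n - 1) - (\<Sum>i\<in>{2..n - 1}. r i * Q_point r Q0 (n - i))))"
  by pat_completeness auto
termination
  by (relation "Wellfounded.measure (\<lambda>(r, Q0, n). n)") auto

declare Q_point.simps [simp del]

text \<open>
  The bounds are extended reals because \<open>Q_upper\<close> is \<open>\<infinity>\<close> when \<open>r 0 \<le> \<epsilon>\<close>. The value \<open>\<infinity>\<close> enters
  \<open>Q_lower\<close> only with a negative sign, so \<open>\<infinity> - \<infinity>\<close> does not occur. The term \<open>max 0 (1 - r 1 - 2 * \<epsilon>)\<close>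
  implements the convention that a negative \<open>1 - r 1 - 2 * \<epsilon>\<close> is replaced by 0. The values at
  \<open>n = 0\<close> are not used.
\<close>

function Q_lower :: "(nat \<Rightarrow> real) \<Rightarrow> real \<Rightarrow> real \<Rightarrow> nat \<Rightarrow> ereal"
  and Q_upper :: "(nat \<Rightarrow> real) \<Rightarrow> real \<Rightarrow> real \<Rightarrow> nat \<Rightarrow> ereal" where
  "Q_lower r \<epsilon> Q0 n =
     (if n = 0 then ereal Q0
      else if n = 1 then ereal (1 / (r 0 + \<epsilon>) * Q0)
      else if n = 2 then ereal (max 0 (1 - r 1 - 2 * \<epsilon>) / (r 0 + \<epsilon>)\<^sup>2 * Q0)
      else ereal (1 / (r 0 + \<epsilon>)) *
        (ereal (max 0 (1 - r 1 - 2 * \<epsilon>)) * Q_lower r \<epsilon> Q0 (n - 1)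
          - (\<Sum>i\<in>{2..n - 1}. ereal (r i + 2 * \<epsilon>) * Q_upper r \<epsilon> Q0 (n - i))))"
| "Q_upper r \<epsilon> Q0 n =
     (if n = 0 then ereal Q0
      else if r 0 \<le> \<epsilon> then \<infinity>
      else if n = 1 then ereal (1 / (r 0 - \<epsilon>) * Q0)
      else if n = 2 then ereal ((1 - r 1 + 2 * \<epsilon>) / (r 0 - \<epsilon>)\<^sup>2 * Q0)
      else ereal (1 / (r 0 - \<epsilon>)) *
        (ereal (1 - r 1 + 2 * \<epsilon>) * Q_upper r \<epsilon> Q0 (n - 1)
          - (\<Sum>i\<in>{2..n - 1}. ereal (r i - 2 * \<epsilon>) * Q_lower r \<epsilon> Q0 (n - i))))"
  by pat_completeness auto
termination
  by (relation "Wellfounded.measure (case_sum (\<lambda>(r, e, Q0, n). n) (\<lambda>(r, e, Q0, n). n))") auto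

declare Q_lower.simps [simp del] Q_upper.simps [simp del]

end

theory Submission
  imports Defs "HOL-Library.Landau_Symbols"
begin

text \<open>
  Kolmogorov's theorem itself is not needed. To first order in \<open>\<epsilon> = O(1 / \<surd>N)\<close> the bounds are
  \<open>Q\<^sub>n - A \<mp> c \<epsilon>\<close>, where \<open>A\<close> is a linear functional of the deviations \<open>r\<^sub>i - \<rho>\<^sub>i\<close>, hence the
  deviation from its mean of an average of i.i.d. variables \<open>h (X k)\<close>, and the recurrences give
  oscillation at most \<open>c\<close> for \<open>h\<close>. So \<open>h (X k)\<close> has standard deviation at most \<open>c / 2\<close>, and by
  the central limit theorem \<open>\<bar>A\<bar> < c \<epsilon>\<close> has asymptotic probability at least
  \<open>Pr (\<bar>Z\<bar> \<le> 2 z)\<close> for a standard normal \<open>Z\<close> and \<open>z = \<epsilon> \<surd>N\<close>. This is at least \<open>K z = P\<close>.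

  That \<open>Q\<close> satisfies the recurrence follows for the \<open>M/GI/1/n\<close> queue from the first-step equations
  of the embedded random walk (the Poisson process restarts after the first service), whose unique
  solution is a partial sum of the recurrent sequence, and for the \<open>GI/M/1/n-1\<close> queue from the
  balance of flow across the cuts of the state space.
\<close>

section \<open>The Kolmogorov distribution and the normal distribution\<close>

text \<open>The inequality between K and the normal law has a probabilistic origin. K is the
  distribution function of the largest absolute value of a Brownian bridge, whose value at time 1/2
  is normal with standard deviation 1/2; the maximum stays below z only if this value does, that is,
  if a standard normal variable stays below 2 z in absolute value. The proof here is analytic. It
  splits at z = 0.4, because near 0 the first terms of the alternating series say nothing about K.
  Two obstacles shape the confidence argument. The expansion is accurate to o(1 / sqrt N) only while
  the deviations of all weights are O(1 / sqrt N), so the main event is intersected with control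
  events, one for each weight, of probability close to 1. Moreover, K z = P is exploited only
  through inequalities, so \<open>z N\<close> may vary with N; it is confined to a bounded interval,
  and a gap between two normal quantiles pays for the expansion error.\<close>

lemma alternating_unimodal_sum_le:
  fixes g :: "nat \<Rightarrow> real"
  assumes nonneg: "\<And>j. 0 \<le> g j" and le: "\<And>j. g j \<le> M"
    and unimodal: "\<And>j. g (Suc j) \<le> g j \<Longrightarrow> g (Suc (Suc j)) \<le> g (Suc j)"
  shows "(\<Sum>k<m. g (2 * k) - g (2 * k + 1)) \<le> M"
proof -
  let ?S = "\<lambda>m. \<Sum>k<m. g (2 * k) - g (2 * k + 1)"
  \<comment> \<open>Up to the peak every pair contributes at most 0. After it each pair is at most
    \<open>g (2 * k) - g (2 * k + 2)\<close>, which telescopes; the first descending pair starts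
    from a height of at most \<open>M\<close>.\<close>
  have "?S m \<le> 0 \<or> (?S m \<le> M - g (2 * m) \<and> g (Suc (2 * m)) \<le> g (2 * m))"
  proof (induction m)
    case (Suc m)
    show ?case
    proof (cases "g (Suc (2 * m)) \<le> g (2 * m)")
      case True
      with unimodal have 1: "g (Suc (Suc (2 * m))) \<le> g (Suc (2 * m))" by blast
      then have 2: "g (Suc (Suc (Suc (2 * m)))) \<le> g (Suc (Suc (2 * m)))" by (rule unimodal)
      from Suc le[of "2 * m"] 1 2 show ?thesis by auto
    next
      case False
      with Suc show ?thesis by auto
    qed
  qed simp
  with nonneg[of "2 * m"] le[of 0] nonneg[of 0] show ?thesis by (smt (verit))
qed

text \<open>The terms at j and -j agree, so the sum over the integers is twice the sum over the
  naturals minus the term 1 at j = 0.\<close>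

lemma kolmogorov_K_sums:
  assumes "0 < z"
  shows "(\<lambda>n. (- 1) ^ n * exp (- 2 * (real n)\<^sup>2 * z\<^sup>2)) sums ((kolmogorov_K z + 1) / 2)"
proof -
  let ?a = "\<lambda>n. (- 1) ^ n * exp (- 2 * (real n)\<^sup>2 * z\<^sup>2) :: real"
  let ?f = "\<lambda>j::int. (- 1) powi j * exp (- 2 * (of_int j)\<^sup>2 * z\<^sup>2) :: real"
  define q where "q = exp (- 2 * z\<^sup>2)"
  have q: "0 < q" "q < 1" using assms by (auto simp: q_def)
  have nrm: "norm (?a n) \<le> q ^ n" for n
  proof -
    have "norm (?a n) = exp (- 2 * (real n)\<^sup>2 * z\<^sup>2)"
      by (simp add: abs_mult)
    also have "\<dots> = q ^ (n * n)"
      by (simp add: q_def exp_of_nat_mult[symmetric] power2_eq_square algebra_simps)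
    also have "\<dots> \<le> q ^ n"
      using q by (intro power_decreasing) (auto simp: le_square)
    finally show ?thesis .
  qed
  have sn: "summable (\<lambda>n. norm (?a n))"
    by (rule summable_comparison_test'[of "\<lambda>n. q ^ n" 0]) (use nrm q in auto)
  then have "summable ?a" by (rule summable_norm_cancel)
  then obtain s where s: "?a sums s" by blast
  then have s1: "(\<lambda>n. ?a (Suc n)) sums (s - 1)"
    by (subst sums_Suc_iff) simp
  have sn1: "summable (\<lambda>n. norm (?a (Suc n)))"
    using sn by (subst summable_Suc_iff)
  have h0: "(?a has_sum s) UNIV" by (rule norm_summable_imp_has_sum[OF sn s])
  have h1: "((\<lambda>n. ?a (Suc n)) has_sum (s - 1)) UNIV" by (rule norm_summable_imp_has_sum[OF sn1 s1])
  have "(?f has_sum s) (range int)"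
    using h0 by (subst has_sum_reindex) (auto simp: o_def)
  moreover have "(?f has_sum (s - 1)) (range (\<lambda>n. - int (Suc n)))"
    using h1 
    by (subst has_sum_reindex) 
       (auto simp: o_def inj_on_def power_int_minus power_int_def power2_eq_square algebra_simps nat_add_distrib
        power_inverse[symmetric]
          simp del: of_nat_Suc)
  moreover have "range int \<inter> range (\<lambda>n. - int (Suc n)) = {}" by auto
  ultimately have "(?f has_sum (s + (s - 1))) (range int \<union> range (\<lambda>n. - int (Suc n)))"
    by (rule has_sum_Un_disjoint)
  also have "range int \<union> range (\<lambda>n. - int (Suc n)) = UNIV"
  proof -
    have "j \<in> range int \<union> range (\<lambda>n. - int (Suc n))" for j by (cases j rule: int_cases) auto
    then show ?thesis by auto
  qed
  finally have "kolmogorov_K z = s + (s - 1)"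
    using assms by (simp add: kolmogorov_K_def infsumI)
  then have "s = (kolmogorov_K z + 1) / 2" by simp
  with s show ?thesis by simp
qed

text \<open>Leibniz criterion: stopping after two terms underestimates the one-sided series,
  stopping after three overestimates it.\<close>

lemma kolmogorov_K_bounds:
  assumes "0 < z"
  shows "1 - 2 * exp (- 2 * z\<^sup>2) \<le> kolmogorov_K z"
    and "kolmogorov_K z \<le> 1 - 2 * exp (- 2 * z\<^sup>2) + 2 * exp (- 8 * z\<^sup>2)"
proof -
  let ?b = "\<lambda>n. exp (- 2 * (real n)\<^sup>2 * z\<^sup>2) :: real"
  let ?a = "\<lambda>n. (- 1) ^ n * ?b n"
  have sums: "?a sums ((kolmogorov_K z + 1) / 2)" by (rule kolmogorov_K_sums[OF assms])
  have "summable (\<lambda>n. norm (?a n))"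
  proof (rule summable_comparison_test'[of "\<lambda>n. exp (- 2 * z\<^sup>2) ^ n" 0])
    fix n :: nat
    have "real n \<le> real n * real n" by (metis le_square of_nat_le_iff of_nat_mult)
    then have "real n * (2 * z\<^sup>2) \<le> (real n)\<^sup>2 * (2 * z\<^sup>2)"
      by (intro mult_right_mono) (auto simp: power2_eq_square)
    then show "norm (norm (?a n)) \<le> exp (- 2 * z\<^sup>2) ^ n"
      by (simp add: abs_mult exp_of_nat_mult[symmetric] algebra_simps)
  qed (use assms in auto)
  then have lim: "?b \<longlonglongrightarrow> 0" 
    by (auto dest!: summable_LIMSEQ_zero simp: abs_mult)
  have dec: "?b (Suc n) \<le> ?b n" for n
  proof -
    have "(real n)\<^sup>2 \<le> (real (Suc n))\<^sup>2" by (intro power_mono) auto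
    then have "(real n)\<^sup>2 * z\<^sup>2 \<le> (real (Suc n))\<^sup>2 * z\<^sup>2" by (intro mult_right_mono) auto
    then show ?thesis by simp
  qed
  note L = summable_Leibniz'[OF lim _ dec]
  have eq: "suminf ?a = (kolmogorov_K z + 1) / 2" using sums by (rule sums_unique[symmetric])
  have "(\<Sum>i<2*1. ?a i) \<le> suminf ?a" by (rule L) simp
  then show "1 - 2 * exp (- 2 * z\<^sup>2) \<le> kolmogorov_K z"
    unfolding eq by (simp add: eval_nat_numeral)
  have "suminf ?a \<le> (\<Sum>i<2*1+1. ?a i)" by (rule L) simp
  then show "kolmogorov_K z \<le> 1 - 2 * exp (- 2 * z\<^sup>2) + 2 * exp (- 8 * z\<^sup>2)"
    unfolding eq by (simp add: eval_nat_numeral)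
qed

text \<open>The maximum is attained at x = 1; it comes from 1 + y \<le> exp y at y = x^2 -
  1.\<close>

lemma mult_exp_neg_half_sq_le:
  fixes x :: real
  assumes "0 \<le> x"
  shows "x * exp (- x\<^sup>2 / 2) \<le> exp (- 1 / 2)"
proof -
  have "x\<^sup>2 \<le> exp (x\<^sup>2 - 1)" using exp_ge_add_one_self[of "x\<^sup>2 - 1"] by simp
  also have "\<dots> = (exp ((x\<^sup>2 - 1) / 2))\<^sup>2" by (simp add: power2_eq_square exp_add[symmetric])
  finally have "x \<le> exp ((x\<^sup>2 - 1) / 2)" by (rule power2_le_imp_le) simp
  then have "x * exp (- x\<^sup>2 / 2) \<le> exp ((x\<^sup>2 - 1) / 2) * exp (- x\<^sup>2 / 2)" by (intro mult_right_mono) auto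
  also have "\<dots> = exp (- 1 / 2)" by (simp add: exp_add[symmetric] field_simps)
  finally show ?thesis .
qed

text \<open>Meant for small \<open>z\<close>. Adding the one-sided series to its shift turns K into
  an alternating sum of the decrements \<open>g\<close> of exp (- x^2 / 2) along a grid of mesh
  \<open>u\<close>. These rise to one peak and then fall, so the sum is at most any bound on a
  single decrement; by the mean value theorem, \<open>u\<close> times the steepest slope exp (- 1 /
  2) is such a bound.\<close>

lemma kolmogorov_K_le_linear:
  assumes "0 < z"
  shows "kolmogorov_K z \<le> exp (- 1 / 2) * (2 * z)"
proof -
  define u where "u = 2 * z"
  define f where "f = (\<lambda>n::nat. exp (- (real n * u)\<^sup>2 / 2))"
  define g where "g = (\<lambda>n. f n - f (Suc n))"
  have u: "0 < u" using assms by (simp add: u_def)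
  have "(\<lambda>n. (- 1) ^ n * f n) sums ((kolmogorov_K z + 1) / 2)"
    using kolmogorov_K_sums[OF assms] by (simp add: f_def u_def power_mult_distrib algebra_simps)
  note sums0 = this
  have "(kolmogorov_K z + 1) / 2 = (kolmogorov_K z + 1) / 2 - 1 + (- 1) ^ 0 * f 0" by (simp add: f_def field_simps)
  with sums0 have "(\<lambda>n. (- 1) ^ n * f n) sums ((kolmogorov_K z + 1) / 2 - 1 + (- 1) ^ 0 * f 0)"
    by (simp only:)
  then have "(\<lambda>n. (- 1) ^ Suc n * f (Suc n)) sums ((kolmogorov_K z + 1) / 2 - 1)"
    by (rule iffD2[OF sums_Suc_iff])
  moreover have "(kolmogorov_K z + 1) / 2 + ((kolmogorov_K z + 1) / 2 - 1) = kolmogorov_K z"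
    by (simp add: field_simps)
  ultimately have "(\<lambda>n. (- 1) ^ n * f n + (- 1) ^ Suc n * f (Suc n)) sums kolmogorov_K z"
    using sums_add[OF sums0] by metis
  then have "(\<lambda>n. (- 1) ^ n * g n) sums kolmogorov_K z"
    by (simp add: g_def algebra_simps)
  then have "(\<lambda>m. \<Sum>n<m. (- 1) ^ n * g n) \<longlonglongrightarrow> kolmogorov_K z" by (simp add: sums_def)
  then have "(\<lambda>m. \<Sum>n<2*m. (- 1) ^ n * g n) \<longlonglongrightarrow> kolmogorov_K z"
    by (rule LIMSEQ_subseq_LIMSEQ[unfolded o_def, of _ _ "\<lambda>m. 2 * m"]) (auto simp: strict_mono_def)
  moreover have "(\<Sum>n<2*m. (- 1) ^ n * g n) = (\<Sum>k<m. g (2 * k) - g (2 * k + 1))" for m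
    by (induction m) auto
  ultimately have lim: "(\<lambda>m. \<Sum>k<m. g (2 * k) - g (2 * k + 1)) \<longlonglongrightarrow> kolmogorov_K z" by simp
  define q where "q = exp (- u\<^sup>2 / 2)"
  have q: "0 < q" "q < 1" using u by (auto simp: q_def)
  have f: "f n = q ^ (n\<^sup>2)" for n
    by (simp add: f_def q_def exp_of_nat_mult[symmetric] power_mult_distrib)
  have g: "g n = q ^ (n\<^sup>2) * (1 - q ^ (2 * n + 1))" for n
  proof -
    have "(Suc n)\<^sup>2 = n\<^sup>2 + (2 * n + 1)" by (simp add: power2_eq_square)
    then have "q ^ ((Suc n)\<^sup>2) = q ^ (n\<^sup>2) * q ^ (2 * n + 1)" by (simp only: power_add)
    then show ?thesis by (simp only: g_def f right_diff_distrib mult_1_right)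
  qed
  have "(\<Sum>k<m. g (2 * k) - g (2 * k + 1)) \<le> exp (- 1 / 2) * u" for m
  proof (rule alternating_unimodal_sum_le)
    fix j
    show "0 \<le> g j" unfolding g using q by (intro mult_nonneg_nonneg) (auto simp: mult_le_one power_le_one)
    let ?F = "\<lambda>x::real. exp (- x\<^sup>2 / 2)"
    have "\<exists>x. real j * u < x \<and> x < real (Suc j) * u \<and>
       ?F (real (Suc j) * u) - ?F (real j * u) = (real (Suc j) * u - real j * u) * (- (x * exp (- x\<^sup>2 / 2)))"
      using u by (intro MVT2) (auto intro!: derivative_eq_intros)
    then obtain x where x: "real j * u < x" "x < real (Suc j) * u"
       "?F (real (Suc j) * u) - ?F (real j * u) = u * (- (x * exp (- x\<^sup>2 / 2)))"
      by (auto simp: algebra_simps)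
    have "0 \<le> real j * u" using u by simp
    with x have "0 \<le> x" by linarith
    from mult_exp_neg_half_sq_le[OF this] have "u * (x * exp (- x\<^sup>2 / 2)) \<le> u * exp (- 1 / 2)"
      using u by (intro mult_left_mono) auto
    with x(3) show "g j \<le> exp (- 1 / 2) * u" by (simp add: g_def f_def mult.commute)
    define x where "x = q ^ (2 * j + 1)"
    have x: "0 < x" "x < 1" using q by (auto simp: x_def intro!: power_Suc_less_one[simplified])
    have s0: "g j = q ^ (j\<^sup>2) * (1 - x)" by (simp add: g x_def)
    have sq: "q ^ ((Suc i)\<^sup>2) = q ^ (i\<^sup>2) * q ^ (2 * i + 1)" for i
    proof -
      have "(Suc i)\<^sup>2 = i\<^sup>2 + (2 * i + 1)" by (simp add: power2_eq_square)
      then show ?thesis by (simp only: power_add)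
    qed
    have x1: "q ^ (2 * Suc j + 1) = q\<^sup>2 * x" and x2: "q ^ (2 * Suc (Suc j) + 1) = q ^ 4 * x"
      by (simp_all add: x_def eval_nat_numeral)
    have s3: "g (Suc j) = q ^ ((Suc j)\<^sup>2) * (1 - q\<^sup>2 * x)" by (simp only: g x1)
    have s1: "g (Suc j) = q ^ (j\<^sup>2) * (x * (1 - q\<^sup>2 * x))"
      by (simp only: s3 sq[of j] x_def[symmetric] mult.assoc)
    have s2: "g (Suc (Suc j)) = q ^ ((Suc j)\<^sup>2) * ((q\<^sup>2 * x) * (1 - q ^ 4 * x))"
      by (simp only: g sq[of "Suc j"] x1 x2 mult.assoc)
    \<comment> \<open>After division by a power of \<open>q\<close> the two descents read 2 x -
      \<open>q\<^sup>2\<close> x^2 \<le> 1 and the same with \<open>y = q\<^sup>2 * x\<close> for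
      \<open>x\<close>. The left side increases on [0, 1], so the first implies the second.\<close>
    assume "g (Suc j) \<le> g j"
    then have 1: "x * (1 - q\<^sup>2 * x) \<le> 1 - x" unfolding s0 s1 using q by simp
    have qs: "q\<^sup>2 < 1" "0 < q\<^sup>2" using q power_strict_mono[of q 1 2] by auto
    define y where "y = q\<^sup>2 * x"
    have y: "y \<le> x" "0 < y" using qs x by (auto simp: y_def)
    have q4: "q ^ 4 * x = q\<^sup>2 * y" by (simp add: y_def eval_nat_numeral)
    have "(x - y) * (q\<^sup>2 * (x + y)) \<le> (x - y) * 2"
      using qs x y mult_le_one[of "q\<^sup>2" "(x+y)/2"] by (intro mult_left_mono) auto
    then have "2 * y - q\<^sup>2 * y\<^sup>2 \<le> 2 * x - q\<^sup>2 * x\<^sup>2" by (simp add: algebra_simps power2_eq_square)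
    with 1 have "y * (1 - q\<^sup>2 * y) \<le> 1 - y" by (simp add: algebra_simps power2_eq_square)
    then show "g (Suc (Suc j)) \<le> g (Suc j)" unfolding s2 s3 q4 y_def[symmetric] using q by simp
  qed
  then show ?thesis unfolding u_def[symmetric] by (intro LIMSEQ_le_const2[OF lim]) auto
qed

section \<open>Normal probability of a symmetric interval\<close>

definition normal_mass :: "real \<Rightarrow> real" where
  "normal_mass t = cdf std_normal_distribution t - cdf std_normal_distribution (- t)"

lemma normal_mass_eq:
  assumes "0 \<le> t"
  shows "normal_mass t = measure std_normal_distribution {- t<..t}"
proof -
  interpret real_distribution std_normal_distribution by (rule real_dist_normal_dist)
  show ?thesis using assms by (cases "t = 0") (simp_all add: normal_mass_def cdf_diff_eq)
qed

lemma std_normal_singleton [simp]: "measure std_normal_distribution {x} = 0"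
  by (simp add: measure_def emeasure_density nn_integral_indicator_singleton)

text \<open>For c = t and y \<ge> 0, or c = - t and y \<le> 0, the cross term makes the density at c
  + y at most exp (- t^2 / 2) times the density at y. Hence each tail is at most this factor times
  its half-line, and the two half-lines have total mass 1.\<close>

lemma normal_mass_ge_tail:
  assumes "0 \<le> t"
  shows "1 - exp (- t\<^sup>2 / 2) \<le> normal_mass t"
proof -
  interpret N: real_distribution std_normal_distribution by (rule real_dist_normal_dist)
  let ?\<phi> = "\<lambda>x. ennreal (std_normal_density x)"
  let ?e = "ennreal (exp (- t\<^sup>2 / 2))"
  have shift: "?\<phi> (c + y) \<le> ?e * ?\<phi> y" if "0 \<le> c * y" "c\<^sup>2 = t\<^sup>2" for c y
  proof -
    have "exp (- (c + y)\<^sup>2 / 2) \<le> exp (- t\<^sup>2 / 2) * exp (- y\<^sup>2 / 2)"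
      using that by (simp add: exp_add[symmetric] power2_sum)
    then have "std_normal_density (c + y) \<le> exp (- t\<^sup>2 / 2) * std_normal_density y"
      by (simp add: std_normal_density_def divide_right_mono)
    then show ?thesis by (simp add: ennreal_mult'[symmetric] ennreal_leI)
  qed
  have "emeasure std_normal_distribution {t<..} = (\<integral>\<^sup>+x. ?\<phi> x * indicator {t<..} x \<partial>lborel)"
    by (simp add: emeasure_density)
  also have "\<dots> = (\<integral>\<^sup>+y. ?\<phi> (t + 1 * y) * indicator {t<..} (t + 1 * y) \<partial>lborel)"
    by (subst nn_integral_real_affine[where c=1 and t=t]) auto
  also have "\<dots> \<le> (\<integral>\<^sup>+y. ?e * (?\<phi> y * indicator {0<..} y) \<partial>lborel)"
    using assms shift[of t] by (intro nn_integral_mono) (auto split: split_indicator)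
  also have "\<dots> = ?e * emeasure std_normal_distribution {0<..}"
    by (subst nn_integral_cmult) (auto simp: emeasure_density)
  finally have 1: "emeasure std_normal_distribution {t<..} \<le> ?e * emeasure std_normal_distribution {0<..}" .
  have "emeasure std_normal_distribution {..-t} = (\<integral>\<^sup>+x. ?\<phi> x * indicator {..-t} x \<partial>lborel)"
    by (simp add: emeasure_density)
  also have "\<dots> = (\<integral>\<^sup>+y. ?\<phi> (-t + 1 * y) * indicator {..-t} (-t + 1 * y) \<partial>lborel)"
    by (subst nn_integral_real_affine[where c=1 and t="-t"]) auto
  also have "\<dots> \<le> (\<integral>\<^sup>+y. ?e * (?\<phi> y * indicator {..0} y) \<partial>lborel)"
    using assms shift[of "-t"] by (intro nn_integral_mono) (auto split: split_indicator simp: mult_nonneg_nonpos)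
  also have "\<dots> = ?e * emeasure std_normal_distribution {..0}"
    by (subst nn_integral_cmult) (auto simp: emeasure_density)
  finally have 2: "emeasure std_normal_distribution {..-t} \<le> ?e * emeasure std_normal_distribution {..0}" .
  have m1: "measure std_normal_distribution {t<..} \<le> exp (- t\<^sup>2 / 2) * measure std_normal_distribution {0<..}"
    using 1 by (simp add: N.emeasure_eq_measure ennreal_mult'[symmetric])
  have m2: "measure std_normal_distribution {..-t} \<le> exp (- t\<^sup>2 / 2) * measure std_normal_distribution {..0}"
    using 2 by (simp add: N.emeasure_eq_measure ennreal_mult'[symmetric])
  have c: "measure std_normal_distribution {a<..} = 1 - measure std_normal_distribution {..a}" for a
  proof -
    have "{a<..} = space std_normal_distribution - {..a}" by auto
    then show ?thesis using N.prob_compl[of "{..a}"] by simp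
  qed
  from m1 m2 show ?thesis
    unfolding normal_mass_def cdf_def c by (simp add: algebra_simps)
qed

text \<open>Integrates 1 - x^2 / 2 \<le> exp (- x^2 / 2) over [- t, t].\<close>

lemma normal_mass_ge_cubic:
  assumes "0 \<le> t"
  shows "2 / sqrt (2 * pi) * (t - t ^ 3 / 6) \<le> normal_mass t"
proof -
  interpret N: real_distribution std_normal_distribution by (rule real_dist_normal_dist)
  let ?c = "1 / sqrt (2 * pi)"
  have "has_bochner_integral lborel (\<lambda>x. (?c * (1 - x\<^sup>2 / 2)) * indicator {- t..t} x)
      (?c * (t - t ^ 3 / 6) - ?c * (- t - (- t) ^ 3 / 6))"
  proof (rule has_bochner_integral_FTC_Icc_real)
    show "- t \<le> t" using assms by simp
    show "((\<lambda>x. ?c * (x - x ^ 3 / 6)) has_real_derivative ?c * (1 - x\<^sup>2 / 2)) (at x)" for x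
      by (rule DERIV_cmult) (auto intro!: derivative_eq_intros simp: power2_eq_square)
  qed (auto intro!: continuous_intros)
  then have int: "integrable lborel (\<lambda>x. (?c * (1 - x\<^sup>2 / 2)) * indicator {- t..t} x)"
    and val: "(\<integral>x. (?c * (1 - x\<^sup>2 / 2)) * indicator {- t..t} x \<partial>lborel) = 2 / sqrt (2 * pi) * (t - t ^ 3 / 6)"
    by (auto simp: has_bochner_integral_iff algebra_simps)
  have "(\<integral>x. (?c * (1 - x\<^sup>2 / 2)) * indicator {- t..t} x \<partial>lborel)
      \<le> (\<integral>x. std_normal_density x * indicator {- t..t} x \<partial>lborel)"
  proof (rule integral_mono[OF int])
    show "integrable lborel (\<lambda>x. std_normal_density x * indicator {- t..t} x)"
      by (rule integrable_real_mult_indicator) auto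
    fix x :: real
    show "(?c * (1 - x\<^sup>2 / 2)) * indicator {- t..t} x \<le> std_normal_density x * indicator {- t..t} x"
      using exp_ge_add_one_self[of "- x\<^sup>2 / 2"]
      by (auto simp: std_normal_density_def divide_right_mono split: split_indicator)
  qed
  also have "\<dots> = measure std_normal_distribution {- t..t}"
  proof -
    have "measure std_normal_distribution {- t..t} = (\<integral>x. indicator {- t..t} x \<partial>std_normal_distribution)"
      by simp
    also have "\<dots> = (\<integral>x. std_normal_density x * indicator {- t..t} x \<partial>lborel)"
      by (subst integral_density) auto
    finally show ?thesis by simp
  qed
  also have "\<dots> = measure std_normal_distribution ({- t<..t} \<union> {- t})"
    using assms by (intro arg_cong[where f="measure _"]) auto
  also have "\<dots> \<le> measure std_normal_distribution {- t<..t} + measure std_normal_distribution {- t}"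
    by (rule measure_Un_le) auto
  finally show ?thesis unfolding val using normal_mass_eq[OF assms] by simp
qed

text \<open>The threshold 0.4 suits both regimes. Below it, the linear bound has slope exp (- 1 / 2)
  \<le> 8 / 13, and the cubic bound wins because 8 / 13 times 2.6 is at most 2 (1 - (2 z)^2 / 6).
  Above it, q = exp (- 2 z^2) satisfies q^3 \<le> 1 / 2, and then 1 - 2 q + 2 q^4 \<le> 1 -
  q.\<close>

lemma kolmogorov_K_le_normal_mass:
  assumes "0 < z"
  shows "kolmogorov_K z \<le> normal_mass (2 * z)"
proof (cases "z \<le> 0.4")
  case True
  \<comment> \<open>13 / 8 is the value at 1 / 2 of the quadratic Taylor polynomial of exp.\<close>
  have "exp (1/2 :: real) \<ge> 13 / 8"
    using exp_lower_Taylor_quadratic[of "1/2 :: real"] by (simp add: power2_eq_square)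
  then have e: "exp (- 1 / 2 :: real) \<le> 8 / 13"
    by (simp add: exp_minus field_simps)
  have "2 * pi \<le> 2.6\<^sup>2" using pi_approx by (simp add: power2_eq_square)
  then have s: "0 < sqrt (2 * pi)" "sqrt (2 * pi) \<le> 2.6"
    using real_le_lsqrt[of "2.6" "2 * pi"] by auto
  have "8 / 13 * 2.6 \<le> (2::real) * (1 - (2 * z)\<^sup>2 / 6)"
    using True assms mult_mono[of z "0.4" z "0.4"] by (simp add: power2_eq_square)
  moreover have "8 / 13 * sqrt (2 * pi) \<le> 8 / 13 * 2.6" using s by simp
  ultimately have "8 / 13 \<le> 2 / sqrt (2 * pi) * (1 - (2 * z)\<^sup>2 / 6)"
    using s by (simp add: field_simps)
  with e have "exp (- 1 / 2) * (2 * z) \<le> (2 / sqrt (2 * pi) * (1 - (2 * z)\<^sup>2 / 6)) * (2 * z)"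
    using assms by (intro mult_right_mono) linarith+
  also have "\<dots> = 2 / sqrt (2 * pi) * (2 * z - (2 * z) ^ 3 / 6)"
    by (simp add: algebra_simps power2_eq_square power3_eq_cube)
  also have "\<dots> \<le> normal_mass (2 * z)" using assms by (intro normal_mass_ge_cubic) auto
  finally show ?thesis using kolmogorov_K_le_linear[OF assms] by linarith
next
  case False
  define q where "q = exp (- 2 * z\<^sup>2)"
  have "0.16 \<le> z\<^sup>2" using False mult_mono[of "0.4" z "0.4" z] by (simp add: power2_eq_square)
  moreover have "(2::real) \<le> exp (6 * 0.16)"
    using exp_lower_Taylor_quadratic[of "6 * 0.16 :: real"] by (simp add: power2_eq_square)
  ultimately have "2 \<le> exp (6 * z\<^sup>2)"
    by (smt (verit) exp_le_cancel_iff)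
  then have q3: "q ^ 3 \<le> 1 / 2"
    by (simp add: q_def exp_of_nat_mult[symmetric] exp_minus field_simps)
  have q4: "exp (- 8 * z\<^sup>2) = q * q ^ 3" by (simp add: q_def exp_of_nat_mult[symmetric] exp_add[symmetric])
  have "kolmogorov_K z \<le> 1 - 2 * q + 2 * (q * q ^ 3)"
    using kolmogorov_K_bounds(2)[OF assms] unfolding q4 q_def .
  also have "\<dots> \<le> 1 - q" using mult_left_mono[OF q3, of q] by (simp add: q_def)
  also have "\<dots> \<le> normal_mass (2 * z)"
    using normal_mass_ge_tail[of "2 * z"] assms by (simp add: q_def power_mult_distrib)
  finally show ?thesis .
qed

lemma continuous_normal_mass: "isCont normal_mass t"
proof -
  interpret N: real_distribution std_normal_distribution by (rule real_dist_normal_dist)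
  have cdf: "isCont (cdf std_normal_distribution) x" for x by (simp add: N.isCont_cdf)
  have "isCont (\<lambda>t. cdf std_normal_distribution (- t)) t"
    by (rule isCont_o2[OF _ cdf]) simp
  with cdf[of t] show ?thesis unfolding normal_mass_def by (rule continuous_diff)
qed

lemma normal_mass_mono: "s \<le> t \<Longrightarrow> normal_mass s \<le> normal_mass t"
proof -
  interpret N: real_distribution std_normal_distribution by (rule real_dist_normal_dist)
  show "s \<le> t \<Longrightarrow> normal_mass s \<le> normal_mass t" unfolding normal_mass_def
    using N.cdf_nondecreasing[of s t] N.cdf_nondecreasing[of "-t" "-s"] by simp
qed

text \<open>The tail bound supplies a point with mass at least \<open>p\<close>; the rest is the
  intermediate value theorem.\<close>

lemma normal_mass_surj:
  assumes "0 < p" "p < 1"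
  obtains t where "0 < t" "normal_mass t = p"
proof -
  have "\<exists>t\<ge>0. exp (- t\<^sup>2 / 2) \<le> 1 - p"
    using assms by (intro exI[of _ "sqrt (2 * (- ln (1 - p)))"]) simp
  then obtain T where T: "0 \<le> T" "p \<le> normal_mass T"
    using normal_mass_ge_tail by (smt (verit))
  moreover have "normal_mass 0 = 0" by (simp add: normal_mass_def)
  ultimately obtain t where "0 \<le> t" "normal_mass t = p"
    using IVT[of normal_mass 0 p T] continuous_normal_mass assms by auto
  with assms \<open>normal_mass 0 = 0\<close> show ?thesis by (intro that[of t]) (cases "t = 0", auto)
qed

section \<open>Restarting a Poisson process\<close>

definition poisson_weight :: "real \<Rightarrow> nat \<Rightarrow> real \<Rightarrow> real" where
  "poisson_weight a i t = exp (- a * t) * ((a * t) ^ i / fact i)"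

lemma poisson_weight_nonneg: "0 < a \<Longrightarrow> 0 \<le> t \<Longrightarrow> 0 \<le> poisson_weight a i t"
  by (simp add: poisson_weight_def)

lemma poisson_weight_measurable [measurable]: "poisson_weight a i \<in> borel_measurable borel"
  unfolding poisson_weight_def by measurable

lemma poisson_weight_sums: "(\<lambda>i. poisson_weight a i t) sums 1"
proof -
  have "(\<lambda>i. (a * t) ^ i / fact i) sums exp (a * t)"
    using exp_converges[of "a * t"] by (simp add: divide_inverse mult.commute)
  from sums_mult[OF this, of "exp (- a * t)"] show ?thesis
    by (simp add: poisson_weight_def exp_add[symmetric])
qed

lemma poisson_weight_le_1: 
  assumes "0 < a" "0 \<le> t"
  shows "poisson_weight a i t \<le> 1"
proof -
  have "sum (\<lambda>i. poisson_weight a i t) {i} \<le> 1"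
    using assms poisson_weight_sums[of a t]
    by (subst sums_unique[OF poisson_weight_sums[of a t]], intro sum_le_suminf)
       (auto simp: sums_iff poisson_weight_nonneg)
  then show ?thesis by simp
qed

lemma suminf_poisson_weight_ennreal:
  assumes "0 < a" "0 \<le> t"
  shows "(\<Sum>i. ennreal (poisson_weight a i t)) = 1"
  using poisson_weight_sums[of a t] assms
  by (subst suminf_ennreal_eq[where x=1]) (auto simp: poisson_weight_nonneg)

section \<open>Arrival epochs, counts and the residual arrival sequence\<close>

definition arrival_time :: "(nat \<Rightarrow> real) \<Rightarrow> nat \<Rightarrow> real" where
  "arrival_time e m = (\<Sum>i<m. e i)"

lemma arrival_time_0 [simp]: "arrival_time e 0 = 0"
  and arrival_time_Suc: "arrival_time e (Suc m) = arrival_time e m + e m"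
  by (simp_all add: arrival_time_def)

lemma arrival_time_case_nat [simp]:
  "arrival_time (case_nat x e) (Suc m) = x + arrival_time e m"
  by (simp only: arrival_time_def sum.lessThan_Suc_shift) simp

text \<open>All epochs up to the k-th are constrained, not only the k-th. This makes the recursion
  over the first gap in \<open>count_is_case_nat_Suc\<close> valid without any sign condition on the
  gaps.\<close>

definition count_is :: "(nat \<Rightarrow> real) \<Rightarrow> real \<Rightarrow> nat \<Rightarrow> bool" where
  "count_is e t k \<longleftrightarrow> (\<forall>m\<le>k. arrival_time e m \<le> t) \<and> t < arrival_time e (Suc k)"

definition residual :: "real \<Rightarrow> nat \<Rightarrow> (nat \<Rightarrow> real) \<Rightarrow> nat \<Rightarrow> real" where
  "residual t k e = case_nat (arrival_time e (Suc k) - t) (\<lambda>j. e (k + Suc j))"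

definition arrival_count :: "real \<Rightarrow> (nat \<Rightarrow> real) \<Rightarrow> nat" where
  "arrival_count t e = card {j. arrival_time e (Suc j) \<le> t}"

lemma arrival_time_mono:
  assumes "\<And>j. 0 \<le> e j" "m \<le> k"
  shows "arrival_time e m \<le> arrival_time e k"
  unfolding arrival_time_def using assms by (intro sum_mono2) auto

lemma count_is_imp_arrival_set:
  assumes "\<And>j. 0 \<le> e j" "count_is e t k"
  shows "{j. arrival_time e (Suc j) \<le> t} = {..<k}"
proof -
  have "arrival_time e (Suc j) \<le> t \<longleftrightarrow> j < k" for j
  proof (cases "j < k")
    case True
    with assms(2) show ?thesis by (auto simp: count_is_def)
  next
    case False
    then have "arrival_time e (Suc k) \<le> arrival_time e (Suc j)"
      using assms(1) by (intro arrival_time_mono) auto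
    with assms(2) False show ?thesis by (auto simp: count_is_def)
  qed
  then show ?thesis by auto
qed

lemma count_is_imp_arrival_count:
  assumes "\<And>j. 0 \<le> e j" "count_is e t k"
  shows "arrival_count t e = k"
  using count_is_imp_arrival_set[OF assms] by (simp add: arrival_count_def)

lemma count_is_case_nat_0: "0 \<le> t \<Longrightarrow> count_is (case_nat x e) t 0 \<longleftrightarrow> t < x"
  by (simp add: count_is_def)

lemma count_is_case_nat_Suc:
  assumes "0 \<le> t"
  shows "count_is (case_nat x e) t (Suc k) \<longleftrightarrow> x \<le> t \<and> count_is e (t - x) k"
proof -
  have split: "(\<forall>m\<le>Suc k. P m) \<longleftrightarrow> P 0 \<and> (\<forall>m\<le>k. P (Suc m))" for P
    by (metis Suc_le_mono not0_implies_Suc zero_le)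
  have "(\<forall>m\<le>Suc k. arrival_time (case_nat x e) m \<le> t) \<longleftrightarrow> (\<forall>m\<le>k. x + arrival_time e m \<le> t)"
    using assms by (subst split) simp
  moreover have "x \<le> t" if "\<forall>m\<le>k. x + arrival_time e m \<le> t"
    using that[rule_format, of 0] by simp
  ultimately show ?thesis unfolding count_is_def by (auto simp: algebra_simps)
qed

lemma residual_case_nat_0: "residual t 0 (case_nat x e) = case_nat (x - t) e"
  by (auto simp: residual_def fun_eq_iff split: nat.split)

lemma residual_case_nat_Suc: "residual t (Suc k) (case_nat x e) = residual (t - x) k e"
  by (auto simp: residual_def fun_eq_iff split: nat.split)

text \<open>Fubini after splitting off the first coordinate; it opens every argument that conditions
  on the first gap or the first service time.\<close>

lemma (in sequence_space) nn_integral_case_nat: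
  assumes [measurable]: "F \<in> borel_measurable S"
  shows "(\<integral>\<^sup>+e. F e \<partial>S) = (\<integral>\<^sup>+x. (\<integral>\<^sup>+e. F (case_nat x e) \<partial>S) \<partial>M)"
proof -
  have "(\<integral>\<^sup>+e. F e \<partial>S) = (\<integral>\<^sup>+e. F e \<partial>distr (M \<Otimes>\<^sub>M S) S (\<lambda>(x, e). case_nat x e))"
    by (simp only: PiM_iter)
  also have "\<dots> = (\<integral>\<^sup>+p. F (case p of (x, e) \<Rightarrow> case_nat x e) \<partial>(M \<Otimes>\<^sub>M S))"
    by (rule nn_integral_distr) measurable
  also have "\<dots> = (\<integral>\<^sup>+x. (\<integral>\<^sup>+e. F (case_nat x e) \<partial>S) \<partial>M)"
    by (subst P.nn_integral_fst[symmetric]) auto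
  finally show ?thesis .
qed

locale exponential_sequence =
  fixes a :: real
  assumes a_pos: "0 < a"

sublocale exponential_sequence \<subseteq> E: prob_space "exponential a"
  using a_pos by (rule prob_space_exponential_density)

sublocale exponential_sequence \<subseteq> sequence_space "exponential a"
  by unfold_locales

context exponential_sequence
begin

lemma arrival_time_measurable [measurable]: "(\<lambda>e. arrival_time e m) \<in> borel_measurable S"
  unfolding arrival_time_def by measurable

lemma count_is_measurable [measurable]: "Measurable.pred S (\<lambda>e. count_is e t k)"
  unfolding count_is_def by measurable

lemma residual_measurable [measurable]: "residual t k \<in> measurable S S"
proof -
  have "(\<lambda>e j. residual t k e j) \<in> measurable S S"
  proof (rule measurable_abs_UNIV)
    show "(\<lambda>e. residual t k e j) \<in> measurable S (exponential a)" for j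
      unfolding residual_def by (cases j) simp_all
  qed
  then show ?thesis by simp
qed

lemma nn_integral_exponential:
  assumes [measurable]: "f \<in> borel_measurable borel"
  shows "(\<integral>\<^sup>+x. f x \<partial>exponential a) = (\<integral>\<^sup>+x. ennreal (a * exp (- a * x)) * indicator {0..} x * f x \<partial>lborel)"
  by (subst nn_integral_density)
     (auto simp: exponential_density_def mult.commute intro!: nn_integral_cong split: split_indicator)

text \<open>Conditions on the first gap x. The factors exp (- a x) and exp (- a (t - x)) multiply to
  a constant, which leaves a polynomial in x with an explicit antiderivative.\<close>

lemma poisson_weight_Suc_integral:
  assumes "0 \<le> t"
  shows "(\<integral>\<^sup>+x. indicator {..t} x * ennreal (poisson_weight a k (t - x)) \<partial>exponential a)
    = ennreal (poisson_weight a (Suc k) t)"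
proof -
  let ?F = "\<lambda>x. - exp (- a * t) * ((a * (t - x)) ^ Suc k / fact (Suc k))"
  let ?f = "\<lambda>x. a * exp (- a * t) * ((a * (t - x)) ^ k / fact k)"
  have "(\<integral>\<^sup>+x. indicator {..t} x * ennreal (poisson_weight a k (t - x)) \<partial>exponential a)
    = (\<integral>\<^sup>+x. ennreal (?f x) * indicator {0..t} x \<partial>lborel)"
    using a_pos by (subst nn_integral_exponential)
       (auto intro!: nn_integral_cong split: split_indicator
          simp: poisson_weight_def ennreal_mult'[symmetric] exp_add[symmetric] algebra_simps)
  also have "\<dots> = ?F t - ?F 0"
  proof (rule nn_integral_FTC_Icc)
    fix x assume x: "x \<in> {0..t}"
    have "((\<lambda>x. (a * (t - x)) ^ Suc k / fact (Suc k)) has_real_derivative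
      real (Suc k) * (a * (t - x)) ^ k * (- a) / fact (Suc k)) (at x)"
      by (auto intro!: derivative_eq_intros simp del: power_Suc fact_Suc)
    also have "real (Suc k) * (a * (t - x)) ^ k * (- a) / fact (Suc k) = - a * ((a * (t - x)) ^ k / fact k)"
      by (simp add: field_simps del: of_nat_Suc)
    finally have "(?F has_real_derivative - exp (- a * t) * (- a * ((a * (t - x)) ^ k / fact k))) (at x)"
      by (rule DERIV_cmult)
    then show "(?F has_real_derivative ?f x) (at x)" by (simp add: mult_ac)
    show "0 \<le> ?f x" using a_pos x by simp
  qed (use assms in auto)
  also have "?F t - ?F 0 = poisson_weight a (Suc k) t"
    by (simp add: poisson_weight_def)
  finally show ?thesis .
qed

text \<open>Lack of memory of the first gap: a shift by \<open>t\<close> multiplies the exponential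
  density by exp (- a t), and the later gaps are untouched.\<close>

lemma nn_integral_count_is_0:
  assumes [measurable]: "g \<in> borel_measurable S" and t: "0 \<le> t"
  shows "(\<integral>\<^sup>+e. indicator {e. count_is e t 0} e * g (residual t 0 e) \<partial>S)
    = ennreal (poisson_weight a 0 t) * (\<integral>\<^sup>+e. g e \<partial>S)"
proof -
  define H where "H = (\<lambda>x. \<integral>\<^sup>+e. g (case_nat x e) \<partial>S)"
  have [measurable]: "H \<in> borel_measurable borel"
    unfolding H_def by measurable
  let ?d = "\<lambda>x. ennreal (a * exp (- a * x)) * indicator {0..} x"
  have "(\<integral>\<^sup>+e. indicator {e. count_is e t 0} e * g (residual t 0 e) \<partial>S)
    = (\<integral>\<^sup>+x. \<integral>\<^sup>+e. indicator {t<..} x * g (case_nat (x - t) e) \<partial>S \<partial>exponential a)"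
    by (subst nn_integral_case_nat)
       (auto simp: count_is_case_nat_0[OF t] residual_case_nat_0 indicator_def)
  also have "\<dots> = (\<integral>\<^sup>+x. indicator {t<..} x * H (x - t) \<partial>exponential a)"
    unfolding H_def by (intro nn_integral_cong nn_integral_cmult) measurable
  also have "\<dots> = (\<integral>\<^sup>+x. ?d x * (indicator {t<..} x * H (x - t)) \<partial>lborel)"
    by (rule nn_integral_exponential) measurable
  also have "\<dots> = (\<integral>\<^sup>+y. ?d (t + 1 * y) * (indicator {t<..} (t + 1 * y) * H (t + 1 * y - t)) \<partial>lborel)"
    by (subst nn_integral_real_affine[where c=1 and t=t]) auto
  also have "\<dots> = (\<integral>\<^sup>+y. ennreal (exp (- a * t)) * (?d y * H y) \<partial>lborel)"
  \<comment> \<open>The strict inequality in \<open>count_is\<close> and the closed support of the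
    density disagree only at y = 0.\<close>
  proof (rule nn_integral_cong_AE)
    have "AE y in lborel. y \<noteq> (0::real)" by (rule AE_lborel_singleton)
    then show "AE y in lborel. ?d (t + 1 * y) * (indicator {t<..} (t + 1 * y) * H (t + 1 * y - t))
      = ennreal (exp (- a * t)) * (?d y * H y)"
    proof (rule eventually_mono)
      fix y :: real assume "y \<noteq> 0"
      have "ennreal (a * exp (- a * (t + 1 * y))) = ennreal (exp (- a * t)) * ennreal (a * exp (- a * y))"
        using a_pos by (simp add: ennreal_mult'[symmetric] exp_add[symmetric] algebra_simps)
      with \<open>y \<noteq> 0\<close> t show "?d (t + 1 * y) * (indicator {t<..} (t + 1 * y) * H (t + 1 * y - t))
        = ennreal (exp (- a * t)) * (?d y * H y)"
        by (cases "y < 0") (simp_all add: mult.assoc)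
    qed
  qed
  also have "\<dots> = ennreal (exp (- a * t)) * (\<integral>\<^sup>+y. ?d y * H y \<partial>lborel)"
    by (rule nn_integral_cmult) measurable
  also have "(\<integral>\<^sup>+y. ?d y * H y \<partial>lborel) = (\<integral>\<^sup>+y. H y \<partial>exponential a)"
    by (rule nn_integral_exponential[symmetric]) measurable
  also have "\<dots> = (\<integral>\<^sup>+e. g e \<partial>S)"
    unfolding H_def by (rule nn_integral_case_nat[symmetric]) measurable
  finally show ?thesis by (simp add: poisson_weight_def)
qed

text \<open>With g = 1 this is the Poisson law of the count; for general \<open>g\<close> it also
  says that the residual sequence is independent of the count and distributed as the original one.
  The induction conditions on the first gap and continues with horizon t - x.\<close>

lemma nn_integral_count_is:
  assumes [measurable]: "g \<in> borel_measurable S" and t: "0 \<le> t"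
  shows "(\<integral>\<^sup>+e. indicator {e. count_is e t k} e * g (residual t k e) \<partial>S)
    = ennreal (poisson_weight a k t) * (\<integral>\<^sup>+e. g e \<partial>S)"
  using t
proof (induction k arbitrary: t)
  case 0
  then show ?case by (intro nn_integral_count_is_0) auto
next
  case (Suc k)
  have "(\<integral>\<^sup>+e. indicator {e. count_is e t (Suc k)} e * g (residual t (Suc k) e) \<partial>S)
    = (\<integral>\<^sup>+x. \<integral>\<^sup>+e. indicator {..t} x * (indicator {e. count_is e (t - x) k} e * g (residual (t - x) k e)) \<partial>S \<partial>exponential a)"
    by (subst nn_integral_case_nat)
       (auto simp: count_is_case_nat_Suc[OF Suc.prems] residual_case_nat_Suc indicator_def intro!: nn_integral_cong)
  also have "\<dots> = (\<integral>\<^sup>+x. indicator {..t} x * (\<integral>\<^sup>+e. indicator {e. count_is e (t - x) k} e * g (residual (t - x) k e) \<partial>S) \<partial>exponential a)"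
    by (intro nn_integral_cong nn_integral_cmult) measurable
  also have "\<dots> = (\<integral>\<^sup>+x. (indicator {..t} x * ennreal (poisson_weight a k (t - x))) * (\<integral>\<^sup>+e. g e \<partial>S) \<partial>exponential a)"
    by (intro nn_integral_cong) (auto simp: Suc.IH split: split_indicator)
  also have "\<dots> = (\<integral>\<^sup>+x. indicator {..t} x * ennreal (poisson_weight a k (t - x)) \<partial>exponential a) * (\<integral>\<^sup>+e. g e \<partial>S)"
    by (rule nn_integral_multc) measurable
  finally show ?case unfolding poisson_weight_Suc_integral[OF Suc.prems] .
qed

lemma AE_exponential_pos: "AE x in exponential a. 0 < x"
proof -
  have "AE x in lborel. x \<noteq> (0::real)" by (rule AE_lborel_singleton)
  then show ?thesis
    by (subst AE_density) (auto simp: exponential_density_def elim!: eventually_mono)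
qed

lemma AE_pos: "AE e in S. \<forall>j. 0 < e j"
  unfolding AE_all_countable by (intro allI AE_component AE_exponential_pos) auto

text \<open>Excludes explosion, where the set counted by \<open>arrival_count\<close> is infinite
  and its \<open>card\<close> is 0: the events for different \<open>k\<close> are disjoint, and the
  Poisson weights sum to 1.\<close>

lemma AE_count_is:
  assumes t: "0 \<le> t"
  shows "AE e in S. count_is e t (arrival_count t e)"
proof -
  \<comment> \<open>Restriction to positive gaps is what makes the events disjoint for different
    \<open>k\<close>.\<close>
  have "emeasure S {e\<in>space S. \<exists>k. count_is e t k} = (\<Sum>k. emeasure S {e\<in>space S. count_is e t k \<and> (\<forall>j. 0 < e j)})"
  proof -
    have "emeasure S {e\<in>space S. \<exists>k. count_is e t k} = emeasure S (\<Union>k. {e\<in>space S. count_is e t k \<and> (\<forall>j. 0 < e j)})"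
      using AE_pos by (intro emeasure_eq_AE) auto
    also have "\<dots> = (\<Sum>k. emeasure S {e\<in>space S. count_is e t k \<and> (\<forall>j. 0 < e j)})"
    proof (rule suminf_emeasure[symmetric])
      show "disjoint_family (\<lambda>k. {e \<in> space S. count_is e t k \<and> (\<forall>j. 0 < e j)})"
        unfolding disjoint_family_on_def
        using count_is_imp_arrival_count by (auto simp: less_imp_le) (metis less_imp_le)+
    qed auto
    finally show ?thesis .
  qed
  also have "\<dots> = (\<Sum>k. ennreal (poisson_weight a k t))"
  proof (rule suminf_cong)
    fix k
    have "emeasure S {e\<in>space S. count_is e t k \<and> (\<forall>j. 0 < e j)} = emeasure S {e\<in>space S. count_is e t k}"
      using AE_pos by (intro emeasure_eq_AE) auto
    also have "\<dots> = (\<integral>\<^sup>+e. indicator {e\<in>space S. count_is e t k} e \<partial>S)"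
      by (rule nn_integral_indicator[symmetric]) measurable
    also have "\<dots> = (\<integral>\<^sup>+e. indicator {e. count_is e t k} e * 1 \<partial>S)"
      by (intro nn_integral_cong) (auto split: split_indicator)
    also have "\<dots> = ennreal (poisson_weight a k t)"
      by (subst nn_integral_count_is[where g="\<lambda>_. 1", OF _ t]) (auto simp: P.emeasure_space_1)
    finally show "emeasure S {e\<in>space S. count_is e t k \<and> (\<forall>j. 0 < e j)} = ennreal (poisson_weight a k t)" .
  qed
  also have "\<dots> = 1" by (rule suminf_poisson_weight_ennreal[OF a_pos t])
  finally have "AE e in S. \<exists>k. count_is e t k"
    by (intro P.AE_I_eq_1) auto
  with AE_pos show ?thesis
    by eventually_elim (metis count_is_imp_arrival_count less_imp_le)
qed

text \<open>The Markov property at a fixed time. It is applied at the end of the first service, and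
  to the departures during an interarrival time.\<close>

lemma nn_integral_restart:
  assumes [measurable]: "\<And>k. \<Phi> k \<in> borel_measurable S" and t: "0 \<le> t"
  shows "(\<integral>\<^sup>+e. \<Phi> (arrival_count t e) (residual t (arrival_count t e) e) \<partial>S)
    = (\<Sum>k. ennreal (poisson_weight a k t) * (\<integral>\<^sup>+e. \<Phi> k e \<partial>S))"
proof -
  have "(\<integral>\<^sup>+e. \<Phi> (arrival_count t e) (residual t (arrival_count t e) e) \<partial>S)
    = (\<integral>\<^sup>+e. (\<Sum>k. indicator {e. count_is e t k} e * \<Phi> k (residual t k e)) \<partial>S)"
  proof (rule nn_integral_cong_AE)
    show "AE e in S. \<Phi> (arrival_count t e) (residual t (arrival_count t e) e) =
      (\<Sum>k. indicator {e. count_is e t k} e * \<Phi> k (residual t k e))"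
      using AE_count_is[OF t] AE_pos
    proof eventually_elim
      fix e :: "nat \<Rightarrow> real" assume 1: "count_is e t (arrival_count t e)" "\<forall>j. 0 < e j"
      then have "count_is e t k \<longleftrightarrow> k = arrival_count t e" for k
        using count_is_imp_arrival_count[of e t k] by (auto simp: less_imp_le)
      then have "(\<Sum>k. indicator {e. count_is e t k} e * \<Phi> k (residual t k e))
        = (\<Sum>k\<in>{arrival_count t e}. indicator {e. count_is e t k} e * \<Phi> k (residual t k e))"
        by (intro suminf_finite) auto
      with 1 show "\<Phi> (arrival_count t e) (residual t (arrival_count t e) e) =
      (\<Sum>k. indicator {e. count_is e t k} e * \<Phi> k (residual t k e))" by simp
    qed
  qed
  also have "\<dots> = (\<Sum>k. \<integral>\<^sup>+e. indicator {e. count_is e t k} e * \<Phi> k (residual t k e) \<partial>S)"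
    by (rule nn_integral_suminf) measurable
  also have "\<dots> = (\<Sum>k. ennreal (poisson_weight a k t) * (\<integral>\<^sup>+e. \<Phi> k e \<partial>S))"
    by (intro suminf_cong nn_integral_count_is t) measurable
  finally show ?thesis .
qed

end

section \<open>The recurrence\<close>

lemma Q_point_0 [simp]: "Q_point r Q0 0 = Q0"
  by (simp add: Q_point.simps)

text \<open>Merges the three defining cases: the coefficient 1 - \<open>r 1\<close> is split into
  the leading term and the summand i = 1.\<close>

lemma Q_point_Suc:
  assumes "r 0 \<noteq> 0"
  shows "r 0 * Q_point r Q0 (Suc n) = Q_point r Q0 n - (\<Sum>i\<in>{1..n}. r i * Q_point r Q0 (Suc n - i))"
proof -
  consider "n = 0" | "n = 1" | "2 \<le> n" by linarith
  then show ?thesis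
  proof cases
    case 1
    with assms show ?thesis by (simp add: Q_point.simps)
  next
    case 2
    with assms show ?thesis by (simp add: Q_point.simps[of r Q0 2] field_simps flip: numeral_2_eq_2)
  next
    case 3
    then have "{1..n} = insert 1 {2..n}" by auto
    with 3 assms show ?thesis
      by (subst Q_point.simps) (simp add: algebra_simps)
  qed
qed

lemma Q_point_recurrence:
  assumes "r 0 \<noteq> 0"
  shows "Q_point r Q0 n = (\<Sum>i\<le>n. r i * Q_point r Q0 (Suc n - i))"
proof -
  have "{..n} = insert 0 {1..n}" by auto
  then show ?thesis using Q_point_Suc[of r Q0 n, OF assms] by simp
qed

text \<open>The recurrence is required below \<open>N\<close> only, because the tail sums of a
  stationary distribution satisfy it in a finite range.\<close>

lemma Q_point_unique:
  assumes "r 0 \<noteq> 0" "R 0 = Q0" "n \<le> N"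
    and rec: "\<And>n. n < N \<Longrightarrow> R n = (\<Sum>i\<le>n. r i * R (Suc n - i))"
  shows "R n = Q_point r Q0 n"
  using \<open>n \<le> N\<close>
proof (induction n rule: less_induct)
  case (less n)
  show ?case
  proof (cases n)
    case (Suc m)
    have "{..m} = insert 0 {1..m}" by auto
    with rec[of m] less.prems Suc have "R m = r 0 * R (Suc m) + (\<Sum>i\<in>{1..m}. r i * R (Suc m - i))" by simp
    moreover have "(\<Sum>i\<in>{1..m}. r i * R (Suc m - i)) = (\<Sum>i\<in>{1..m}. r i * Q_point r Q0 (Suc m - i))"
      using less Suc by (intro sum.cong) auto
    moreover have "R m = Q_point r Q0 m" using less Suc by simp
    ultimately have "r 0 * R n = r 0 * Q_point r Q0 n"
      unfolding Suc using Q_point_Suc[of r Q0 m, OF assms(1)] by linarith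
    then show ?thesis using mult_left_cancel[OF assms(1)] by simp
  qed (use assms in simp)
qed

lemma Q_point_scale:
  assumes "r 0 \<noteq> 0"
  shows "Q_point r (c * Q0) n = c * Q_point r Q0 n"
proof (rule Q_point_unique[symmetric, where N=n and R="\<lambda>n. c * Q_point r Q0 n"])
  show "c * Q_point r Q0 m = (\<Sum>i\<le>m. r i * (c * Q_point r Q0 (Suc m - i)))" for m
    unfolding Q_point_recurrence[of r Q0 m, OF assms] sum_distrib_left by (simp only: mult.left_commute)
qed (use assms in simp_all)

text \<open>Replacing each earlier value by the larger Q_n gives r_0 Q_{n+1} \<ge> (1 - r_1 - ... -
  r_n) Q_n, and the bracket is at least r_0 since the weights sum to at most 1.\<close>

lemma Q_point_mono_nonneg:
  assumes r: "\<And>i. 0 \<le> r i" "0 < r 0" "\<And>n. (\<Sum>i\<le>n. r i) \<le> 1" and "0 \<le> Q0"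
  shows "0 \<le> Q_point r Q0 n \<and> Q_point r Q0 n \<le> Q_point r Q0 (Suc n)"
proof (induction n rule: less_induct)
  case (less n)
  let ?q = "Q_point r Q0"
  have mono: "?q i \<le> ?q j" if "i \<le> j" "j \<le> n" for i j
    using that(1) that(2)
  proof (induction rule: dec_induct)
    case (step m)
    then show ?case using less[of m] by auto
  qed simp
  have nn: "0 \<le> ?q n" using less[of "n - 1"] \<open>0 \<le> Q0\<close> by (cases n) auto
  have "{..n} = insert 0 {1..n}" by auto
  with r(3)[of n] have s: "r 0 \<le> 1 - (\<Sum>i\<in>{1..n}. r i)" by simp
  have "r 0 * ?q n \<le> (1 - (\<Sum>i\<in>{1..n}. r i)) * ?q n" using s nn by (intro mult_right_mono)
  also have "\<dots> = ?q n - (\<Sum>i\<in>{1..n}. r i * ?q n)" by (simp add: left_diff_distrib sum_distrib_right)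
  also have "\<dots> \<le> ?q n - (\<Sum>i\<in>{1..n}. r i * ?q (Suc n - i))"
    using r by (intro diff_left_mono sum_mono mult_left_mono mono) auto
  also have "\<dots> = r 0 * ?q (Suc n)" using Q_point_Suc[of r] r by simp
  finally show ?case using nn r by simp
qed

lemma Q_point_pos:
  assumes r: "\<And>i. 0 \<le> r i" "0 < r 0" "\<And>n. (\<Sum>i\<le>n. r i) \<le> 1" and "0 < Q0"
  shows "0 < Q_point r Q0 n"
proof (induction n)
  case (Suc n)
  with Q_point_mono_nonneg[OF r, of Q0 n] \<open>0 < Q0\<close> show ?case by auto
qed (use assms in simp)

text \<open>Summed recurrence: passing from d to d + 1 adds exactly the recurrence for index
  d.\<close>

lemma Q_point_convolution:
  assumes "r 0 \<noteq> 0"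
  shows "(\<Sum>k\<le>d. r k * (\<Sum>i\<in>{1..d - k}. Q_point r Q0 i)) = (\<Sum>i<d. Q_point r Q0 i)"
proof (induction d)
  case (Suc d)
  let ?q = "Q_point r Q0"
  have "(\<Sum>k\<le>Suc d. r k * (\<Sum>i\<in>{1..Suc d - k}. ?q i)) = (\<Sum>k\<le>d. r k * (\<Sum>i\<in>{1..Suc d - k}. ?q i))"
    by simp
  also have "\<dots> = (\<Sum>k\<le>d. r k * (\<Sum>i\<in>{1..d - k}. ?q i) + r k * ?q (Suc d - k))"
    by (intro sum.cong) (auto simp: Suc_diff_le algebra_simps)
  also have "\<dots> = (\<Sum>i<d. ?q i) + ?q d"
    by (simp only: sum.distrib Suc Q_point_recurrence[of r, OF assms, symmetric])
  finally show ?case by simp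
qed simp

text \<open>\<open>w j\<close> is the candidate for the mean cost until a system with
  \<open>j\<close> customers empties, when every service costs \<open>Q0\<close>. Its increments
  explain the shape: going from \<open>j\<close> down to \<open>j - 1\<close> customers takes a busy
  period of a queue with \<open>n + 1 - j\<close> waiting places, of mean cost Q_{n+1-j}.\<close>

lemma Q_point_walk_sums:
  fixes r :: "nat \<Rightarrow> real" and Q0 :: real
  assumes "r 0 \<noteq> 0" "r sums 1" "1 \<le> j" "j \<le> n + 1"
  defines "w \<equiv> \<lambda>j. \<Sum>i\<in>{n + 1 - j..n}. Q_point r Q0 i"
  shows "(\<lambda>k. r k * w (min (j + k) (n + 1) - 1)) sums (w j - Q0)"
proof -
  let ?q = "Q_point r Q0"
  define d where "d = n + 1 - j"
  have d: "d \<le> n" using assms by (simp add: d_def)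
  \<comment> \<open>\<open>d\<close> is the number of free places. The truncated
    \<open>d - k\<close> is 0 once the arrivals fill them, which is the loss of further
    customers.\<close>
  have w: "w (min (j + k) (n + 1) - 1) = (\<Sum>i\<in>{1..n}. ?q i) - (\<Sum>i\<in>{1..d - k}. ?q i)" for k
  proof -
    have "n + 1 - (min (j + k) (n + 1) - 1) = Suc (d - k)" using assms by (auto simp: d_def)
    moreover have "{1..n} = {1..d - k} \<union> {Suc (d - k)..n}" using d by auto
    then have "(\<Sum>i\<in>{1..n}. ?q i) = (\<Sum>i\<in>{1..d - k}. ?q i) + (\<Sum>i\<in>{Suc (d - k)..n}. ?q i)"
      by (simp add: sum.union_disjoint)
    ultimately show ?thesis by (simp add: w_def)
  qed
  have "(\<lambda>k. r k * (\<Sum>i\<in>{1..d - k}. ?q i)) sums (\<Sum>k\<le>d. r k * (\<Sum>i\<in>{1..d - k}. ?q i))"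
    by (intro sums_finite) auto
  from sums_diff[OF sums_mult2[OF assms(2), of "\<Sum>i\<in>{1..n}. ?q i"] this]
  have "(\<lambda>k. r k * w (min (j + k) (n + 1) - 1)) sums ((\<Sum>i\<in>{1..n}. ?q i) - (\<Sum>i<d. ?q i))"
    by (simp only: w right_diff_distrib Q_point_convolution[of r Q0 d, OF assms(1)]) simp
  moreover have "(\<Sum>i\<in>{1..n}. ?q i) - (\<Sum>i<d. ?q i) = w j - Q0"
  proof -
    have "{..n} = {..<d} \<union> {d..n}" "{..n} = insert 0 {1..n}" using d by auto
    have "(\<Sum>i\<le>n. ?q i) = (\<Sum>i<d. ?q i) + (\<Sum>i\<in>{d..n}. ?q i)"
      by (subst \<open>{..n} = {..<d} \<union> {d..n}\<close>, rule sum.union_disjoint) auto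
    moreover have "(\<Sum>i\<le>n. ?q i) = Q0 + (\<Sum>i\<in>{1..n}. ?q i)"
      by (subst \<open>{..n} = insert 0 {1..n}\<close>) simp
    ultimately show ?thesis by (simp add: w_def d_def)
  qed
  ultimately show ?thesis by simp
qed

text \<open>The largest value is attained at a smallest state, from which the walk steps down with
  positive probability; hence it is attained at 0.\<close>

lemma walk_equation_unique:
  fixes r D :: "nat \<Rightarrow> real"
  assumes r: "\<And>i. 0 \<le> r i" "0 < r 0" "r sums 1"
    and D: "D 0 = 0"
    and eq: "\<And>j. 1 \<le> j \<Longrightarrow> j \<le> n + 1 \<Longrightarrow> (\<lambda>k. r k * D (min (j + k) (n + 1) - 1)) sums D j"
    and "j \<le> n + 1"
  shows "D j \<le> 0"
proof -
  define B where "B = Max (D ` {..n + 1})"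
  have B: "D i \<le> B" if "i \<le> n + 1" for i using that by (auto simp: B_def)
  have "B \<in> D ` {..n + 1}" unfolding B_def by (rule Max_in) auto
  then have ex: "\<exists>i. i \<le> n + 1 \<and> D i = B" by auto
  define i where "i = (LEAST i. i \<le> n + 1 \<and> D i = B)"
  have i: "i \<le> n + 1" "D i = B" using LeastI_ex[OF ex] by (auto simp: i_def)
  have "i = 0"
  proof (rule ccontr)
    assume "i \<noteq> 0"
    then have "D (i - 1) \<noteq> B" using not_less_Least[of "i - 1" "\<lambda>i. i \<le> n + 1 \<and> D i = B"] i
      by (auto simp: i_def)
    then have less: "D (i - 1) < B" using B[of "i - 1"] i by (auto simp: less_le)
    have 1: "(\<lambda>k. r k * D (min (i + k) (n + 1) - 1)) sums B" using eq[of i] i \<open>i \<noteq> 0\<close> by auto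
    have 2: "(\<lambda>k. r k * B) sums B" using sums_mult2[OF r(3), of B] by simp
    have "(\<lambda>k. r k * B - r k * D (min (i + k) (n + 1) - 1)) sums 0" using sums_diff[OF 2 1] by simp
    moreover have "0 \<le> r k * B - r k * D (min (i + k) (n + 1) - 1)" for k
      using r(1)[of k] B[of "min (i + k) (n + 1) - 1"] by (simp add: mult_left_mono)
    ultimately have "\<forall>k. r k * B - r k * D (min (i + k) (n + 1) - 1) = 0"
      by (subst suminf_eq_zero_iff[symmetric]) (simp_all add: sums_iff)
    then have "r 0 * B - r 0 * D (min (i + 0) (n + 1) - 1) = 0" by blast
    moreover have "min (i + 0) (n + 1) - 1 = i - 1" using i by simp
    ultimately show False using r(2) less by simp
  qed
  then show ?thesis using B[OF \<open>j \<le> n + 1\<close>] i D by simp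
qed

section \<open>The M/GI/1/n queue\<close>

text \<open>The quantities that the empirical weights estimate: the law of the number of Poisson
  arrivals during a time with distribution \<open>G\<close>.\<close>

definition mixed_poisson :: "real \<Rightarrow> real measure \<Rightarrow> nat \<Rightarrow> real" where
  "mixed_poisson a G i = (\<integral>t. poisson_weight a i t \<partial>G)"

text \<open>First-step analysis restarts the queue in arbitrary states, hence the free initial
  content.\<close>

primrec content_from :: "nat \<Rightarrow> nat \<Rightarrow> (nat \<Rightarrow> real) \<times> (nat \<Rightarrow> real) \<Rightarrow> nat \<Rightarrow> nat" where
  "content_from n j \<omega> 0 = j"
| "content_from n j \<omega> (Suc k) = min (content_from n j \<omega> k + arrivals_in_service \<omega> k) (n + 1) - 1"

lemma mgi1_content_eq: "mgi1_content n \<omega> k = content_from n 1 \<omega> k"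
  by (induction k) simp_all

text \<open>One scheme for three characteristics: the cost is 1, the service time, or the overflow.
  Charging nothing after the first emptying lets an infinite series replace the sum up to the random
  \<open>mgi1_served\<close>.\<close>

definition step_cost ::
  "(nat \<Rightarrow> real \<Rightarrow> nat \<Rightarrow> ennreal) \<Rightarrow> nat \<Rightarrow> nat \<Rightarrow> (nat \<Rightarrow> real) \<times> (nat \<Rightarrow> real) \<Rightarrow> nat \<Rightarrow> ennreal" where
  "step_cost c n j \<omega> k = (if \<forall>i\<le>k. content_from n j \<omega> i \<noteq> 0
     then c (content_from n j \<omega> k) (fst \<omega> k) (arrivals_in_service \<omega> k) else 0)"

lemma arrival_time_residual:
  "arrival_time (residual t N e) (Suc j) = arrival_time e (Suc (N + j)) - t"
proof (induction j)
  case 0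
  then show ?case by (simp add: residual_def arrival_time_def)
next
  case (Suc j)
  then show ?case by (simp add: residual_def arrival_time_Suc)
qed

lemma arrivals_in_service_arrival_time:
  "arrivals_in_service (s, e) k =
    card {j. arrival_time s k < arrival_time e (Suc j) \<and> arrival_time e (Suc j) \<le> arrival_time s (Suc k)}"
  by (simp add: arrivals_in_service_def arrival_time_def lessThan_Suc_atMost)

lemma arrivals_in_service_0:
  assumes "\<And>j. 0 < e j"
  shows "arrivals_in_service (case_nat t s, e) 0 = arrival_count t e"
proof -
  have "0 < arrival_time e (Suc j)" for j
    unfolding arrival_time_def using assms by (intro sum_pos) auto
  then show ?thesis
    unfolding arrivals_in_service_arrival_time arrival_count_def by simp
qed

text \<open>The first \<open>N\<close> arrivals fall into the first service, so the later ones are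
  matched by an index shift of \<open>N\<close>.\<close>

lemma arrivals_in_service_Suc:
  assumes e: "\<And>j. 0 < e j" and s: "\<And>k. 0 < s k" and N: "count_is e t N"
  shows "arrivals_in_service (case_nat t s, e) (Suc k) = arrivals_in_service (s, residual t N e) k"
proof -
  let ?A = "{j. arrival_time s k < arrival_time (residual t N e) (Suc j)
     \<and> arrival_time (residual t N e) (Suc j) \<le> arrival_time s (Suc k)}"
  have "{j. arrival_time (case_nat t s) (Suc k) < arrival_time e (Suc j) \<and>
      arrival_time e (Suc j) \<le> arrival_time (case_nat t s) (Suc (Suc k))} = (+) N ` ?A" (is "?B = _")
  proof
    show "(+) N ` ?A \<subseteq> ?B" by (auto simp: arrival_time_residual)
    show "?B \<subseteq> (+) N ` ?A"
    proof
      fix j assume j: "j \<in> ?B"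
      have "0 \<le> arrival_time s k"
        using s by (auto simp: arrival_time_def less_imp_le intro!: sum_nonneg)
      with j have "t < arrival_time e (Suc j)" by simp
      moreover have "arrival_time e (Suc j) \<le> t \<longleftrightarrow> j < N"
        using count_is_imp_arrival_set[OF _ N] e by (auto simp: less_imp_le)
      ultimately have "N \<le> j" by simp
      then obtain i where "j = N + i" by (auto simp: le_iff_add)
      with j show "j \<in> (+) N ` ?A" by (auto simp: arrival_time_residual)
    qed
  qed
  then show ?thesis
    unfolding arrivals_in_service_arrival_time by (simp add: card_image)
qed

text \<open>The end of the first service acts as a new time 0: the departure and the
  \<open>N\<close> arrivals are absorbed into the initial content, the arrivals still to come into
  \<open>residual\<close>.\<close>

lemma content_from_Suc:
  assumes e: "\<And>j. 0 < e j" and s: "\<And>k. 0 < s k" and N: "count_is e t N"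
  shows "content_from n j (case_nat t s, e) (Suc k)
    = content_from n (min (j + N) (n + 1) - 1) (s, residual t N e) k"
proof (induction k)
  case 0
  have "arrivals_in_service (case_nat t s, e) 0 = N"
    using arrivals_in_service_0[of e] e count_is_imp_arrival_count[OF _ N] by (simp add: less_imp_le)
  then show ?case by simp
next
  case (Suc k)
  then show ?case
    using arrivals_in_service_Suc[OF e s N, where k=k] by simp
qed

lemma step_cost_Suc:
  assumes e: "\<And>j. 0 < e j" and s: "\<And>k. 0 < s k" and N: "count_is e t N" and "j \<noteq> 0"
  shows "step_cost c n j (case_nat t s, e) (Suc k)
    = step_cost c n (min (j + N) (n + 1) - 1) (s, residual t N e) k"
proof -
  have split: "(\<forall>i\<le>Suc k. P i) \<longleftrightarrow> P 0 \<and> (\<forall>i\<le>k. P (Suc i))" for P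
    by (metis Suc_le_mono not0_implies_Suc zero_le)
  show ?thesis
    unfolding step_cost_def split content_from_Suc[OF e s N] arrivals_in_service_Suc[OF e s N]
    using \<open>j \<noteq> 0\<close> by auto
qed

lemma step_cost_0:
  assumes e: "\<And>j. 0 < e j" and N: "count_is e t N" and "j \<noteq> 0"
  shows "step_cost c n j (case_nat t s, e) 0 = c j t N"
  using arrivals_in_service_0[of e] e count_is_imp_arrival_count[OF _ N] \<open>j \<noteq> 0\<close>
  by (simp add: step_cost_def less_imp_le)

locale queue_input = exponential_sequence +
  fixes G :: "real measure"
  assumes real_distribution_G: "real_distribution G" and AE_G_pos: "AE x in G. 0 < x"

sublocale queue_input \<subseteq> G: real_distribution G
  by (rule real_distribution_G)

sublocale queue_input \<subseteq> T: sequence_space G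
  by unfold_locales

sublocale queue_input \<subseteq> TS: pair_prob_space T.S S
  by unfold_locales

context queue_input
begin

abbreviation \<rho> :: "nat \<Rightarrow> real" where "\<rho> \<equiv> mixed_poisson a G"

lemma integrable_poisson_weight: "integrable G (poisson_weight a i)"
proof (rule G.integrable_const_bound[where B=1])
  show "AE t in G. norm (poisson_weight a i t) \<le> 1"
    using AE_G_pos by eventually_elim (simp add: poisson_weight_nonneg poisson_weight_le_1 a_pos)
qed simp

lemma ennreal_mixed_poisson: "ennreal (\<rho> i) = (\<integral>\<^sup>+t. ennreal (poisson_weight a i t) \<partial>G)"
  unfolding mixed_poisson_def using AE_G_pos a_pos
  by (intro nn_integral_eq_integral[symmetric] integrable_poisson_weight)
     (auto elim!: eventually_mono simp: poisson_weight_nonneg)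

lemma mixed_poisson_nonneg: "0 \<le> \<rho> i"
  unfolding mixed_poisson_def using AE_G_pos a_pos
  by (intro integral_nonneg_AE) (auto elim!: eventually_mono simp: poisson_weight_nonneg)

lemma mixed_poisson_0_pos: "0 < \<rho> 0"
proof -
  have "(\<integral>t. 0 \<partial>G) < \<rho> 0"
    unfolding mixed_poisson_def
  proof (rule G.integral_less_AE_space)
    show "AE t in G. 0 < poisson_weight a 0 t" by (simp add: poisson_weight_def)
  qed (use integrable_poisson_weight G.emeasure_space_1 in auto)
  then show ?thesis by simp
qed

lemma suminf_ennreal_mixed_poisson: "(\<Sum>i. ennreal (\<rho> i)) = 1"
proof -
  have "(\<Sum>i. ennreal (\<rho> i)) = (\<integral>\<^sup>+t. (\<Sum>i. ennreal (poisson_weight a i t)) \<partial>G)"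
    unfolding ennreal_mixed_poisson by (rule nn_integral_suminf[symmetric]) simp
  also have "\<dots> = (\<integral>\<^sup>+t. 1 \<partial>G)"
    using AE_G_pos by (intro nn_integral_cong_AE) (auto elim!: eventually_mono simp: suminf_poisson_weight_ennreal a_pos)
  finally show ?thesis using G.emeasure_space_1 by simp
qed

lemma mixed_poisson_sums: "\<rho> sums 1"
proof -
  have "summable \<rho>"
    by (rule summable_suminf_not_top) (simp_all add: mixed_poisson_nonneg suminf_ennreal_mixed_poisson)
  moreover have "suminf \<rho> = 1"
    using suminf_ennreal2[OF mixed_poisson_nonneg \<open>summable \<rho>\<close>] suminf_ennreal_mixed_poisson
    by (simp add: suminf_nonneg mixed_poisson_nonneg \<open>summable \<rho>\<close>)
  ultimately show ?thesis by (simp add: sums_iff)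
qed

lemma sum_mixed_poisson_le_1: "finite I \<Longrightarrow> sum \<rho> I \<le> 1"
  using sum_le_suminf[of \<rho> I] mixed_poisson_sums mixed_poisson_nonneg by (simp add: sums_iff)

section \<open>Mean accumulated costs and their first-step equations\<close>

lemma arrivals_measurable [measurable]:
  "(\<lambda>\<omega>. arrivals_in_service \<omega> k) \<in> measurable (T.S \<Otimes>\<^sub>M S) (count_space UNIV)"
proof -
  have "(\<lambda>\<omega>. card {j. (\<Sum>i<k. fst \<omega> i) < (\<Sum>i\<le>j. snd \<omega> i) \<and> (\<Sum>i\<le>j. snd \<omega> i) \<le> (\<Sum>i\<le>k. fst \<omega> i)})
    \<in> measurable (T.S \<Otimes>\<^sub>M S) (count_space UNIV)"
  proof (rule measurable_card)
    fix i
    have [measurable]: "(\<lambda>\<omega>. fst \<omega> i) \<in> borel_measurable (T.S \<Otimes>\<^sub>M S)"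
      "(\<lambda>\<omega>. snd \<omega> i) \<in> borel_measurable (T.S \<Otimes>\<^sub>M S)" for i
      by simp_all
    have [measurable]: "(\<lambda>\<omega>. \<Sum>i\<in>A. fst \<omega> i) \<in> borel_measurable (T.S \<Otimes>\<^sub>M S)"
      "(\<lambda>\<omega>. \<Sum>i\<in>A. snd \<omega> i) \<in> borel_measurable (T.S \<Otimes>\<^sub>M S)" for A :: "nat set"
      by (intro borel_measurable_sum; measurable)+
    have "{\<omega> \<in> space (T.S \<Otimes>\<^sub>M S). (\<Sum>i<k. fst \<omega> i) < (\<Sum>l\<le>i. snd \<omega> l) \<and> (\<Sum>l\<le>i. snd \<omega> l) \<le> (\<Sum>i\<le>k. fst \<omega> i)}
      \<in> sets (T.S \<Otimes>\<^sub>M S)" by measurable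
    then show "{\<omega> \<in> space (T.S \<Otimes>\<^sub>M S). i \<in> {j. (\<Sum>i<k. fst \<omega> i) < (\<Sum>i\<le>j. snd \<omega> i) \<and> (\<Sum>i\<le>j. snd \<omega> i) \<le> (\<Sum>i\<le>k. fst \<omega> i)}}
      \<in> sets (T.S \<Otimes>\<^sub>M S)" by simp
  qed
  then show ?thesis by (simp add: arrivals_in_service_def split_beta')
qed

lemma content_measurable [measurable]:
  "(\<lambda>\<omega>. content_from n j \<omega> k) \<in> measurable (T.S \<Otimes>\<^sub>M S) (count_space UNIV)"
  by (induction k) simp_all

lemma step_cost_measurable [measurable]:
  assumes [measurable]: "\<And>j k. (\<lambda>t. c j t k) \<in> borel_measurable borel"
  shows "(\<lambda>\<omega>. step_cost c n j \<omega> k) \<in> borel_measurable (T.S \<Otimes>\<^sub>M S)"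
proof -
  have "(\<lambda>\<omega>. c i (fst \<omega> k) l) \<in> borel_measurable (T.S \<Otimes>\<^sub>M S)" for i l by measurable
  then have "(\<lambda>\<omega>. c i (fst \<omega> k) (arrivals_in_service \<omega> k)) \<in> borel_measurable (T.S \<Otimes>\<^sub>M S)" for i
    by (rule measurable_compose_countable) measurable
  then have "(\<lambda>\<omega>. c (content_from n j \<omega> k) (fst \<omega> k) (arrivals_in_service \<omega> k)) \<in> borel_measurable (T.S \<Otimes>\<^sub>M S)"
    by (rule measurable_compose_countable) measurable
  then show ?thesis unfolding step_cost_def by measurable
qed

text \<open>Truncation at \<open>m\<close> services turns the first-step relation into a recursion
  on \<open>m\<close>; values in \<open>ennreal\<close> postpone all questions of
  finiteness.\<close>

definition cost_upto :: "(nat \<Rightarrow> real \<Rightarrow> nat \<Rightarrow> ennreal) \<Rightarrow> nat \<Rightarrow> nat \<Rightarrow> nat \<Rightarrow> ennreal" where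
  "cost_upto c n m j = (\<integral>\<^sup>+\<omega>. (\<Sum>k<m. step_cost c n j \<omega> k) \<partial>(T.S \<Otimes>\<^sub>M S))"

definition mean_step_cost :: "(nat \<Rightarrow> real \<Rightarrow> nat \<Rightarrow> ennreal) \<Rightarrow> nat \<Rightarrow> ennreal" where
  "mean_step_cost c j = (\<integral>\<^sup>+t. (\<Sum>k. ennreal (poisson_weight a k t) * c j t k) \<partial>G)"

lemma cost_upto_at_0 [simp]: "cost_upto c n m 0 = 0"
proof -
  have "step_cost c n 0 \<omega> k = 0" for \<omega> k by (auto simp: step_cost_def)
  then show ?thesis by (simp add: cost_upto_def)
qed

lemma cost_upto_0 [simp]: "cost_upto c n 0 j = 0"
  by (simp add: cost_upto_def)

lemma AE_T_pos: "AE s in T.S. \<forall>k. 0 < s k"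
  unfolding AE_all_countable by (intro allI T.AE_component AE_G_pos) auto

text \<open>Condition on the first service time \<open>t\<close>, then on the arrivals during it. By
  \<open>step_cost_Suc\<close> and \<open>nn_integral_restart\<close> the other \<open>m\<close>
  services see a fresh arrival sequence and start from the content left behind.\<close>

lemma cost_upto_Suc:
  assumes [measurable]: "\<And>j k. (\<lambda>t. c j t k) \<in> borel_measurable borel" and "j \<noteq> 0"
  shows "cost_upto c n (Suc m) j =
    mean_step_cost c j + (\<Sum>k. ennreal (\<rho> k) * cost_upto c n m (min (j + k) (n + 1) - 1))"
proof -
  define V where "V = (\<lambda>m j \<omega>. \<Sum>k<m. step_cost c n j \<omega> k)"
  have [measurable]: "V m j \<in> borel_measurable (T.S \<Otimes>\<^sub>M S)" for m j
    unfolding V_def by measurable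
  have [measurable]: "(\<lambda>e. V m j (s, e)) \<in> borel_measurable S" if "s \<in> space T.S" for s m j
    using that by measurable
  let ?J = "\<lambda>k. min (j + k) (n + 1) - 1"
  have inner: "(\<integral>\<^sup>+e. V (Suc m) j (case_nat t s, e) \<partial>S) =
      (\<Sum>k. ennreal (poisson_weight a k t) * (c j t k + (\<integral>\<^sup>+e. V m (?J k) (s, e) \<partial>S)))"
    if "0 < t" "\<forall>k. 0 < s k" for t s
  proof -
    have s: "s \<in> space T.S" by (simp add: space_PiM)
    have "(\<integral>\<^sup>+e. V (Suc m) j (case_nat t s, e) \<partial>S) =
      (\<integral>\<^sup>+e. c j t (arrival_count t e) + V m (?J (arrival_count t e)) (s, residual t (arrival_count t e) e) \<partial>S)"
      using AE_pos AE_count_is[OF less_imp_le[OF \<open>0 < t\<close>]]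
    proof (intro nn_integral_cong_AE, eventually_elim)
      fix e :: "nat \<Rightarrow> real" assume e: "\<forall>j. 0 < e j" and N: "count_is e t (arrival_count t e)"
      show "V (Suc m) j (case_nat t s, e) = c j t (arrival_count t e) +
          V m (?J (arrival_count t e)) (s, residual t (arrival_count t e) e)"
        unfolding V_def sum.lessThan_Suc_shift
        using step_cost_0[OF _ N \<open>j \<noteq> 0\<close>, of c n s] step_cost_Suc[OF _ _ N \<open>j \<noteq> 0\<close>, of s c n] e that
        by (simp cong: if_cong)
    qed
    also have "\<dots> = (\<Sum>k. ennreal (poisson_weight a k t) * (\<integral>\<^sup>+e. c j t k + V m (?J k) (s, e) \<partial>S))"
      using s that by (intro nn_integral_restart) auto
    also have "\<dots> = (\<Sum>k. ennreal (poisson_weight a k t) * (c j t k + (\<integral>\<^sup>+e. V m (?J k) (s, e) \<partial>S)))"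
      using s by (subst nn_integral_add) (auto simp: P.emeasure_space_1)
    finally show ?thesis .
  qed
  have [measurable]: "(\<lambda>s. \<integral>\<^sup>+e. V m j (s, e) \<partial>S) \<in> borel_measurable T.S" for m j
    by measurable
  have cost: "cost_upto c n m j = (\<integral>\<^sup>+s. (\<integral>\<^sup>+e. V m j (s, e) \<partial>S) \<partial>T.S)" for m j
  proof -
    have "cost_upto c n m j = (\<integral>\<^sup>+\<omega>. V m j \<omega> \<partial>(T.S \<Otimes>\<^sub>M S))" by (simp add: cost_upto_def V_def)
    also have "\<dots> = (\<integral>\<^sup>+s. (\<integral>\<^sup>+e. V m j (s, e) \<partial>S) \<partial>T.S)" by (rule P.nn_integral_fst[symmetric]) measurable
    finally show ?thesis .
  qed
  \<comment> \<open>The arrivals are integrated first and the first service time last, so that the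
    restart applies with all service times fixed.\<close>
  have "cost_upto c n (Suc m) j = (\<integral>\<^sup>+t. (\<integral>\<^sup>+s. (\<integral>\<^sup>+e. V (Suc m) j (case_nat t s, e) \<partial>S) \<partial>T.S) \<partial>G)"
    unfolding cost by (rule T.nn_integral_case_nat) measurable
  also have "\<dots> = (\<integral>\<^sup>+t. (\<Sum>k. ennreal (poisson_weight a k t) * (c j t k + cost_upto c n m (?J k))) \<partial>G)"
    using AE_G_pos
  proof (intro nn_integral_cong_AE, eventually_elim)
    fix t :: real assume t: "0 < t"
    have "(\<integral>\<^sup>+s. (\<integral>\<^sup>+e. V (Suc m) j (case_nat t s, e) \<partial>S) \<partial>T.S) =
      (\<integral>\<^sup>+s. (\<Sum>k. ennreal (poisson_weight a k t) * (c j t k + (\<integral>\<^sup>+e. V m (?J k) (s, e) \<partial>S))) \<partial>T.S)"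
      using AE_T_pos by (intro nn_integral_cong_AE) (auto elim!: eventually_mono simp: inner t)
    also have "\<dots> = (\<Sum>k. \<integral>\<^sup>+s. ennreal (poisson_weight a k t) * (c j t k + (\<integral>\<^sup>+e. V m (?J k) (s, e) \<partial>S)) \<partial>T.S)"
      by (rule nn_integral_suminf) measurable
    also have "\<dots> = (\<Sum>k. ennreal (poisson_weight a k t) * (c j t k + cost_upto c n m (?J k)))"
      unfolding cost by (simp add: nn_integral_cmult nn_integral_add T.P.emeasure_space_1)
    finally show "(\<integral>\<^sup>+s. (\<integral>\<^sup>+e. V (Suc m) j (case_nat t s, e) \<partial>S) \<partial>T.S) = \<dots>" .
  qed
  also have "\<dots> = (\<integral>\<^sup>+t. (\<Sum>k. ennreal (poisson_weight a k t) * c j t k) +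
      (\<Sum>k. ennreal (poisson_weight a k t) * cost_upto c n m (?J k)) \<partial>G)"
    by (simp add: distrib_left suminf_add)
  also have "\<dots> = mean_step_cost c j + (\<integral>\<^sup>+t. (\<Sum>k. ennreal (poisson_weight a k t) * cost_upto c n m (?J k)) \<partial>G)"
    unfolding mean_step_cost_def by (rule nn_integral_add) measurable
  also have "(\<integral>\<^sup>+t. (\<Sum>k. ennreal (poisson_weight a k t) * cost_upto c n m (?J k)) \<partial>G) =
      (\<Sum>k. ennreal (\<rho> k) * cost_upto c n m (?J k))"
    by (subst nn_integral_suminf) (simp_all add: nn_integral_multc ennreal_mixed_poisson)
  finally show ?thesis .
qed

end

lemma suminf_ennreal_imp_sums:
  fixes f :: "nat \<Rightarrow> real"
  assumes "\<And>k. 0 \<le> f k" "(\<Sum>k. ennreal (f k)) = ennreal A" "0 \<le> A"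
  shows "f sums A"
proof -
  have "summable f" by (rule summable_suminf_not_top) (simp_all add: assms)
  moreover have "ennreal (suminf f) = ennreal A"
    using suminf_ennreal2[OF assms(1) \<open>summable f\<close>] assms(2) by simp
  then have "suminf f = A"
    using suminf_nonneg[OF \<open>summable f\<close> assms(1)] assms(3) by (simp only: ennreal_inj)
  ultimately show ?thesis by (simp only: sums_iff)
qed

lemma poisson_weight_mean_sums: "(\<lambda>k. poisson_weight a k t * real k) sums (a * t)"
proof -
  have "poisson_weight a (Suc k) t * real (Suc k) = a * t * poisson_weight a k t" for k
    by (simp add: poisson_weight_def field_simps del: of_nat_Suc)
  moreover have "(\<lambda>k. a * t * poisson_weight a k t) sums (a * t * 1)"
    by (rule sums_mult[OF poisson_weight_sums])
  ultimately have "(\<lambda>k. poisson_weight a (Suc k) t * real (Suc k)) sums (a * t)"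
    by simp
  then show ?thesis by (subst (asm) sums_Suc_iff) simp
qed

context queue_input
begin

lemma cost_upto_incseq: "incseq (\<lambda>m. cost_upto c n m j)"
  unfolding cost_upto_def by (intro incseq_SucI nn_integral_mono) simp

text \<open>Comparison, then uniqueness. Induction on \<open>m\<close> gives
  \<open>cost_upto\<close> \<le> \<open>w\<close>, so the supremum is finite, and by monotone
  convergence it solves the same equations. The difference of the two solutions solves the
  homogeneous equations, and \<open>walk_equation_unique\<close> makes it nonpositive.\<close>

lemma SUP_cost_upto_eq:
  fixes w :: "nat \<Rightarrow> real"
  assumes c [measurable]: "\<And>j k. (\<lambda>t. c j t k) \<in> borel_measurable borel"
    and w: "\<And>j. 0 \<le> w j" "w 0 = 0"
    and eq: "\<And>j. 1 \<le> j \<Longrightarrow> j \<le> n + 1 \<Longrightarrow> ennreal (w j) =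
      mean_step_cost c j + (\<Sum>k. ennreal (\<rho> k * w (min (j + k) (n + 1) - 1)))"
    and "j \<le> n + 1"
  shows "(SUP m. cost_upto c n m j) = ennreal (w j)"
proof -
  define v where "v = (\<lambda>j. SUP m. cost_upto c n m j)"
  have le: "cost_upto c n m j \<le> ennreal (w j)" if "j \<le> n + 1" for m j
    using that
  proof (induction m arbitrary: j)
    case (Suc m)
    show ?case
    proof (cases "j = 0")
      case False
      have "cost_upto c n (Suc m) j =
          mean_step_cost c j + (\<Sum>k. ennreal (\<rho> k) * cost_upto c n m (min (j + k) (n + 1) - 1))"
        using False by (intro cost_upto_Suc) auto
      also have "\<dots> \<le> mean_step_cost c j + (\<Sum>k. ennreal (\<rho> k * w (min (j + k) (n + 1) - 1)))"
        by (intro add_left_mono suminf_le)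
           (auto simp: ennreal_mult' mixed_poisson_nonneg intro!: mult_left_mono Suc.IH)
      also have "\<dots> = ennreal (w j)" using eq[of j] False Suc.prems by simp
      finally show ?thesis .
    qed simp
  qed simp
  have v_le: "v j \<le> ennreal (w j)" if "j \<le> n + 1" for j
    unfolding v_def using le[OF that] by (intro SUP_least)
  define u where "u = (\<lambda>j. enn2real (v j))"
  have v: "v j = ennreal (u j)" if "j \<le> n + 1" for j
    unfolding u_def using v_le[OF that] by (intro ennreal_enn2real[symmetric]) (rule le_less_trans, auto)
  have u: "0 \<le> u j" for j by (simp add: u_def)
  have v_eq: "v j = mean_step_cost c j + (\<Sum>k. ennreal (\<rho> k * u (min (j + k) (n + 1) - 1)))"
    if "1 \<le> j" for j
  proof -
    let ?J = "\<lambda>k. min (j + k) (n + 1) - 1"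
    \<comment> \<open>Dropping the first member of an increasing sequence leaves its supremum
      unchanged.\<close>
    have "v j = (SUP m. cost_upto c n (Suc m) j)"
      unfolding v_def
      by (rule antisym) (auto intro!: SUP_mono intro: exI[of _ "Suc _"] incseq_SucD[OF cost_upto_incseq])
    also have "\<dots> = (SUP m. mean_step_cost c j + (\<Sum>k. ennreal (\<rho> k) * cost_upto c n m (?J k)))"
      using that by (simp add: cost_upto_Suc)
    also have "\<dots> = mean_step_cost c j + (SUP m. (\<Sum>k. ennreal (\<rho> k) * cost_upto c n m (?J k)))"
      by (rule ennreal_SUP_add_right[symmetric]) simp
    also have "(SUP m. (\<Sum>k. ennreal (\<rho> k) * cost_upto c n m (?J k))) =
        (\<Sum>k. SUP m. ennreal (\<rho> k) * cost_upto c n m (?J k))"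
      by (rule ennreal_suminf_SUP_eq[symmetric])
         (auto simp: incseq_def intro!: mult_left_mono intro: incseqD[OF cost_upto_incseq])
    also have "\<dots> = (\<Sum>k. ennreal (\<rho> k) * v (?J k))"
      by (simp add: v_def SUP_mult_left_ennreal)
    also have "\<dots> = (\<Sum>k. ennreal (\<rho> k * u (?J k)))"
      by (intro suminf_cong) (simp add: v ennreal_mult mixed_poisson_nonneg u)
    finally show ?thesis .
  qed
  \<comment> \<open>Since the left side is finite, both summands are, which permits passing to real
    series that can be subtracted.\<close>
  have split: "\<exists>A. 0 \<le> A \<and> (\<lambda>k. \<rho> k * f (min (j + k) (n + 1) - 1)) sums A \<and> f j = enn2real (mean_step_cost c j) + A"
    if "ennreal (f j) = mean_step_cost c j + (\<Sum>k. ennreal (\<rho> k * f (min (j + k) (n + 1) - 1)))"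
      "\<And>j. 0 \<le> f j" for f :: "nat \<Rightarrow> real" and j
  proof -
    let ?s = "(\<Sum>k. ennreal (\<rho> k * f (min (j + k) (n + 1) - 1)))"
    have fin: "mean_step_cost c j \<noteq> \<top>" "?s \<noteq> \<top>"
      using that(1) by (metis ennreal_add_eq_top ennreal_neq_top)+
    then have "?s = ennreal (enn2real ?s)" by (simp add: less_top)
    then have "(\<lambda>k. \<rho> k * f (min (j + k) (n + 1) - 1)) sums enn2real ?s"
      using that(2) by (intro suminf_ennreal_imp_sums) (auto simp: mixed_poisson_nonneg)
    moreover have "enn2real (ennreal (f j)) = enn2real (mean_step_cost c j) + enn2real ?s"
      unfolding that(1) using fin by (intro enn2real_plus) (auto simp: less_top)
    then have "f j = enn2real (mean_step_cost c j) + enn2real ?s"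
      using that(2) by simp
    ultimately show ?thesis by (intro exI[of _ "enn2real ?s"]) simp
  qed
  have "w j - u j \<le> 0"
  proof (rule walk_equation_unique[where r=\<rho> and n=n and D="\<lambda>j. w j - u j"])
    show "w 0 - u 0 = 0" using w by (simp add: u_def v_def)
    fix j :: nat assume j: "1 \<le> j" "j \<le> n + 1"
    obtain A where A: "(\<lambda>k. \<rho> k * w (min (j + k) (n + 1) - 1)) sums A" "w j = enn2real (mean_step_cost c j) + A"
      using split[of w j] eq[OF j] w by blast
    obtain B where B: "(\<lambda>k. \<rho> k * u (min (j + k) (n + 1) - 1)) sums B" "u j = enn2real (mean_step_cost c j) + B"
      using split[of u j] v_eq[OF j(1)] v[OF j(2)] u by metis
    show "(\<lambda>k. \<rho> k * (w (min (j + k) (n + 1) - 1) - u (min (j + k) (n + 1) - 1))) sums (w j - u j)"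
      using sums_diff[OF A(1) B(1)] A(2) B(2) by (simp add: right_diff_distrib)
  qed (use \<open>j \<le> n + 1\<close> in \<open>auto simp: mixed_poisson_nonneg mixed_poisson_0_pos mixed_poisson_sums\<close>)
  then have "ennreal (w j) \<le> v j" using v[OF \<open>j \<le> n + 1\<close>] by (simp add: ennreal_leI)
  with v_le[OF \<open>j \<le> n + 1\<close>] show ?thesis unfolding v_def by (rule antisym)
qed

lemma nn_integral_total_cost:
  assumes [measurable]: "\<And>j k. (\<lambda>t. c j t k) \<in> borel_measurable borel"
  shows "(\<integral>\<^sup>+\<omega>. (\<Sum>k. step_cost c n j \<omega> k) \<partial>(T.S \<Otimes>\<^sub>M S)) = (SUP m. cost_upto c n m j)"
proof -
  have "(\<integral>\<^sup>+\<omega>. (\<Sum>k. step_cost c n j \<omega> k) \<partial>(T.S \<Otimes>\<^sub>M S)) =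
      (\<integral>\<^sup>+\<omega>. (SUP m. \<Sum>k<m. step_cost c n j \<omega> k) \<partial>(T.S \<Otimes>\<^sub>M S))"
    by (simp add: suminf_eq_SUP)
  also have "\<dots> = (SUP m. cost_upto c n m j)"
    unfolding cost_upto_def
    by (rule nn_integral_monotone_convergence_SUP) (auto simp: incseq_Suc_iff le_fun_def)
  finally show ?thesis .
qed

section \<open>Explicit solutions for the three costs\<close>

abbreviation mean_served :: "nat \<Rightarrow> nat \<Rightarrow> real" where
  "mean_served n j \<equiv> \<Sum>i\<in>{n + 1 - j..n}. Q_point \<rho> 1 i"

lemma Q_point_one_nonneg: "0 \<le> Q_point \<rho> 1 i"
  using Q_point_mono_nonneg[of \<rho> 1 i] mixed_poisson_nonneg mixed_poisson_0_pos sum_mixed_poisson_le_1 by simp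

lemma mean_served_nonneg: "0 \<le> mean_served n j"
  by (intro sum_nonneg Q_point_one_nonneg)

lemma mean_served_sums:
  assumes "1 \<le> j" "j \<le> n + 1"
  shows "(\<lambda>k. \<rho> k * mean_served n (min (j + k) (n + 1) - 1)) sums (mean_served n j - 1)"
  using mixed_poisson_0_pos assms by (intro Q_point_walk_sums mixed_poisson_sums) auto

lemma mean_served_ge_1:
  assumes "1 \<le> j" "j \<le> n + 1"
  shows "1 \<le> mean_served n j"
proof -
  have "0 \<le> mean_served n j - 1"
    by (rule sums_le[OF _ sums_zero mean_served_sums[OF assms]])
       (intro mult_nonneg_nonneg mixed_poisson_nonneg mean_served_nonneg)
  then show ?thesis by simp
qed

lemma mean_step_cost_const_arrivals:
  assumes [measurable]: "f \<in> borel_measurable borel"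
  shows "mean_step_cost (\<lambda>j t k. f t) j = (\<integral>\<^sup>+t. f t \<partial>G)"
  unfolding mean_step_cost_def using AE_G_pos
  by (intro nn_integral_cong_AE)
     (auto elim!: eventually_mono simp: ennreal_suminf_multc suminf_poisson_weight_ennreal a_pos)

lemma mean_step_cost_const_service:
  "mean_step_cost (\<lambda>j t k. f j k) j = (\<Sum>k. ennreal (\<rho> k) * f j k)"
  unfolding mean_step_cost_def
  by (subst nn_integral_suminf) (simp_all add: nn_integral_multc ennreal_mixed_poisson)

text \<open>Wald's identity: a cost depending on the service time alone contributes its mean for
  each service.\<close>

lemma SUP_cost_upto_linear:
  assumes f [measurable]: "f \<in> borel_measurable borel" and b: "(\<integral>\<^sup>+t. f t \<partial>G) = ennreal b" "0 \<le> b"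
    and "j \<le> n + 1"
  shows "(SUP m. cost_upto (\<lambda>j t k. f t) n m j) = ennreal (b * mean_served n j)"
proof (rule SUP_cost_upto_eq[where w="\<lambda>j. b * mean_served n j"])
  fix j assume j: "1 \<le> j" "j \<le> n + 1"
  have "(\<lambda>k. \<rho> k * (b * mean_served n (min (j + k) (n + 1) - 1))) sums (b * (mean_served n j - 1))"
    using sums_mult[OF mean_served_sums[OF j], of b] by (simp add: mult_ac)
  then have "(\<Sum>k. ennreal (\<rho> k * (b * mean_served n (min (j + k) (n + 1) - 1)))) = ennreal (b * (mean_served n j - 1))"
    using b by (intro suminf_ennreal_eq mult_nonneg_nonneg mixed_poisson_nonneg mean_served_nonneg)
  moreover have "ennreal b + ennreal (b * (mean_served n j - 1)) = ennreal (b * mean_served n j)"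
  proof -
    have "0 \<le> b * (mean_served n j - 1)"
      using b mean_served_ge_1[OF j] by (intro mult_nonneg_nonneg) auto
    from ennreal_plus[OF b(2) this] show ?thesis by (simp add: right_diff_distrib)
  qed
  ultimately show "ennreal (b * mean_served n j) = mean_step_cost (\<lambda>j t k. f t) j +
      (\<Sum>k. ennreal (\<rho> k * (b * mean_served n (min (j + k) (n + 1) - 1))))"
    by (simp only: mean_step_cost_const_arrivals[OF f] b)
next
  fix j show "0 \<le> b * mean_served n j" using b by (intro mult_nonneg_nonneg mean_served_nonneg)
qed (use assms in auto)

lemma mixed_poisson_mean_sums:
  assumes "integrable G (\<lambda>x. x)"
  shows "(\<lambda>k. \<rho> k * real k) sums (a * (\<integral>x. x \<partial>G))"
proof (rule suminf_ennreal_imp_sums)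
  have "(\<Sum>k. ennreal (\<rho> k * real k)) = (\<Sum>k. \<integral>\<^sup>+t. ennreal (poisson_weight a k t) * ennreal (real k) \<partial>G)"
    by (simp add: ennreal_mult mixed_poisson_nonneg ennreal_mixed_poisson nn_integral_multc)
  also have "\<dots> = (\<integral>\<^sup>+t. (\<Sum>k. ennreal (poisson_weight a k t) * ennreal (real k)) \<partial>G)"
    by (rule nn_integral_suminf[symmetric]) simp
  also have "\<dots> = (\<integral>\<^sup>+t. ennreal (a * t) \<partial>G)"
    using AE_G_pos
  proof (intro nn_integral_cong_AE, eventually_elim)
    fix t :: real assume "0 < t"
    then show "(\<Sum>k. ennreal (poisson_weight a k t) * ennreal (real k)) = ennreal (a * t)"
      using a_pos by (simp add: ennreal_mult[symmetric] poisson_weight_nonneg)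
        (intro suminf_ennreal_eq poisson_weight_mean_sums mult_nonneg_nonneg poisson_weight_nonneg; simp)
  qed
  also have "\<dots> = ennreal (\<integral>t. a * t \<partial>G)"
    using AE_G_pos a_pos assms by (intro nn_integral_eq_integral) (auto elim!: eventually_mono)
  finally show "(\<Sum>k. ennreal (\<rho> k * real k)) = ennreal (a * (\<integral>x. x \<partial>G))" by simp
  show "0 \<le> a * (\<integral>x. x \<partial>G)"
    using AE_G_pos a_pos by (intro mult_nonneg_nonneg integral_nonneg_AE) (auto elim!: eventually_mono)
qed (simp add: mixed_poisson_nonneg)

text \<open>Conservation of customers: the initial ones and the arrivals are served or lost, and Wald's
  identity gives the mean number of arrivals.\<close>

lemma SUP_cost_upto_lost:
  assumes int: "integrable G (\<lambda>x. x)" and b: "1 \<le> a * (\<integral>x. x \<partial>G)" and "j \<le> n + 1"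
  shows "(SUP m. cost_upto (\<lambda>j t k. ennreal (real (j + k - (n + 1)))) n m j) =
    ennreal (real j + (a * (\<integral>x. x \<partial>G) - 1) * mean_served n j)"
proof (rule SUP_cost_upto_eq[where w="\<lambda>j. real j + (a * (\<integral>x. x \<partial>G) - 1) * mean_served n j"])
  fix j assume j: "1 \<le> j" "j \<le> n + 1"
  let ?b = "a * (\<integral>x. x \<partial>G) - 1" and ?J = "\<lambda>k. min (j + k) (n + 1) - 1"
  let ?w = "\<lambda>j. real j + ?b * mean_served n j"
  \<comment> \<open>The assumption \<open>b\<close> keeps the candidate nonnegative; in the
    application it comes from Q0 > 0.\<close>
  have w: "0 \<le> ?w j" for j using b by (intro add_nonneg_nonneg mult_nonneg_nonneg mean_served_nonneg) auto
  have "mean_step_cost (\<lambda>j t k. ennreal (real (j + k - (n + 1)))) j = (\<Sum>k. ennreal (\<rho> k * real (j + k - (n + 1))))"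
    by (simp only: mean_step_cost_const_service[of "\<lambda>j k. ennreal (real (j + k - (n + 1)))"]
        ennreal_mult[OF mixed_poisson_nonneg of_nat_0_le_iff])
  then have "mean_step_cost (\<lambda>j t k. ennreal (real (j + k - (n + 1)))) j + (\<Sum>k. ennreal (\<rho> k * ?w (?J k))) =
      (\<Sum>k. ennreal (\<rho> k * real (j + k - (n + 1)))) + (\<Sum>k. ennreal (\<rho> k * ?w (?J k)))"
    by (simp only:)
  also have "\<dots> = (\<Sum>k. ennreal (\<rho> k * real (j + k - (n + 1))) + ennreal (\<rho> k * ?w (?J k)))"
    by (rule suminf_add) auto
  also have "\<dots> = (\<Sum>k. ennreal (\<rho> k * real k + \<rho> k * (real j - 1) + ?b * (\<rho> k * mean_served n (?J k))))"
  proof (rule suminf_cong)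
    fix k
    \<comment> \<open>One service as a balance: the lost customers plus those left behind are the
      \<open>j\<close> present plus the \<open>k\<close> arrivals minus the one served.\<close>
    have "real (j + k - (n + 1)) + real (?J k) = real k + (real j - 1)"
      using j by (cases "j + k \<le> n + 1") (auto simp: of_nat_diff)
    then have "\<rho> k * (real (j + k - (n + 1)) + real (?J k)) = \<rho> k * (real k + (real j - 1))" by (rule arg_cong)
    then have "\<rho> k * real (j + k - (n + 1)) + \<rho> k * ?w (?J k) =
        \<rho> k * real k + \<rho> k * (real j - 1) + ?b * (\<rho> k * mean_served n (?J k))"
      by (simp only: distrib_left mult.left_commute)
    then show "ennreal (\<rho> k * real (j + k - (n + 1))) + ennreal (\<rho> k * ?w (?J k)) =
        ennreal (\<rho> k * real k + \<rho> k * (real j - 1) + ?b * (\<rho> k * mean_served n (?J k)))"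
      by (subst ennreal_plus[symmetric]) (intro mult_nonneg_nonneg mixed_poisson_nonneg w of_nat_0_le_iff | simp only:)+
  qed
  also have "\<dots> = ennreal (a * (\<integral>x. x \<partial>G) + 1 * (real j - 1) + ?b * (mean_served n j - 1))"
  proof (rule suminf_ennreal_eq)
    show "0 \<le> \<rho> k * real k + \<rho> k * (real j - 1) + ?b * (\<rho> k * mean_served n (?J k))" for k
      using b j by (intro add_nonneg_nonneg mult_nonneg_nonneg mixed_poisson_nonneg mean_served_nonneg) auto
    show "(\<lambda>k. \<rho> k * real k + \<rho> k * (real j - 1) + ?b * (\<rho> k * mean_served n (?J k))) sums
      (a * (\<integral>x. x \<partial>G) + 1 * (real j - 1) + ?b * (mean_served n j - 1))"
      by (intro sums_add sums_mult sums_mult2 mixed_poisson_mean_sums[OF int] mixed_poisson_sums mean_served_sums[OF j])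
  qed
  also have "\<dots> = ennreal (?w j)"
    by (rule arg_cong[where f=ennreal]) (simp add: algebra_simps)
  finally show "ennreal (?w j) = mean_step_cost (\<lambda>j t k. ennreal (real (j + k - (n + 1)))) j +
      (\<Sum>k. ennreal (\<rho> k * ?w (?J k)))" ..
next
  fix j show "0 \<le> real j + (a * (\<integral>x. x \<partial>G) - 1) * mean_served n j"
    using b by (intro add_nonneg_nonneg mult_nonneg_nonneg mean_served_nonneg) auto
qed (use assms in auto)

text \<open>With unit cost the total counts the services before the first emptying. Its mean is
  finite, whereas on a path that never empties it is infinite. This makes the \<open>LEAST\<close>
  in \<open>mgi1_served\<close> meaningful.\<close>

lemma AE_content_reaches_0: "AE \<omega> in T.S \<Otimes>\<^sub>M S. \<exists>k. content_from n 1 \<omega> k = 0"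
proof -
  have "(\<integral>\<^sup>+\<omega>. (\<Sum>k. step_cost (\<lambda>_ _ _. 1) n 1 \<omega> k) \<partial>(T.S \<Otimes>\<^sub>M S)) \<noteq> \<infinity>"
    using SUP_cost_upto_linear[of "\<lambda>_. 1" 1 1 n]
    by (simp add: nn_integral_total_cost G.emeasure_space_1[simplified])
  then have "AE \<omega> in T.S \<Otimes>\<^sub>M S. (\<Sum>k. step_cost (\<lambda>_ _ _. 1) n 1 \<omega> k) \<noteq> \<infinity>"
    by (intro nn_integral_noteq_infinite) measurable
  then show ?thesis
  proof (rule eventually_mono)
    fix \<omega> assume fin: "(\<Sum>k. step_cost (\<lambda>_ _ _. 1) n 1 \<omega> k) \<noteq> \<infinity>"
    show "\<exists>k. content_from n 1 \<omega> k = 0"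
    proof (rule ccontr)
      assume "\<not> (\<exists>k. content_from n 1 \<omega> k = 0)"
      then have "step_cost (\<lambda>_ _ _. 1) n 1 \<omega> k = 1" for k by (simp add: step_cost_def)
      then have "(\<Sum>k. step_cost (\<lambda>_ _ _. 1) n 1 \<omega> k) = (\<Sum>k. ennreal 1)" by simp
      also have "\<dots> = \<top>"
      proof (rule ccontr)
        assume "(\<Sum>k. ennreal 1) \<noteq> \<top>"
        then have "summable (\<lambda>k::nat. 1::real)" by (rule summable_suminf_not_top[rotated]) simp
        then show False by (simp add: summable_const_iff)
      qed
      finally show False using fin by simp
    qed
  qed
qed

lemma total_cost_eq_sum_served:
  assumes "\<exists>k. content_from n 1 \<omega> k = 0"
  shows "(\<Sum>k. step_cost c n 1 \<omega> k) =
    (\<Sum>k<mgi1_served n \<omega>. c (mgi1_content n \<omega> k) (fst \<omega> k) (arrivals_in_service \<omega> k))"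
proof -
  define N where "N = mgi1_served n \<omega>"
  have N: "N = (LEAST k. content_from n 1 \<omega> k = 0)"
    by (simp add: N_def mgi1_served_def mgi1_content_eq)
  have 0: "content_from n 1 \<omega> N = 0" unfolding N using assms by (rule LeastI_ex)
  have less: "content_from n 1 \<omega> k \<noteq> 0" if "k < N" for k
    using not_less_Least[of k "\<lambda>k. content_from n 1 \<omega> k = 0"] that by (simp add: N)
  have "(\<Sum>k. step_cost c n 1 \<omega> k) = (\<Sum>k<N. step_cost c n 1 \<omega> k)"
  proof (rule suminf_finite)
    fix k assume "k \<notin> {..<N}"
    with 0 have "\<not> (\<forall>i\<le>k. content_from n 1 \<omega> i \<noteq> 0)" by (auto simp: not_less)
    then show "step_cost c n 1 \<omega> k = 0" unfolding step_cost_def by (rule if_not_P)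
  qed simp
  also have "\<dots> = (\<Sum>k<N. c (mgi1_content n \<omega> k) (fst \<omega> k) (arrivals_in_service \<omega> k))"
    using less by (intro sum.cong) (auto simp: step_cost_def mgi1_content_eq)
  finally show ?thesis by (simp add: N_def)
qed

lemma mgi1_served_measurable [measurable]:
  "mgi1_served n \<in> measurable (T.S \<Otimes>\<^sub>M S) (count_space UNIV)"
  unfolding mgi1_served_def mgi1_content_eq by measurable

lemma sum_served_measurable:
  fixes f :: "nat \<Rightarrow> _ \<Rightarrow> real"
  assumes [measurable]: "\<And>k. f k \<in> borel_measurable (T.S \<Otimes>\<^sub>M S)"
  shows "(\<lambda>\<omega>. \<Sum>k<mgi1_served n \<omega>. f k \<omega>) \<in> borel_measurable (T.S \<Otimes>\<^sub>M S)"
proof -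
  have "(\<lambda>\<omega>. \<Sum>k<N. f k \<omega>) \<in> borel_measurable (T.S \<Otimes>\<^sub>M S)" for N :: nat by measurable
  then show ?thesis by (rule measurable_compose_countable) measurable
qed

text \<open>Returns from \<open>ennreal\<close> costs to the Bochner integrals in the definitions.
  Cost and \<open>f\<close> are compared for positive service times, which occur almost
  surely.\<close>

lemma integral_sum_served:
  fixes f :: "nat \<Rightarrow> _ \<Rightarrow> real"
  assumes f [measurable]: "\<And>k. f k \<in> borel_measurable (T.S \<Otimes>\<^sub>M S)"
    and c [measurable]: "\<And>j k. (\<lambda>t. c j t k) \<in> borel_measurable borel"
    and fc: "\<And>k \<omega>. (\<And>i. 0 < fst \<omega> i) \<Longrightarrow> 0 \<le> f k \<omega> \<and>
        ennreal (f k \<omega>) = c (mgi1_content n \<omega> k) (fst \<omega> k) (arrivals_in_service \<omega> k)"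
    and val: "(SUP m. cost_upto c n m 1) = ennreal v" "0 \<le> v"
  shows "(\<integral>\<omega>. (\<Sum>k<mgi1_served n \<omega>. f k \<omega>) \<partial>mgi1_space a G) = v"
proof -
  have pos: "AE \<omega> in T.S \<Otimes>\<^sub>M S. \<forall>i. 0 < fst \<omega> i"
    using AE_T_pos by (intro TS.AE_pair_measure) (auto elim!: eventually_mono)
  have "(\<integral>\<omega>. (\<Sum>k<mgi1_served n \<omega>. f k \<omega>) \<partial>(T.S \<Otimes>\<^sub>M S)) =
      enn2real (\<integral>\<^sup>+\<omega>. ennreal (\<Sum>k<mgi1_served n \<omega>. f k \<omega>) \<partial>(T.S \<Otimes>\<^sub>M S))"
    using pos fc by (intro integral_eq_nn_integral sum_served_measurable f)
       (auto elim!: eventually_mono intro!: sum_nonneg)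
  also have "(\<integral>\<^sup>+\<omega>. ennreal (\<Sum>k<mgi1_served n \<omega>. f k \<omega>) \<partial>(T.S \<Otimes>\<^sub>M S)) =
      (\<integral>\<^sup>+\<omega>. (\<Sum>k. step_cost c n 1 \<omega> k) \<partial>(T.S \<Otimes>\<^sub>M S))"
    using pos AE_content_reaches_0[of n]
  proof (intro nn_integral_cong_AE, eventually_elim)
    fix \<omega> assume \<omega>: "\<forall>i. 0 < fst \<omega> i" "\<exists>k. content_from n 1 \<omega> k = 0"
    then have "ennreal (\<Sum>k<mgi1_served n \<omega>. f k \<omega>) = (\<Sum>k<mgi1_served n \<omega>. ennreal (f k \<omega>))"
      using fc by (intro sum_ennreal[symmetric]) auto
    also have "\<dots> = (\<Sum>k. step_cost c n 1 \<omega> k)"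
      unfolding total_cost_eq_sum_served[OF \<omega>(2)] using fc \<omega>(1) by (intro sum.cong) auto
    finally show "ennreal (\<Sum>k<mgi1_served n \<omega>. f k \<omega>) = (\<Sum>k. step_cost c n 1 \<omega> k)" .
  qed
  also have "\<dots> = ennreal v" using val by (simp add: nn_integral_total_cost)
  finally show ?thesis using val by (simp add: mgi1_space_def)
qed

lemma expectation_served: "(\<integral>\<omega>. real (mgi1_served n \<omega>) \<partial>mgi1_space a G) = Q_point \<rho> 1 n"
proof -
  have "(\<integral>\<omega>. (\<Sum>k<mgi1_served n \<omega>. 1::real) \<partial>mgi1_space a G) = 1 * mean_served n 1"
  proof (rule integral_sum_served[where c="\<lambda>j t k. 1"])
    show "(SUP m. cost_upto (\<lambda>j t k. 1) n m 1) = ennreal (1 * mean_served n 1)"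
      using G.emeasure_space_1 by (intro SUP_cost_upto_linear) auto
  qed (auto simp: Q_point_one_nonneg)
  \<comment> \<open>For \<open>j = 1\<close> the sum in \<open>mean_served\<close> is the single
    term Q_n.\<close>
  then show ?thesis by simp
qed

lemma expectation_busy_period:
  assumes "integrable G (\<lambda>x. x)"
  shows "(\<integral>\<omega>. mgi1_busy_period n \<omega> \<partial>mgi1_space a G) = (\<integral>x. x \<partial>G) * Q_point \<rho> 1 n"
proof -
  have b: "0 \<le> (\<integral>x. x \<partial>G)" using AE_G_pos by (intro integral_nonneg_AE) (auto elim!: eventually_mono)
  have "(\<integral>\<omega>. (\<Sum>k<mgi1_served n \<omega>. fst \<omega> k) \<partial>mgi1_space a G) = (\<integral>x. x \<partial>G) * mean_served n 1"
  proof (rule integral_sum_served[where c="\<lambda>j t k. ennreal t"])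
    have "(\<integral>\<^sup>+t. ennreal t \<partial>G) = ennreal (\<integral>x. x \<partial>G)"
      using AE_G_pos assms by (intro nn_integral_eq_integral) (auto elim!: eventually_mono)
    then show "(SUP m. cost_upto (\<lambda>j t k. ennreal t) n m 1) = ennreal ((\<integral>x. x \<partial>G) * mean_served n 1)"
      using b by (intro SUP_cost_upto_linear) auto
  qed (use b in \<open>auto simp: Q_point_one_nonneg less_imp_le\<close>)
  then show ?thesis by (simp add: mgi1_busy_period_def)
qed

lemma expectation_lost:
  assumes "integrable G (\<lambda>x. x)" "1 \<le> a * (\<integral>x. x \<partial>G)"
  shows "(\<integral>\<omega>. real (mgi1_lost n \<omega>) \<partial>mgi1_space a G) = 1 + (a * (\<integral>x. x \<partial>G) - 1) * Q_point \<rho> 1 n"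
proof -
  have "(\<integral>\<omega>. (\<Sum>k<mgi1_served n \<omega>. real (mgi1_content n \<omega> k + arrivals_in_service \<omega> k - (n + 1))) \<partial>mgi1_space a G)
    = real 1 + (a * (\<integral>x. x \<partial>G) - 1) * mean_served n 1"
  proof (rule integral_sum_served[where c="\<lambda>j t k. ennreal (real (j + k - (n + 1)))"])
    show "(SUP m. cost_upto (\<lambda>j t k. ennreal (real (j + k - (n + 1)))) n m 1) =
        ennreal (real 1 + (a * (\<integral>x. x \<partial>G) - 1) * mean_served n 1)"
      using assms by (intro SUP_cost_upto_lost) auto
    show "(\<lambda>\<omega>. real (mgi1_content n \<omega> k + arrivals_in_service \<omega> k - (n + 1))) \<in> borel_measurable (T.S \<Otimes>\<^sub>M S)" for k
      unfolding mgi1_content_eq by measurable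
  qed (use assms in \<open>auto simp: Q_point_one_nonneg\<close>)
  then show ?thesis by (simp add: mgi1_lost_def)
qed

end

section \<open>The GI/M/1/n-1 queue\<close>

lemma gim1_transition_eq_measure:
  "gim1_transition a G n i j = measure (G \<Otimes>\<^sub>M (\<Pi>\<^sub>M k\<in>UNIV. exponential a))
    {p \<in> space (G \<Otimes>\<^sub>M (\<Pi>\<^sub>M k\<in>UNIV. exponential a)).
       min (i + 1) n - card {k. k < min (i + 1) n \<and> (\<Sum>l\<le>k. snd p l) \<le> fst p} = j}"
  unfolding gim1_transition_def case_prod_beta prod.collapse by (rule refl)

context queue_input
begin

sublocale GS: pair_prob_space G S
  by unfold_locales

text \<open>Given the interarrival time, the potential number \<open>k\<close> of departures is
  Poisson. The definition counts at most \<open>m i\<close> of them; the truncated subtraction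
  \<open>m i - k\<close> has the same effect.\<close>

lemma gim1_transition_sums:
  fixes n :: nat
  defines "m \<equiv> \<lambda>i. min (i + 1) n"
  shows "(\<lambda>k. \<rho> k * of_bool (m i - k = j)) sums gim1_transition a G n i j"
proof (rule suminf_ennreal_imp_sums)
  let ?D = "\<lambda>x v. card {k. k < m i \<and> (\<Sum>l\<le>k. v l) \<le> x}"
  have D [measurable]: "(\<lambda>p. ?D (fst p) (snd p)) \<in> measurable (G \<Otimes>\<^sub>M S) (count_space UNIV)"
  proof (rule measurable_card)
    fix k
    have [measurable]: "(\<lambda>p. \<Sum>l\<le>k. snd p l) \<in> borel_measurable (G \<Otimes>\<^sub>M S)"
      by (intro borel_measurable_sum) simp
    have [measurable]: "(\<lambda>p. fst p) \<in> borel_measurable (G \<Otimes>\<^sub>M S)"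
      by simp
    have "{p \<in> space (G \<Otimes>\<^sub>M S). k < m i \<and> (\<Sum>l\<le>k. snd p l) \<le> fst p} \<in> sets (G \<Otimes>\<^sub>M S)" by measurable
    then show "{p \<in> space (G \<Otimes>\<^sub>M S). k \<in> {k. k < m i \<and> (\<Sum>l\<le>k. snd p l) \<le> fst p}} \<in> sets (G \<Otimes>\<^sub>M S)"
      by (simp only: mem_Collect_eq)
  qed
  let ?E = "{p \<in> space (G \<Otimes>\<^sub>M S). m i - ?D (fst p) (snd p) = j}"
  have "(\<lambda>p. m i - ?D (fst p) (snd p)) \<in> measurable (G \<Otimes>\<^sub>M S) (count_space UNIV)"
    by (rule measurable_compose[OF D]) simp
  then have "(\<lambda>p. m i - ?D (fst p) (snd p)) -` {j} \<inter> space (G \<Otimes>\<^sub>M S) \<in> sets (G \<Otimes>\<^sub>M S)"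
    by (rule measurable_sets) simp
  moreover have "(\<lambda>p. m i - ?D (fst p) (snd p)) -` {j} \<inter> space (G \<Otimes>\<^sub>M S) = ?E" by blast
  ultimately have E: "?E \<in> sets (G \<Otimes>\<^sub>M S)" by (simp only:)
  have "gim1_transition a G n i j = measure (G \<Otimes>\<^sub>M S) ?E"
    unfolding m_def by (rule gim1_transition_eq_measure)
  then have "ennreal (gim1_transition a G n i j) = emeasure (G \<Otimes>\<^sub>M S) ?E"
    by (simp only: GS.emeasure_eq_measure)
  also have "\<dots> = (\<integral>\<^sup>+p. indicator ?E p \<partial>(G \<Otimes>\<^sub>M S))"
    by (rule nn_integral_indicator[OF E, symmetric])
  also have "\<dots> = (\<integral>\<^sup>+x. (\<integral>\<^sup>+v. indicator ?E (x, v) \<partial>S) \<partial>G)"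
    by (rule P.nn_integral_fst[symmetric]) (rule borel_measurable_indicator[OF E])
  also have "\<dots> = (\<integral>\<^sup>+x. (\<Sum>k. ennreal (poisson_weight a k x) * of_bool (m i - k = j)) \<partial>G)"
    using AE_G_pos
  proof (intro nn_integral_cong_AE, eventually_elim)
    fix x :: real assume x: "0 < x"
    have "(\<integral>\<^sup>+v. indicator ?E (x, v) \<partial>S) = (\<integral>\<^sup>+v. of_bool (m i - arrival_count x v = j) \<partial>S)"
      using AE_pos AE_count_is[OF less_imp_le[OF x]]
    proof (intro nn_integral_cong_AE, eventually_elim)
      fix v :: "nat \<Rightarrow> real" assume v: "\<forall>j. 0 < v j" and N: "count_is v x (arrival_count x v)"
      have "{k. arrival_time v (Suc k) \<le> x} = {..<arrival_count x v}"
        using v count_is_imp_arrival_set[OF _ N] by (auto simp: less_imp_le)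
      then have "{k. k < m i \<and> (\<Sum>l\<le>k. v l) \<le> x} = {..<m i} \<inter> {..<arrival_count x v}"
        by (auto simp: arrival_time_def lessThan_Suc_atMost)
      also have "\<dots> = {..<min (m i) (arrival_count x v)}" by auto
      finally have "?D x v = min (m i) (arrival_count x v)" by (simp only: card_lessThan)
      then have "m i - ?D x v = m i - arrival_count x v" by auto
      then show "indicator ?E (x, v) = (of_bool (m i - arrival_count x v = j) :: ennreal)"
        by (auto simp: indicator_def space_pair_measure space_PiM)
    qed
    also have "\<dots> = (\<Sum>k. ennreal (poisson_weight a k x) * (\<integral>\<^sup>+v. of_bool (m i - k = j) \<partial>S))"
      using x by (intro nn_integral_restart[where \<Phi>="\<lambda>k v. of_bool (m i - k = j)"]) auto
    finally show "(\<integral>\<^sup>+v. indicator ?E (x, v) \<partial>S) = (\<Sum>k. ennreal (poisson_weight a k x) * of_bool (m i - k = j))"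
      by (simp add: P.emeasure_space_1)
  qed
  also have "\<dots> = (\<Sum>k. ennreal (\<rho> k) * of_bool (m i - k = j))"
    by (subst nn_integral_suminf) (simp_all add: nn_integral_multc ennreal_mixed_poisson)
  also have "\<dots> = (\<Sum>k. ennreal (\<rho> k * of_bool (m i - k = j)))"
    by (intro suminf_cong) auto
  finally show "(\<Sum>k. ennreal (\<rho> k * of_bool (m i - k = j))) = ennreal (gim1_transition a G n i j)" ..
qed (auto simp: mixed_poisson_nonneg gim1_transition_def)

text \<open>For \<open>1 \<le> j\<close> just one number of departures leads to \<open>j\<close>,
  whereas state 0 collects a whole tail.\<close>

lemma gim1_transition_eq:
  assumes "1 \<le> j"
  shows "gim1_transition a G n i j = (if j \<le> min (i + 1) n then \<rho> (min (i + 1) n - j) else 0)"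
proof -
  let ?m = "min (i + 1) n"
  have "(\<lambda>k. \<rho> k * of_bool (?m - k = j)) sums (\<Sum>k\<in>{?m - j}. \<rho> k * of_bool (?m - k = j))"
    using assms by (intro sums_finite) auto
  from sums_unique2[OF gim1_transition_sums this] assms show ?thesis by auto
qed

lemma sum_gim1_transition:
  assumes "i \<le> n"
  shows "(\<Sum>j\<le>n. gim1_transition a G n i j) = 1"
proof -
  let ?m = "min (i + 1) n"
  have "(\<lambda>k. \<Sum>j\<le>n. \<rho> k * of_bool (?m - k = j)) sums (\<Sum>j\<le>n. gim1_transition a G n i j)"
    by (intro sums_sum gim1_transition_sums)
  moreover have "(\<Sum>j\<le>n. \<rho> k * of_bool (?m - k = j)) = \<rho> k" for k
  proof -
    have "(\<Sum>j\<le>n. \<rho> k * of_bool (?m - k = j)) = (\<Sum>j\<in>{?m - k}. \<rho> k * of_bool (?m - k = j))"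
      by (intro sum.mono_neutral_right) auto
    then show ?thesis by simp
  qed
  ultimately show ?thesis using mixed_poisson_sums sums_unique2 by simp blast
qed

text \<open>Summation over the number \<open>d\<close> of departures. The range
  \<open>d \<le> n - j\<close> does not depend on \<open>i\<close>, so that \<open>gim1_cut\<close>
  can exchange the sums.\<close>

lemma gim1_upper_transition:
  assumes "1 \<le> j" "j \<le> n"
  shows "(\<Sum>l\<in>{j..n}. gim1_transition a G n i l) = (\<Sum>d\<le>n - j. \<rho> d * of_bool (j + d \<le> min (i + 1) n))"
proof -
  let ?m = "min (i + 1) n"
  have "(\<Sum>l\<in>{j..n}. gim1_transition a G n i l) = (\<Sum>l\<in>{j..n}. if l \<le> ?m then \<rho> (?m - l) else 0)"
    using assms by (intro sum.cong gim1_transition_eq) auto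
  also have "\<dots> = (\<Sum>l\<in>{j..?m}. \<rho> (?m - l))"
    by (subst sum.inter_filter[symmetric]) (auto intro!: sum.cong)
  also have "\<dots> = (\<Sum>d\<in>{d. j + d \<le> ?m}. \<rho> d)"
    by (rule sum.reindex_bij_witness[where i="\<lambda>d. ?m - d" and j="\<lambda>l. ?m - l"]) auto
  also have "{d. j + d \<le> ?m} = {d \<in> {..n - j}. j + d \<le> ?m}" by auto
  also have "(\<Sum>d\<in>\<dots>. \<rho> d) = (\<Sum>d\<le>n - j. \<rho> d * of_bool (j + d \<le> ?m))"
    unfolding sum.inter_filter[OF finite_atMost] by (rule sum.cong) auto
  finally show ?thesis .
qed

text \<open>Balance of the flow across the cut between the states below and above \<open>j\<close>.\<close>

lemma gim1_cut:
  assumes "1 \<le> j" "j \<le> n"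
  shows "(\<Sum>l\<in>{j..n}. \<Sum>i\<le>n. p i * gim1_transition a G n i l) =
    (\<Sum>d\<le>n - j. \<rho> d * (\<Sum>i\<in>{j + d - 1..n}. p i))"
proof -
  have "(\<Sum>l\<in>{j..n}. \<Sum>i\<le>n. p i * gim1_transition a G n i l) =
      (\<Sum>i\<le>n. p i * (\<Sum>l\<in>{j..n}. gim1_transition a G n i l))"
    by (subst sum.swap) (simp add: sum_distrib_left)
  also have "\<dots> = (\<Sum>i\<le>n. \<Sum>d\<le>n - j. \<rho> d * (p i * of_bool (j + d \<le> min (i + 1) n)))"
    by (simp only: gim1_upper_transition[OF assms] sum_distrib_left mult.left_commute)
  also have "\<dots> = (\<Sum>d\<le>n - j. \<rho> d * (\<Sum>i\<le>n. p i * of_bool (j + d \<le> min (i + 1) n)))"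
    by (subst sum.swap) (simp only: sum_distrib_left)
  also have "\<dots> = (\<Sum>d\<le>n - j. \<rho> d * (\<Sum>i\<in>{j + d - 1..n}. p i))"
  proof (rule sum.cong[OF refl])
    fix d assume d: "d \<in> {..n - j}"
    have "(\<Sum>i\<le>n. p i * of_bool (j + d \<le> min (i + 1) n)) = (\<Sum>i\<in>{i \<in> {..n}. j + d \<le> min (i + 1) n}. p i)"
      unfolding sum.inter_filter[OF finite_atMost] by (rule sum.cong) auto
    also have "{i \<in> {..n}. j + d \<le> min (i + 1) n} = {j + d - 1..n}" using d assms by auto
    finally show "\<rho> d * (\<Sum>i\<le>n. p i * of_bool (j + d \<le> min (i + 1) n)) = \<rho> d * (\<Sum>i\<in>{j + d - 1..n}. p i)"
      by (rule arg_cong)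
  qed
  finally show ?thesis .
qed

lemma Q_point_one_pos: "0 < Q_point \<rho> 1 n"
  using mixed_poisson_0_pos by (intro Q_point_pos mixed_poisson_nonneg sum_mixed_poisson_le_1) auto

text \<open>By the cut equations the tail sums \<open>R k\<close> satisfy the recurrence with
  initial value \<open>p n\<close>. Hence the total mass 1 is \<open>p n\<close> times Q_n.\<close>

lemma gim1_stationary_loss:
  assumes "gim1_stationary a G n p"
  shows "p n = 1 / Q_point \<rho> 1 n"
proof -
  have sum: "(\<Sum>j\<le>n. p j) = 1" and bal: "\<And>j. j \<le> n \<Longrightarrow> p j = (\<Sum>i\<le>n. p i * gim1_transition a G n i j)"
    using assms by (auto simp: gim1_stationary_def)
  define R where "R = (\<lambda>k. \<Sum>i\<in>{n - k..n}. p i)"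
  have "R n = Q_point \<rho> (p n * 1) n"
  proof (rule Q_point_unique[where N=n])
    fix k assume k: "k < n"
    have "R k = (\<Sum>l\<in>{n - k..n}. \<Sum>i\<le>n. p i * gim1_transition a G n i l)"
      unfolding R_def by (intro sum.cong bal) auto
    also have "\<dots> = (\<Sum>d\<le>n - (n - k). \<rho> d * (\<Sum>i\<in>{n - k + d - 1..n}. p i))"
      using k by (intro gim1_cut) auto
    also have "\<dots> = (\<Sum>d\<le>k. \<rho> d * R (Suc k - d))"
    proof (rule sum.cong)
      fix d assume "d \<in> {..k}"
      with k have "n - k + d - 1 = n - (Suc k - d)" by auto
      then show "\<rho> d * (\<Sum>i\<in>{n - k + d - 1..n}. p i) = \<rho> d * R (Suc k - d)" by (simp add: R_def)
    qed (use k in auto)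
    finally show "R k = (\<Sum>d\<le>k. \<rho> d * R (Suc k - d))" .
  qed (use mixed_poisson_0_pos in \<open>auto simp: R_def\<close>)
  also have "\<dots> = p n * Q_point \<rho> 1 n" using mixed_poisson_0_pos by (intro Q_point_scale) auto
  finally have "p n * Q_point \<rho> 1 n = 1" using sum by (simp add: R_def atLeast0AtMost)
  with Q_point_one_pos[of n] show ?thesis by (simp add: field_simps)
qed

text \<open>Resolves the \<open>THE\<close> in \<open>gim1_loss_prob\<close>. The witness reverses
  the uniqueness argument: its tail sums are Q_{n-j} / Q_n, and its entries are nonnegative because
  Q increases.\<close>

lemma gim1_stationary_exists:
  assumes "1 \<le> n"
  shows "\<exists>p. gim1_stationary a G n p"
proof -
  let ?q = "Q_point \<rho> 1"
  define p where "p = (\<lambda>i. (?q (n - i) - (if i < n then ?q (n - Suc i) else 0)) / ?q n)"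
  have tail: "(\<Sum>i\<in>{j..n}. p i) = ?q (n - j) / ?q n" if "j \<le> n" for j
    using that
  proof (induction rule: inc_induct)
    case base
    then show ?case by (simp add: p_def)
  next
    case (step j)
    then have "{j..n} = insert j {Suc j..n}" by auto
    with step show ?case by (simp add: p_def diff_divide_distrib)
  qed
  let ?b = "\<lambda>j. \<Sum>i\<le>n. p i * gim1_transition a G n i j"
  have cut: "(\<Sum>l\<in>{j..n}. ?b l) = ?q (n - j) / ?q n" if "1 \<le> j" "j \<le> n" for j
  proof -
    have "(\<Sum>l\<in>{j..n}. ?b l) = (\<Sum>d\<le>n - j. \<rho> d * (\<Sum>i\<in>{j + d - 1..n}. p i))"
      by (rule gim1_cut[OF that])
    also have "\<dots> = (\<Sum>d\<le>n - j. \<rho> d * ?q (Suc (n - j) - d)) / ?q n"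
      unfolding sum_divide_distrib
    proof (rule sum.cong)
      fix d assume "d \<in> {..n - j}"
      with that have "j + d - 1 \<le> n" "n - (j + d - 1) = Suc (n - j) - d" by auto
      then show "\<rho> d * (\<Sum>i\<in>{j + d - 1..n}. p i) = \<rho> d * ?q (Suc (n - j) - d) / ?q n"
        by (simp add: tail)
    qed simp
    finally show ?thesis using Q_point_recurrence[of \<rho> 1 "n - j"] mixed_poisson_0_pos by simp
  qed
  \<comment> \<open>The cut at 0 lies outside \<open>gim1_cut\<close>; it holds because the rows of
    the transition matrix sum to 1.\<close>
  have cut0: "(\<Sum>l\<in>{0..n}. ?b l) = 1"
  proof -
    have "(\<Sum>l\<in>{0..n}. ?b l) = (\<Sum>i\<le>n. p i * (\<Sum>l\<le>n. gim1_transition a G n i l))"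
      unfolding atLeast0AtMost by (subst sum.swap) (simp add: sum_distrib_left)
    also have "\<dots> = (\<Sum>i\<in>{0..n}. p i)" by (simp add: sum_gim1_transition atLeast0AtMost)
    also have "\<dots> = 1" using tail[of 0] Q_point_one_pos[of n] by simp
    finally show ?thesis .
  qed
  have cut_eq: "(\<Sum>l\<in>{j..n}. ?b l) = (\<Sum>i\<in>{j..n}. p i)" if "j \<le> n" for j
    using cut[of j] tail[OF that] that cut0 Q_point_one_pos[of n] by (cases "j = 0") auto
  \<comment> \<open>Each balance equation is the difference of two neighbouring cuts.\<close>
  have bal: "p j = ?b j" if "j \<le> n" for j
  proof (cases "j = n")
    case True
    with cut_eq[of n] show ?thesis by simp
  next
    case False
    with that have "{j..n} = insert j {Suc j..n}" by auto
    with cut_eq[of j] cut_eq[of "Suc j"] False that show ?thesis by simp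
  qed
  have "0 \<le> p j" for j
  proof -
    have "?q (n - Suc j) \<le> ?q (n - j)" if "j < n"
    proof -
      have "n - j = Suc (n - Suc j)" using that by simp
      then show ?thesis
        using Q_point_mono_nonneg[of \<rho> 1 "n - Suc j"] mixed_poisson_nonneg mixed_poisson_0_pos sum_mixed_poisson_le_1
        by simp
    qed
    then show ?thesis using Q_point_one_pos[of n] Q_point_one_nonneg by (auto simp: p_def)
  qed
  moreover have "(\<Sum>j\<le>n. p j) = 1" using tail[of 0] Q_point_one_pos[of n] by (simp add: atLeast0AtMost)
  ultimately show ?thesis
    unfolding gim1_stationary_def by (intro exI[of _ p] conjI allI impI bal)
qed

lemma gim1_loss_prob_eq: "gim1_loss_prob a G n = 1 / Q_point \<rho> 1 n"
proof (cases "n = 0")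
  case True
  then show ?thesis by (simp add: gim1_loss_prob_def)
next
  case False
  then obtain p where p: "gim1_stationary a G n p" using gim1_stationary_exists[of n] by auto
  have "(THE \<pi>. \<exists>p. gim1_stationary a G n p \<and> \<pi> = p n) = 1 / Q_point \<rho> 1 n"
  proof (rule the_equality)
    show "\<exists>p. gim1_stationary a G n p \<and> 1 / Q_point \<rho> 1 n = p n"
      using p gim1_stationary_loss[OF p] by (intro exI[of _ p]) simp
  qed (auto dest: gim1_stationary_loss)
  with False show ?thesis by (simp add: gim1_loss_prob_def)
qed

text \<open>Each case is a multiple of the sequence with initial value 1, which is what the
  preceding computations produce.\<close>

theorem queueing_characteristic_eq_Q_point:
  assumes "queueing_characteristic a G Q0 Q" "0 < Q0"
  shows "Q n = Q_point \<rho> Q0 n"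
proof -
  have scale: "Q_point \<rho> c n = c * Q_point \<rho> 1 n" for c
    using Q_point_scale[of \<rho> c 1 n] mixed_poisson_0_pos by simp
  from assms(1) show ?thesis
  proof cases
    case (busy_period)
    then show ?thesis using expectation_busy_period[of n] scale[of Q0] by simp
  next
    case served
    then show ?thesis using expectation_served by simp
  next
    \<comment> \<open>Here \<open>0 < Q0\<close> says that the mean number of arrivals per service
      exceeds 1, as \<open>expectation_lost\<close> requires; its summand 1 cancels the 1 subtracted
      in the definition.\<close>
    case lost
    then show ?thesis using expectation_lost[of n] scale[of Q0] assms(2) by simp
  next
    case loss_prob
    then show ?thesis using gim1_loss_prob_eq by simp
  qed
qed

end

section \<open>First-order expansion of the bounds\<close>

text \<open>The lower bound is the value at \<open>\<epsilon>\<close>, the upper bound the value at \<open>- \<epsilon>\<close>; the sign changes only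
  in the terms that enter negatively.\<close>

function real_bound :: "(nat \<Rightarrow> real) \<Rightarrow> real \<Rightarrow> real \<Rightarrow> nat \<Rightarrow> real" where
  "real_bound r e Q0 0 = Q0"
| "real_bound r e Q0 (Suc n) =
     (real_bound r e Q0 n - (\<Sum>i\<in>{1..n}. (r i + 2 * e) * real_bound r (if i = 1 then e else - e) Q0 (Suc n - i)))
       / (r 0 + e)"
  by pat_completeness auto
termination
  by (relation "Wellfounded.measure (\<lambda>(r, e, Q0, n). n)") auto

text \<open>Minus the derivative at \<rho> of the recurrent sequence in direction \<open>d\<close>,
  obtained by differentiating the recurrence in \<open>Q_point_Suc\<close> with respect to the
  weights.\<close>

function linear_term :: "(nat \<Rightarrow> real) \<Rightarrow> (nat \<Rightarrow> real) \<Rightarrow> (nat \<Rightarrow> real) \<Rightarrow> nat \<Rightarrow> real" where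
  "linear_term \<rho> q d 0 = 0"
| "linear_term \<rho> q d (Suc n) =
     ((\<Sum>i\<le>n. d i * q (Suc n - i)) + linear_term \<rho> q d n - (\<Sum>i\<in>{1..n}. \<rho> i * linear_term \<rho> q d (Suc n - i)))
       / \<rho> 0"
  by pat_completeness auto
termination
  by (relation "Wellfounded.measure (\<lambda>(r, q, d, n). n)") auto

text \<open>The coefficient of \<open>\<epsilon>\<close> in the first-order expansion of the bounds.\<close>

function half_width :: "(nat \<Rightarrow> real) \<Rightarrow> (nat \<Rightarrow> real) \<Rightarrow> nat \<Rightarrow> real" where
  "half_width \<rho> q 0 = 0"
| "half_width \<rho> q (Suc n) =
     (q (Suc n) + (\<Sum>i\<in>{1..n}. 2 * q (Suc n - i)) + half_width \<rho> q n
       - (\<Sum>i\<in>{1..n}. \<rho> i * ((if i = 1 then 1 else - 1) * half_width \<rho> q (Suc n - i)))) / \<rho> 0"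
  by pat_completeness auto
termination
  by (relation "Wellfounded.measure (\<lambda>(r, q, n). n)") auto

lemma linear_term_add:
  "linear_term \<rho> q (\<lambda>i. d i + d' i) n = linear_term \<rho> q d n + linear_term \<rho> q d' n"
proof (induction n rule: less_induct)
  case (less n)
  show ?case
  proof (cases n)
    case (Suc m)
    have "(\<Sum>i\<in>{1..m}. \<rho> i * linear_term \<rho> q (\<lambda>i. d i + d' i) (Suc m - i)) =
      (\<Sum>i\<in>{1..m}. \<rho> i * linear_term \<rho> q d (Suc m - i)) + (\<Sum>i\<in>{1..m}. \<rho> i * linear_term \<rho> q d' (Suc m - i))"
      using less Suc by (subst sum.distrib[symmetric], intro sum.cong) (auto simp: distrib_left)
    moreover have "linear_term \<rho> q (\<lambda>i. d i + d' i) m = linear_term \<rho> q d m + linear_term \<rho> q d' m"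
      using less Suc by simp
    ultimately show ?thesis
      unfolding Suc linear_term.simps by (simp only: add_divide_distrib[symmetric] distrib_right sum.distrib)
        (simp add: algebra_simps)
  qed simp
qed

lemma linear_term_scale: "linear_term \<rho> q (\<lambda>i. c * d i) n = c * linear_term \<rho> q d n"
proof (induction n rule: less_induct)
  case (less n)
  show ?case
  proof (cases n)
    case (Suc m)
    have "(\<Sum>i\<in>{1..m}. \<rho> i * linear_term \<rho> q (\<lambda>i. c * d i) (Suc m - i)) =
      c * (\<Sum>i\<in>{1..m}. \<rho> i * linear_term \<rho> q d (Suc m - i))"
      using less Suc by (subst sum_distrib_left, intro sum.cong) auto
    moreover have "linear_term \<rho> q (\<lambda>i. c * d i) m = c * linear_term \<rho> q d m"
      using less Suc by simp
    ultimately show ?thesis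
      unfolding Suc linear_term.simps
      by (simp only: times_divide_eq_right distrib_left right_diff_distrib mult.assoc sum_distrib_left[symmetric])
  qed simp
qed

lemma linear_term_zero: "linear_term \<rho> q (\<lambda>i. 0) n = 0"
  using linear_term_scale[of \<rho> q 0 "\<lambda>i. 0" n] by simp

lemma linear_term_sum:
  "linear_term \<rho> q (\<lambda>i. \<Sum>k\<in>A. d k i) n = (\<Sum>k\<in>A. linear_term \<rho> q (d k) n)"
  by (induction A rule: infinite_finite_induct) (simp_all add: linear_term_zero linear_term_add)

lemma linear_term_diff:
  "linear_term \<rho> q (\<lambda>i. d i - d' i) n = linear_term \<rho> q d n - linear_term \<rho> q d' n"
  using linear_term_add[of \<rho> q d "\<lambda>i. - 1 * d' i" n] linear_term_scale[of \<rho> q "- 1" d' n] by simp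

text \<open>The recursion of \<open>half_width\<close> dominates that of \<open>linear_term\<close>
  term by term: its signs make all contributions add up, given 0 \<le> 1 - \<rho> 1, and its
  coefficients 1 and 2 are at least 1. For weights in [0, 1], measured from 1 / 2, the bound is
  \<open>half_width / 2\<close>; this is the origin of the oscillation bound.\<close>

lemma abs_linear_term_le:
  assumes \<rho>: "\<And>i. 0 \<le> \<rho> i" "0 < \<rho> 0" "\<rho> 1 \<le> 1" and q: "\<And>i. 0 \<le> q i" and d: "\<And>i. \<bar>d i\<bar> \<le> b"
  shows "\<bar>linear_term \<rho> q d n\<bar> \<le> b * half_width \<rho> q n"
proof (induction n rule: less_induct)
  case (less n)
  show ?case
  proof (cases n)
    case (Suc m)
    let ?l = "linear_term \<rho> q d" and ?c = "half_width \<rho> q"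
    let ?\<sigma> = "\<lambda>i::nat. if i = 1 then 1 else - 1 :: real"
    have b: "0 \<le> b" using d[of 0] by linarith
    have 1: "\<bar>\<Sum>i\<le>m. d i * q (Suc m - i)\<bar> \<le> b * (q (Suc m) + (\<Sum>i\<in>{1..m}. 2 * q (Suc m - i)))"
    proof -
      have "\<bar>\<Sum>i\<le>m. d i * q (Suc m - i)\<bar> \<le> (\<Sum>i\<le>m. b * q (Suc m - i))"
        using d q by (intro sum_abs[THEN order_trans] sum_mono) (simp add: abs_mult mult_right_mono)
      also have "\<dots> = b * (q (Suc m) + (\<Sum>i\<in>{1..m}. q (Suc m - i)))"
      proof -
        have "{..m} = insert 0 {1..m}" by auto
        then show ?thesis by (simp add: sum_distrib_left distrib_left)
      qed
      also have "\<dots> \<le> b * (q (Suc m) + (\<Sum>i\<in>{1..m}. 2 * q (Suc m - i)))"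
        using q b by (intro mult_left_mono add_left_mono sum_mono) auto
      finally show ?thesis .
    qed
    have 2: "\<bar>?l m - (\<Sum>i\<in>{1..m}. \<rho> i * ?l (Suc m - i))\<bar> \<le>
        b * (?c m - (\<Sum>i\<in>{1..m}. \<rho> i * (?\<sigma> i * ?c (Suc m - i))))"
    proof (cases "m = 0")
      case False
      \<comment> \<open>The summand i = 1 joins the leading term, so that their joint coefficient is
        the nonnegative 1 - \<rho> 1.\<close>
      then have S: "{1..m} = insert 1 {2..m}" by auto
      have e1: "?l m - (\<Sum>i\<in>{1..m}. \<rho> i * ?l (Suc m - i)) = (1 - \<rho> 1) * ?l m - (\<Sum>i\<in>{2..m}. \<rho> i * ?l (Suc m - i))"
        unfolding S by (subst sum.insert) (auto simp: algebra_simps)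
      have "(\<Sum>i\<in>{2..m}. \<rho> i * (?\<sigma> i * ?c (Suc m - i))) = - (\<Sum>i\<in>{2..m}. \<rho> i * ?c (Suc m - i))"
        by (subst sum_negf[symmetric], intro sum.cong) auto
      then have e2: "?c m - (\<Sum>i\<in>{1..m}. \<rho> i * (?\<sigma> i * ?c (Suc m - i))) =
          (1 - \<rho> 1) * ?c m + (\<Sum>i\<in>{2..m}. \<rho> i * ?c (Suc m - i))"
        unfolding S by (subst sum.insert) (auto simp: algebra_simps)
      have "\<bar>(1 - \<rho> 1) * ?l m\<bar> \<le> b * ((1 - \<rho> 1) * ?c m)"
        using mult_left_mono[OF less[of m], of "1 - \<rho> 1"] \<rho>(3) Suc by (simp add: abs_mult mult_ac)
      moreover have "\<bar>\<Sum>i\<in>{2..m}. \<rho> i * ?l (Suc m - i)\<bar> \<le> b * (\<Sum>i\<in>{2..m}. \<rho> i * ?c (Suc m - i))"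
        unfolding sum_distrib_left
      proof (intro sum_abs[THEN order_trans] sum_mono)
        fix i assume "i \<in> {2..m}"
        then show "\<bar>\<rho> i * ?l (Suc m - i)\<bar> \<le> b * (\<rho> i * ?c (Suc m - i))"
          using mult_left_mono[OF less[of "Suc m - i"], of "\<rho> i"] \<rho>(1)[of i] Suc by (simp add: abs_mult mult_ac)
      qed
      ultimately show ?thesis unfolding e1 e2 distrib_left by linarith
    qed simp
    have "\<bar>?l (Suc m)\<bar> = \<bar>(\<Sum>i\<le>m. d i * q (Suc m - i)) + (?l m - (\<Sum>i\<in>{1..m}. \<rho> i * ?l (Suc m - i)))\<bar> / \<rho> 0"
      using \<rho>(2) by (simp add: abs_divide add_diff_eq)
    also have "\<dots> \<le> (b * (q (Suc m) + (\<Sum>i\<in>{1..m}. 2 * q (Suc m - i))) +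
        b * (?c m - (\<Sum>i\<in>{1..m}. \<rho> i * (?\<sigma> i * ?c (Suc m - i))))) / \<rho> 0"
      using 1 2 \<rho>(2) by (intro divide_right_mono) linarith+
    also have "\<dots> = b * ?c (Suc m)"
      by (simp only: half_width.simps times_divide_eq_right distrib_left[symmetric] add_diff_eq)
    finally show ?thesis unfolding Suc .
  qed simp
qed

lemma half_width_pos:
  assumes \<rho>: "\<And>i. 0 \<le> \<rho> i" "0 < \<rho> 0" "\<rho> 1 \<le> 1" and q: "\<And>i. 0 < q i"
  shows "0 < half_width \<rho> q (Suc n)"
proof -
  \<comment> \<open>The estimate for the zero direction with \<open>b = 1\<close> reads 0 \<le>
    \<open>half_width\<close>.\<close>
  have nn: "0 \<le> half_width \<rho> q m" for m
    using abs_linear_term_le[of \<rho> q "\<lambda>_. 0" 1 m] assms by (auto simp: linear_term_zero less_imp_le)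
  let ?\<sigma> = "\<lambda>i::nat. if i = 1 then 1 else - 1 :: real" and ?c = "half_width \<rho> q"
  have "0 \<le> ?c n - (\<Sum>i\<in>{1..n}. \<rho> i * (?\<sigma> i * ?c (Suc n - i)))"
  proof (cases "n = 0")
    case False
    then have S: "{1..n} = insert 1 {2..n}" by auto
    have "(\<Sum>i\<in>{2..n}. \<rho> i * (?\<sigma> i * ?c (Suc n - i))) \<le> 0"
      using \<rho> nn by (intro sum_nonpos) (auto intro!: mult_nonneg_nonneg)
    moreover have "0 \<le> (1 - \<rho> 1) * ?c n" using \<rho> nn by (intro mult_nonneg_nonneg) auto
    ultimately show ?thesis
      unfolding S by (subst sum.insert) (auto simp: algebra_simps)
  qed simp
  moreover have "0 \<le> (\<Sum>i\<in>{1..n}. 2 * q (Suc n - i))" using q by (intro sum_nonneg) (auto simp: less_imp_le)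
  ultimately show ?thesis
    unfolding half_width.simps using q[of "Suc n"] \<rho>(2) by (intro divide_pos_pos) linarith+
qed

text \<open>The hypotheses keep both conventions inactive, the value \<infinity> and the cut-off at
  0. Then the extended recurrences are two instances of one real recurrence.\<close>

lemma Q_bounds_eq_real_bound:
  assumes "0 \<le> e" "e < r 0" "0 \<le> 1 - r 1 - 2 * e" "1 \<le> n"
  shows "Q_lower r e Q0 n = ereal (real_bound r e Q0 n) \<and> Q_upper r e Q0 n = ereal (real_bound r (- e) Q0 n)"
  using \<open>1 \<le> n\<close>
proof (induction n rule: less_induct)
  case (less n)
  have pos: "0 < r 0 + e" "0 < r 0 - e" using assms by auto
  consider "n = 1" | "n = 2" | "3 \<le> n" using less.prems by linarith
  then show ?case
  proof cases
    case 1
    with assms pos show ?thesis by (simp add: Q_lower.simps Q_upper.simps)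
  next
    case 2
    have "real_bound r x Q0 2 = (1 - r 1 - 2 * x) / (r 0 + x)\<^sup>2 * Q0" if "r 0 + x \<noteq> 0" for x
    proof -
      have "real_bound r x Q0 2 = (1 - r 1 - 2 * x) * (Q0 / (r 0 + x)) / (r 0 + x)"
        by (simp add: eval_nat_numeral algebra_simps diff_divide_distrib add_divide_distrib)
      then show ?thesis by (simp add: power2_eq_square)
    qed
    with 2 assms pos show ?thesis
      using Q_lower.simps[of r e Q0 2] Q_upper.simps[of r e Q0 2] by (simp add: max_absorb2)
  next
    case 3
    then obtain m where m: "n = Suc m" "2 \<le> m" by (cases n) auto
    then have S: "{1..m} = insert 1 {2..m}" by auto
    \<comment> \<open>Both bounds at once: x = e for the lower, x = - e for the upper.\<close>
    have rb: "real_bound r x Q0 n = 1 / (r 0 + x) *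
      ((1 - r 1 - 2 * x) * real_bound r x Q0 (n - 1) - (\<Sum>i\<in>{2..n - 1}. (r i + 2 * x) * real_bound r (- x) Q0 (n - i)))" for x
    proof -
      have "(\<Sum>i\<in>{2..m}. (r i + 2 * x) * real_bound r (if i = 1 then x else - x) Q0 (Suc m - i)) =
          (\<Sum>i\<in>{2..m}. (r i + 2 * x) * real_bound r (- x) Q0 (Suc m - i))"
        by (intro sum.cong) auto
      then have "real_bound r x Q0 m - (\<Sum>i\<in>{1..m}. (r i + 2 * x) * real_bound r (if i = 1 then x else - x) Q0 (Suc m - i)) =
          (1 - r 1 - 2 * x) * real_bound r x Q0 m - (\<Sum>i\<in>{2..m}. (r i + 2 * x) * real_bound r (- x) Q0 (Suc m - i))"
        unfolding S by (subst sum.insert) (auto simp: left_diff_distrib distrib_right)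
      then show ?thesis unfolding m(1) real_bound.simps by simp
    qed
    have IH: "Q_lower r e Q0 k = ereal (real_bound r e Q0 k)" "Q_upper r e Q0 k = ereal (real_bound r (- e) Q0 k)"
      if "1 \<le> k" "k < n" for k using less.IH[of k] that by auto
    have "(\<Sum>i\<in>{2..n - 1}. ereal (r i + 2 * e) * Q_upper r e Q0 (n - i)) =
        ereal (\<Sum>i\<in>{2..n - 1}. (r i + 2 * e) * real_bound r (- e) Q0 (n - i))"
      unfolding sum_ereal[symmetric] using m by (intro sum.cong) (auto simp: IH)
    then have 1: "Q_lower r e Q0 n = ereal (real_bound r e Q0 n)"
      using 3 assms pos unfolding Q_lower.simps[of r e Q0 n] by (simp add: IH max_absorb2 rb)
    have "(\<Sum>i\<in>{2..n - 1}. ereal (r i - 2 * e) * Q_lower r e Q0 (n - i)) =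
        ereal (\<Sum>i\<in>{2..n - 1}. (r i - 2 * e) * real_bound r e Q0 (n - i))"
      unfolding sum_ereal[symmetric] using m by (intro sum.cong) (auto simp: IH)
    then have 2: "Q_upper r e Q0 n = ereal (real_bound r (- e) Q0 n)"
      using 3 assms pos unfolding Q_upper.simps[of r e Q0 n] by (simp add: IH rb[of "- e"])
    from 1 2 show ?thesis by simp
  qed
qed

text \<open>The regime s \<rightarrow> 0 with all perturbations bounded by C s. As a filter it
  admits Landau notation, and the resulting threshold \<open>s0\<close> is uniform over the
  perturbations, hence independent of the sample.\<close>

definition small_perturbations :: "real \<Rightarrow> nat \<Rightarrow> ((nat \<Rightarrow> real) \<times> real \<times> real) filter" where
  "small_perturbations C n = (INF s0\<in>{0<..}. principal
     {(d, e, s). 0 < s \<and> s < s0 \<and> (\<forall>i\<le>n. \<bar>d i\<bar> \<le> C * s) \<and> \<bar>e\<bar> \<le> C * s})"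

lemma eventually_small_perturbations:
  "eventually P (small_perturbations C n) \<longleftrightarrow>
     (\<exists>s0>0. \<forall>d e s. 0 < s \<and> s < s0 \<and> (\<forall>i\<le>n. \<bar>d i\<bar> \<le> C * s) \<and> \<bar>e\<bar> \<le> C * s \<longrightarrow> P (d, e, s))"
  unfolding small_perturbations_def
proof (subst eventually_INF_base)
  fix a b :: real assume "a \<in> {0<..}" "b \<in> {0<..}"
  then show "\<exists>x\<in>{0<..}. principal {(d, e, s). 0 < s \<and> s < x \<and> (\<forall>i\<le>n. \<bar>d i\<bar> \<le> C * s) \<and> \<bar>e\<bar> \<le> C * s}
    \<le> inf (principal {(d, e, s). 0 < s \<and> s < a \<and> (\<forall>i\<le>n. \<bar>d i\<bar> \<le> C * s) \<and> \<bar>e\<bar> \<le> C * s})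
          (principal {(d, e, s). 0 < s \<and> s < b \<and> (\<forall>i\<le>n. \<bar>d i\<bar> \<le> C * s) \<and> \<bar>e\<bar> \<le> C * s})"
    by (intro bexI[of _ "min a b"]) auto
qed (auto simp: eventually_principal)

lemma linear_term_bigo:
  assumes "\<rho> 0 \<noteq> 0" and "\<And>i. i < n \<Longrightarrow> (\<lambda>p. d p i) \<in> O[F](g)"
  shows "(\<lambda>p. linear_term \<rho> q (d p) n) \<in> O[F](g)"
  using assms(2)
proof (induction n rule: less_induct)
  case (less n)
  show ?case
  proof (cases n)
    case (Suc m)
    have "(\<lambda>p. ((\<Sum>i\<le>m. d p i * q (Suc m - i)) + linear_term \<rho> q (d p) m
        - (\<Sum>i\<in>{1..m}. \<rho> i * linear_term \<rho> q (d p) (Suc m - i))) / \<rho> 0) \<in> O[F](g)"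
      using less Suc assms(1) by (intro landau_o.big.cdiv_in_iff'[THEN iffD2] sum_in_bigo big_sum_in_bigo) auto
    then show ?thesis by (simp only: Suc linear_term.simps)
  qed simp
qed

lemma small_perturbations_bigo:
  shows "i \<le> n \<Longrightarrow> (\<lambda>p. fst p i) \<in> O[small_perturbations C n](\<lambda>p. snd (snd p))"
    and "(\<lambda>p. fst (snd p)) \<in> O[small_perturbations C n](\<lambda>p. snd (snd p))"
  by (rule bigoI[where c=C]; force simp: eventually_small_perturbations intro: exI[of _ 1])+

lemma small_perturbations_tendsto: "((\<lambda>p. snd (snd p)) \<longlongrightarrow> 0) (small_perturbations C n)"
  by (rule tendstoI) (auto simp: eventually_small_perturbations)

lemma small_perturbations_smallo: "(\<lambda>p. snd (snd p)) \<in> o[small_perturbations C n](\<lambda>_. 1)"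
  using small_perturbations_tendsto by (intro smalloI_tendsto) auto

lemma bigo_small_perturbations_tendsto:
  assumes "f \<in> O[small_perturbations C n](\<lambda>p. snd (snd p))"
  shows "(f \<longlongrightarrow> 0) (small_perturbations C n)"
  using landau_o.big_small_trans[OF assms small_perturbations_smallo] by (auto dest: smalloD_tendsto)

text \<open>Exact error propagation through one step. Orders zero and one cancel by the recurrences
  of the sequence, the linear term and the half width; what remains are inherited errors and
  products of two small quantities.\<close>

lemma expansion_step:
  fixes R B a L L' c c' q q' x d0 \<rho>0 :: real and r \<rho> d Bi ai qi Li ci :: "nat \<Rightarrow> real"
  assumes "R = \<rho>0 + d0 + x" "R \<noteq> 0" "\<rho>0 \<noteq> 0"
    and "\<rho>0 * q' = q - (\<Sum>i\<in>I. \<rho> i * qi i)"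
    and "\<rho>0 * L' = d0 * q' + (\<Sum>i\<in>I. d i * qi i) + L - (\<Sum>i\<in>I. \<rho> i * Li i)"
    and "\<rho>0 * c' = q' + (\<Sum>i\<in>I. 2 * qi i) + c - (\<Sum>i\<in>I. \<rho> i * (\<sigma> i * ci i))"
    and a: "a = q - L - x * c" and ai: "\<And>i. i \<in> I \<Longrightarrow> ai i = qi i - Li i - (\<sigma> i * x) * ci i"
  shows "(B - (\<Sum>i\<in>I. (\<rho> i + d i + 2 * x) * Bi i)) / R - (q' - L' - x * c') =
    ((B - a) - (\<Sum>i\<in>I. (\<rho> i + d i + 2 * x) * (Bi i - ai i))
      + (\<Sum>i\<in>I. (d i + 2 * x) * (Li i + (\<sigma> i * x) * ci i)) + (d0 + x) * (L' + x * c')) / R"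
proof -
  let ?S1 = "\<Sum>i\<in>I. \<rho> i * qi i" and ?S2 = "\<Sum>i\<in>I. d i * qi i" and ?S3 = "\<Sum>i\<in>I. 2 * qi i"
    and ?S4 = "\<Sum>i\<in>I. \<rho> i * Li i" and ?S5 = "\<Sum>i\<in>I. \<rho> i * (\<sigma> i * ci i)"
    and ?S6 = "\<Sum>i\<in>I. (d i + 2 * x) * (Li i + (\<sigma> i * x) * ci i)"
  have "(\<Sum>i\<in>I. (\<rho> i + d i + 2 * x) * ai i) = (\<Sum>i\<in>I. \<rho> i * qi i + d i * qi i + x * (2 * qi i)
      - \<rho> i * Li i - x * (\<rho> i * (\<sigma> i * ci i)) - (d i + 2 * x) * (Li i + (\<sigma> i * x) * ci i))"
    by (intro sum.cong) (auto simp: ai algebra_simps)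
  also have "\<dots> = ?S1 + ?S2 + x * ?S3 - ?S4 - x * ?S5 - ?S6"
    by (simp only: sum.distrib sum_subtractf sum_distrib_left)
  finally have s: "(\<Sum>i\<in>I. (\<rho> i + d i + 2 * x) * ai i) = ?S1 + ?S2 + x * ?S3 - ?S4 - x * ?S5 - ?S6" .
  have "(\<Sum>i\<in>I. (\<rho> i + d i + 2 * x) * (Bi i - ai i)) =
      (\<Sum>i\<in>I. (\<rho> i + d i + 2 * x) * Bi i) - (\<Sum>i\<in>I. (\<rho> i + d i + 2 * x) * ai i)"
    by (simp only: right_diff_distrib sum_subtractf)
  moreover have "x * (\<rho>0 * c') = x * (q' + ?S3 + c - ?S5)" using assms(6) by simp
  then have "x * (\<rho>0 * c') = x * q' + x * ?S3 + x * c - x * ?S5" by (simp only: distrib_left right_diff_distrib)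
  moreover have "R * (q' - L' - x * c') = \<rho>0 * q' - \<rho>0 * L' - x * (\<rho>0 * c') + (d0 * q' + x * q') - (d0 + x) * (L' + x * c')"
    unfolding assms(1) by (simp add: algebra_simps)
  ultimately have "(B - (\<Sum>i\<in>I. (\<rho> i + d i + 2 * x) * Bi i)) - R * (q' - L' - x * c') =
    (B - a) - (\<Sum>i\<in>I. (\<rho> i + d i + 2 * x) * (Bi i - ai i)) + ?S6 + (d0 + x) * (L' + x * c')"
    using assms(4,5) a s by linarith
  then show ?thesis using \<open>R \<noteq> 0\<close> by (simp add: field_simps)
qed

text \<open>Induction for both signs of \<open>e\<close> at once, since the summands with i \<ge> 2
  call the bound of opposite sign.\<close>

lemma real_bound_expansion:
  assumes "0 < \<rho> 0" and q_rec: "\<And>m. q m = (\<Sum>i\<le>m. \<rho> i * q (Suc m - i))" and "q 0 = Q0"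
    and x: "x = (\<lambda>p. fst (snd p)) \<or> x = (\<lambda>p. - fst (snd p))" and "m \<le> Suc n"
  shows "(\<lambda>p. real_bound (\<lambda>i. \<rho> i + fst p i) (x p) Q0 m
      - (q m - linear_term \<rho> q (fst p) m - x p * half_width \<rho> q m))
    \<in> o[small_perturbations C n](\<lambda>p. snd (snd p))"
  using x \<open>m \<le> Suc n\<close>
proof (induction m arbitrary: x rule: less_induct)
  case (less m)
  let ?F = "small_perturbations C n" and ?s = "\<lambda>p::(nat \<Rightarrow> real) \<times> real \<times> real. snd (snd p)"
  show ?case
  proof (cases m)
    case 0
    then show ?thesis using \<open>q 0 = Q0\<close> by simp
  next
    case (Suc k)
    note k = \<open>m \<le> Suc n\<close>[unfolded Suc]
    define y where "y = (\<lambda>i p. if i = (1::nat) then x p else - x p)"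
    define \<sigma> where "\<sigma> = (\<lambda>i. if i = (1::nat) then 1 else - 1 :: real)"
    define B where "B = (\<lambda>m x (p::(nat \<Rightarrow> real) \<times> real \<times> real). real_bound (\<lambda>i. \<rho> i + fst p i) (x p) Q0 m)"
    define a where "a = (\<lambda>m x (p::(nat \<Rightarrow> real) \<times> real \<times> real). q m - linear_term \<rho> q (fst p) m - x p * half_width \<rho> q m)"
    have x_bigo: "x \<in> O[?F](?s)"
      using less.prems(1) small_perturbations_bigo(2)[of C n] by auto
    have d_bigo: "(\<lambda>p. fst p i) \<in> O[?F](?s)" if "i \<le> n" for i
      using small_perturbations_bigo(1)[OF that] .
    have L_bigo: "(\<lambda>p. linear_term \<rho> q (fst p) l) \<in> O[?F](?s)" if "l \<le> Suc n" for l
      using that \<open>0 < \<rho> 0\<close> by (intro linear_term_bigo d_bigo) auto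
    have y_eq: "y i = (\<lambda>p. \<sigma> i * x p)" for i by (auto simp: y_def \<sigma>_def)
    have IHk: "(\<lambda>p. B k x p - a k x p) \<in> o[?F](?s)"
      unfolding B_def a_def using less Suc by simp
    have IH: "(\<lambda>p. B (Suc k - i) (y i) p - a (Suc k - i) (y i) p) \<in> o[?F](?s)" if "i \<in> {1..k}" for i
      unfolding B_def a_def
    proof (rule less.IH)
      show "y i = (\<lambda>p. fst (snd p)) \<or> y i = (\<lambda>p. - fst (snd p))"
        using less.prems(1) by (auto simp: y_eq \<sigma>_def)
    qed (use that Suc k in auto)
    have R: "((\<lambda>p. \<rho> 0 + fst p 0 + x p) \<longlongrightarrow> \<rho> 0 + 0 + 0) ?F"
      by (intro tendsto_intros bigo_small_perturbations_tendsto d_bigo x_bigo) auto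
    then have "((\<lambda>p. inverse (\<rho> 0 + fst p 0 + x p)) \<longlongrightarrow> inverse (\<rho> 0 + 0 + 0)) ?F"
      using \<open>0 < \<rho> 0\<close> by (intro tendsto_inverse) auto
    then have Rinv: "(\<lambda>p. inverse (\<rho> 0 + fst p 0 + x p)) \<in> O[?F](\<lambda>_. 1)"
      by (intro bigoI_tendsto[where c="inverse (\<rho> 0 + 0 + 0)"]) auto
    have R_pos: "eventually (\<lambda>p. \<rho> 0 + fst p 0 + x p \<noteq> 0) ?F"
      using tendsto_imp_eventually_ne[OF R, of 0] \<open>0 < \<rho> 0\<close> by simp
    \<comment> \<open>The numerator on the right of \<open>expansion_step\<close>.\<close>
    define N where "N = (\<lambda>p. (B k x p - a k x p)
      - (\<Sum>i\<in>{1..k}. (\<rho> i + fst p i + 2 * x p) * (B (Suc k - i) (y i) p - a (Suc k - i) (y i) p))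
      + (\<Sum>i\<in>{1..k}. (fst p i + 2 * x p) * (linear_term \<rho> q (fst p) (Suc k - i) + (\<sigma> i * x p) * half_width \<rho> q (Suc k - i)))
      + (fst p 0 + x p) * (linear_term \<rho> q (fst p) (Suc k) + x p * half_width \<rho> q (Suc k)))"
    have small: "(\<lambda>p. f p * g p) \<in> o[?F](?s)" if "f \<in> O[?F](?s)" "g \<in> O[?F](?s)" for f g
      using landau_o.big_small_mult[OF that(1) landau_o.big_small_trans[OF that(2) small_perturbations_smallo]] by simp
    have bounded: "(\<lambda>p. \<rho> i + fst p i + 2 * x p) \<in> O[?F](\<lambda>_. 1)" if "i \<le> n" for i
    proof -
      have "((\<lambda>p. \<rho> i + fst p i + 2 * x p) \<longlongrightarrow> \<rho> i + 0 + 2 * 0) ?F"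
        using that by (intro tendsto_intros bigo_small_perturbations_tendsto d_bigo x_bigo)
      then show ?thesis by (intro bigoI_tendsto[where c="\<rho> i + 0 + 2 * 0"]) auto
    qed
    have x_c: "(\<lambda>p. c * x p * c') \<in> O[?F](?s)" for c c' :: real
      using landau_o.big.cmult_in_iff'[of c' "\<lambda>p. c * x p"] landau_o.big.cmult_in_iff[of c x] x_bigo
      by (cases "c = 0"; cases "c' = 0") auto
    have "N \<in> o[?F](?s)"
      unfolding N_def
    proof (rule sum_in_smallo(1)[OF sum_in_smallo(1)[OF sum_in_smallo(2)[OF IHk]]])
      show "(\<lambda>p. \<Sum>i\<in>{1..k}. (\<rho> i + fst p i + 2 * x p) * (B (Suc k - i) (y i) p - a (Suc k - i) (y i) p)) \<in> o[?F](?s)"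
      proof (rule big_sum_in_smallo)
        fix i assume i: "i \<in> {1..k}"
        show "(\<lambda>p. (\<rho> i + fst p i + 2 * x p) * (B (Suc k - i) (y i) p - a (Suc k - i) (y i) p)) \<in> o[?F](?s)"
          using landau_o.big_small_mult[OF bounded IH[OF i]] i k by simp
      qed
      show "(\<lambda>p. \<Sum>i\<in>{1..k}. (fst p i + 2 * x p) *
          (linear_term \<rho> q (fst p) (Suc k - i) + \<sigma> i * x p * half_width \<rho> q (Suc k - i))) \<in> o[?F](?s)"
      proof (intro big_sum_in_smallo small)
        fix i assume i: "i \<in> {1..k}"
        show "(\<lambda>p. fst p i + 2 * x p) \<in> O[?F](?s)"
          using i k x_c[of 2 1] by (intro sum_in_bigo d_bigo) auto
        show "(\<lambda>p. linear_term \<rho> q (fst p) (Suc k - i) + \<sigma> i * x p * half_width \<rho> q (Suc k - i)) \<in> O[?F](?s)"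
          using i k by (intro sum_in_bigo L_bigo x_c) auto
      qed
      show "(\<lambda>p. (fst p 0 + x p) * (linear_term \<rho> q (fst p) (Suc k) + x p * half_width \<rho> q (Suc k))) \<in> o[?F](?s)"
      proof (rule small)
        show "(\<lambda>p. fst p 0 + x p) \<in> O[?F](?s)"
          by (intro sum_in_bigo d_bigo x_bigo) auto
        show "(\<lambda>p. linear_term \<rho> q (fst p) (Suc k) + x p * half_width \<rho> q (Suc k)) \<in> O[?F](?s)"
          using k x_c[of 1 "half_width \<rho> q (Suc k)"] by (intro sum_in_bigo L_bigo) auto
      qed
    qed
    then have "(\<lambda>p. N p * inverse (\<rho> 0 + fst p 0 + x p)) \<in> o[?F](?s)"
      using landau_o.small_big_mult[OF _ Rinv, of N ?s] by simp
    moreover have "eventually (\<lambda>p. real_bound (\<lambda>i. \<rho> i + fst p i) (x p) Q0 m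
        - (q m - linear_term \<rho> q (fst p) m - x p * half_width \<rho> q m) = N p * inverse (\<rho> 0 + fst p 0 + x p)) ?F"
      using R_pos
    proof (rule eventually_mono)
      fix p assume p: "\<rho> 0 + fst p 0 + x p \<noteq> (0::real)"
      have S: "{..k} = insert 0 {1..k}" by auto
      have "(B k x p - (\<Sum>i\<in>{1..k}. (\<rho> i + fst p i + 2 * x p) * B (Suc k - i) (y i) p)) / (\<rho> 0 + fst p 0 + x p)
          - (q (Suc k) - linear_term \<rho> q (fst p) (Suc k) - x p * half_width \<rho> q (Suc k)) = N p / (\<rho> 0 + fst p 0 + x p)"
        unfolding N_def
      proof (rule expansion_step)
        show "\<rho> 0 * q (Suc k) = q k - (\<Sum>i\<in>{1..k}. \<rho> i * q (Suc k - i))"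
          using q_rec[of k] unfolding S by simp
        show "\<rho> 0 * linear_term \<rho> q (fst p) (Suc k) = fst p 0 * q (Suc k) + (\<Sum>i\<in>{1..k}. fst p i * q (Suc k - i)) +
          linear_term \<rho> q (fst p) k - (\<Sum>i\<in>{1..k}. \<rho> i * linear_term \<rho> q (fst p) (Suc k - i))"
          using \<open>0 < \<rho> 0\<close> unfolding linear_term.simps S by simp
        show "\<rho> 0 * half_width \<rho> q (Suc k) = q (Suc k) + (\<Sum>i\<in>{1..k}. 2 * q (Suc k - i)) + half_width \<rho> q k -
          (\<Sum>i\<in>{1..k}. \<rho> i * (\<sigma> i * half_width \<rho> q (Suc k - i)))"
          using \<open>0 < \<rho> 0\<close> unfolding half_width.simps \<sigma>_def by simp
      qed (use p \<open>0 < \<rho> 0\<close> in \<open>auto simp: a_def y_eq\<close>)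
      then show "real_bound (\<lambda>i. \<rho> i + fst p i) (x p) Q0 m
        - (q m - linear_term \<rho> q (fst p) m - x p * half_width \<rho> q m) = N p * inverse (\<rho> 0 + fst p 0 + x p)"
        unfolding Suc real_bound.simps B_def y_def by (simp only: divide_inverse)
    qed
    ultimately show ?thesis by (subst landau_o.small.in_cong)
  qed
qed

text \<open>The deterministic core: for small \<open>s\<close> the expansion error of either bound
  is at most \<kappa> s, so the bounds enclose \<open>q n\<close> once the linear term stays
  \<kappa> s inside the first-order width.\<close>

lemma interval_estimate_small_perturbations:
  assumes \<rho>: "0 < \<rho> 0" "\<rho> 1 < 1" and q_rec: "\<And>m. q m = (\<Sum>i\<le>m. \<rho> i * q (Suc m - i))" and "q 0 = Q0"
    and "1 \<le> n" "0 < \<kappa>"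
  obtains s0 where "0 < s0"
    and "\<And>d e s. 0 < s \<Longrightarrow> s < s0 \<Longrightarrow> (\<And>i. i \<le> n \<Longrightarrow> \<bar>d i\<bar> \<le> C * s) \<Longrightarrow> 0 \<le> e \<Longrightarrow> e \<le> C * s \<Longrightarrow>
      \<bar>linear_term \<rho> q d n\<bar> < e * half_width \<rho> q n - \<kappa> * s \<Longrightarrow>
      Q_lower (\<lambda>i. \<rho> i + d i) e Q0 n < ereal (q n) \<and> ereal (q n) < Q_upper (\<lambda>i. \<rho> i + d i) e Q0 n"
proof -
  let ?F = "small_perturbations C n" and ?s = "\<lambda>p::(nat \<Rightarrow> real) \<times> real \<times> real. snd (snd p)"
  let ?err = "\<lambda>x p. real_bound (\<lambda>i. \<rho> i + fst p i) (x p) Q0 n - (q n - linear_term \<rho> q (fst p) n - x p * half_width \<rho> q n)"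
  have err: "eventually (\<lambda>p. norm (?err x p) \<le> \<kappa> * norm (?s p)) ?F"
    if "x = (\<lambda>p. fst (snd p)) \<or> x = (\<lambda>p. - fst (snd p))" for x
    using real_bound_expansion[OF \<rho>(1) q_rec \<open>q 0 = Q0\<close> that, of n n C] \<open>0 < \<kappa>\<close> by (auto dest: landau_o.smallD)
  have e1: "((\<lambda>p. \<rho> 0 + fst p 0 - fst (snd p)) \<longlongrightarrow> \<rho> 0 + 0 - 0) ?F"
    by (intro tendsto_intros bigo_small_perturbations_tendsto small_perturbations_bigo) auto
  have e2: "((\<lambda>p. 1 - (\<rho> 1 + fst p 1) - 2 * fst (snd p)) \<longlongrightarrow> 1 - (\<rho> 1 + 0) - 2 * 0) ?F"
    using \<open>1 \<le> n\<close> by (intro tendsto_intros bigo_small_perturbations_tendsto small_perturbations_bigo)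
  \<comment> \<open>The last two conjuncts keep the conventions inactive; the final one rests on
    \<rho> 1 < 1.\<close>
  define P where "P = (\<lambda>p. norm (?err (\<lambda>p. fst (snd p)) p) \<le> \<kappa> * norm (?s p) \<and>
      norm (?err (\<lambda>p. - fst (snd p)) p) \<le> \<kappa> * norm (?s p) \<and>
      0 < \<rho> 0 + fst p 0 - fst (snd p) \<and> 0 < 1 - (\<rho> 1 + fst p 1) - 2 * fst (snd p))"
  have "eventually P ?F"
    unfolding P_def
    using \<rho> by (intro eventually_conj err order_tendstoD(1)[OF e1] order_tendstoD(1)[OF e2]) auto
  then obtain s0 where s0: "0 < s0" and "\<forall>d e s. 0 < s \<and> s < s0 \<and> (\<forall>i\<le>n. \<bar>d i\<bar> \<le> C * s) \<and> \<bar>e\<bar> \<le> C * s \<longrightarrow> P (d, e, s)"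
    unfolding eventually_small_perturbations by blast
  then have *: "P (d, e, s)" if "0 < s" "s < s0" "\<And>i. i \<le> n \<Longrightarrow> \<bar>d i\<bar> \<le> C * s" "\<bar>e\<bar> \<le> C * s" for d e s
    using that by blast
  show ?thesis
  proof (rule that[OF s0])
    fix d :: "nat \<Rightarrow> real" and e s :: real
    assume s: "0 < s" "s < s0" and d: "\<And>i. i \<le> n \<Longrightarrow> \<bar>d i\<bar> \<le> C * s" and e: "0 \<le> e" "e \<le> C * s"
      and L: "\<bar>linear_term \<rho> q d n\<bar> < e * half_width \<rho> q n - \<kappa> * s"
    have PP: "P (d, e, s)" using e by (intro * s d) auto
    have "Q_lower (\<lambda>i. \<rho> i + d i) e Q0 n = ereal (real_bound (\<lambda>i. \<rho> i + d i) e Q0 n) \<and>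
        Q_upper (\<lambda>i. \<rho> i + d i) e Q0 n = ereal (real_bound (\<lambda>i. \<rho> i + d i) (- e) Q0 n)"
      using PP e \<open>1 \<le> n\<close> unfolding P_def by (intro Q_bounds_eq_real_bound) auto
    then show "Q_lower (\<lambda>i. \<rho> i + d i) e Q0 n < ereal (q n) \<and> ereal (q n) < Q_upper (\<lambda>i. \<rho> i + d i) e Q0 n"
      using PP e L s(1) unfolding P_def by auto
  qed
qed

section \<open>Confidence probability\<close>

text \<open>The set integral in \<open>emp_weight\<close> ignores negative points, where
  \<open>poisson_weight\<close> is unbounded. Building the cut-off into the function gives values in
  [0, 1] everywhere.\<close>

definition truncated_weight :: "real \<Rightarrow> nat \<Rightarrow> real \<Rightarrow> real" where
  "truncated_weight a i t = indicator {0..} t * poisson_weight a i t"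

lemma truncated_weight_measurable [measurable]: "truncated_weight a i \<in> borel_measurable borel"
  unfolding truncated_weight_def by measurable

lemma truncated_weight_bounds:
  assumes "0 < a"
  shows "0 \<le> truncated_weight a i t" "truncated_weight a i t \<le> 1"
  using assms poisson_weight_nonneg[of a t i] poisson_weight_le_1[of a t i]
  by (auto simp: truncated_weight_def split: split_indicator)

text \<open>The empirical law is that of an observation with uniformly random index. Since the
  distribution function of that law is \<open>emp_cdf\<close>, the regularity that
  \<open>interval_measure\<close> asks for comes with it.\<close>

lemma interval_measure_emp_cdf:
  assumes "1 \<le> N"
  shows "interval_measure (emp_cdf x N) = distr (uniform_count_measure {..<N}) borel x"
proof -
  let ?U = "uniform_count_measure {..<N}" and ?D = "distr (uniform_count_measure {..<N}) borel x"
  interpret U: prob_space ?U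
    using assms by (intro prob_space_uniform_count_measure) (auto simp: lessThan_empty_iff)
  interpret D: real_distribution ?D
    by (rule U.real_distribution_distr) simp
  have cdf: "cdf ?D = emp_cdf x N"
  proof
    fix t
    have "cdf ?D t = measure ?U {k. k < N \<and> x k \<le> t}"
      unfolding cdf_def by (subst measure_distr) (auto simp: space_uniform_count_measure intro!: arg_cong[where f="measure _"])
    also have "\<dots> = emp_cdf x N t"
      unfolding emp_cdf_def by (subst measure_uniform_count_measure) auto
    finally show "cdf ?D t = emp_cdf x N t" .
  qed
  have F: "\<And>s t. s \<le> t \<Longrightarrow> emp_cdf x N s \<le> emp_cdf x N t"
    "\<And>t. continuous (at_right t) (emp_cdf x N)"
    "(emp_cdf x N \<longlongrightarrow> 0) at_bot" "(emp_cdf x N \<longlongrightarrow> 1) at_top"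
    unfolding cdf[symmetric]
    by (rule D.cdf_nondecreasing D.cdf_is_right_cont D.cdf_lim_at_bot D.cdf_lim_at_top_prob; assumption?)+
  show ?thesis
  proof (rule cdf_unique)
    show "real_distribution (interval_measure (emp_cdf x N))"
      by (rule real_distribution_interval_measure) (fact F)+
    show "cdf (interval_measure (emp_cdf x N)) = cdf ?D"
      unfolding cdf by (rule ext) (simp add: cdf_def measure_interval_measure_Iic F)
  qed (rule D.real_distribution_axioms)
qed

lemma emp_weight_eq:
  assumes "1 \<le> N"
  shows "emp_weight a x N i = (\<Sum>k<N. truncated_weight a i (x k)) / real N"
proof -
  have "emp_weight a x N i = (\<integral>t. truncated_weight a i t \<partial>interval_measure (emp_cdf x N))"
    by (simp add: emp_weight_def set_lebesgue_integral_def truncated_weight_def poisson_weight_def)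
  also have "\<dots> = (\<integral>k. truncated_weight a i (x k) \<partial>uniform_count_measure {..<N})"
    unfolding interval_measure_emp_cdf[OF assms] by (rule integral_distr) auto
  also have "\<dots> = (\<Sum>k<N. truncated_weight a i (x k)) / real N"
    by (simp add: integral_uniform_count_measure)
  finally show ?thesis .
qed

text \<open>The event of the theorem must be measurable for its complement to be estimated; the
  induction includes the samples on which the conventions apply.\<close>

lemma Q_bounds_measurable:
  assumes [measurable]: "\<And>i. (\<lambda>\<omega>. r \<omega> i) \<in> borel_measurable M"
  shows "(\<lambda>\<omega>. Q_lower (r \<omega>) e Q0 n) \<in> borel_measurable M \<and> (\<lambda>\<omega>. Q_upper (r \<omega>) e Q0 n) \<in> borel_measurable M"
proof (induction n rule: less_induct)
  case (less n)
  show ?case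
  proof (cases "n \<le> 2")
    case True
    then consider "n = 0" | "n = 1" | "n = 2" by linarith
    moreover have "Q_lower r e Q0 0 = ereal Q0" "Q_upper r e Q0 0 = ereal Q0"
      "Q_lower r e Q0 1 = ereal (1 / (r 0 + e) * Q0)"
      "Q_upper r e Q0 1 = (if r 0 \<le> e then \<infinity> else ereal (1 / (r 0 - e) * Q0))"
      "Q_lower r e Q0 2 = ereal (max 0 (1 - r 1 - 2 * e) / (r 0 + e)\<^sup>2 * Q0)"
      "Q_upper r e Q0 2 = (if r 0 \<le> e then \<infinity> else ereal ((1 - r 1 + 2 * e) / (r 0 - e)\<^sup>2 * Q0))" for r
      by (subst Q_lower.simps Q_upper.simps; simp)+
    ultimately show ?thesis by cases simp_all
  next
    case False
    then obtain m where m: "n = Suc m" "2 \<le> m" by (cases n) auto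
    have [measurable]: "(\<lambda>\<omega>. Q_lower (r \<omega>) e Q0 m) \<in> borel_measurable M"
      "(\<lambda>\<omega>. Q_upper (r \<omega>) e Q0 m) \<in> borel_measurable M"
      using less[of m] m by auto
    have [measurable]: "(\<lambda>\<omega>. \<Sum>i\<in>{2..m}. ereal (r \<omega> i - 2 * e) * Q_lower (r \<omega>) e Q0 (Suc m - i)) \<in> borel_measurable M"
      "(\<lambda>\<omega>. \<Sum>i\<in>{2..m}. ereal (r \<omega> i + 2 * e) * Q_upper (r \<omega>) e Q0 (Suc m - i)) \<in> borel_measurable M"
      using less m by (intro borel_measurable_ereal_sum borel_measurable_ereal_times; force)+
    have "Q_lower r e Q0 n = ereal (1 / (r 0 + e)) * (ereal (max 0 (1 - r 1 - 2 * e)) * Q_lower r e Q0 m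
        - (\<Sum>i\<in>{2..m}. ereal (r i + 2 * e) * Q_upper r e Q0 (Suc m - i)))" for r
      using m by (subst Q_lower.simps) simp
    moreover have "Q_upper r e Q0 n = (if r 0 \<le> e then \<infinity> else ereal (1 / (r 0 - e)) *
        (ereal (1 - r 1 + 2 * e) * Q_upper r e Q0 m - (\<Sum>i\<in>{2..m}. ereal (r i - 2 * e) * Q_lower r e Q0 (Suc m - i))))" for r
      using m by (subst Q_upper.simps) simp
    ultimately show ?thesis by simp
  qed
qed

text \<open>By linearity the mean of the linear term is the linear term of the mean weights.\<close>

lemma has_bochner_integral_linear_term:
  assumes "\<And>i. has_bochner_integral M (\<lambda>t. Z t i) (z i)"
  shows "has_bochner_integral M (\<lambda>t. linear_term \<rho> q (Z t) n) (linear_term \<rho> q z n)"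
proof (induction n rule: less_induct)
  case (less n)
  show ?case
  proof (cases n)
    case (Suc m)
    show ?thesis
      unfolding Suc linear_term.simps
      by (intro has_bochner_integral_divide_zero has_bochner_integral_diff has_bochner_integral_add
          has_bochner_integral_sum has_bochner_integral_mult_left has_bochner_integral_mult_right assms less)
         (use Suc in auto)
  qed (simp add: has_bochner_integral_zero)
qed

section \<open>Central limit bound for means of bounded variables\<close>

context prob_space
begin

text \<open>The values lie in an interval of length \<open>c\<close>, so the standard deviation is at most \<open>c / 2\<close>.\<close>

lemma eventually_prob_mean_deviation_ge:
  fixes X :: "nat \<Rightarrow> 'a \<Rightarrow> real" and h :: "real \<Rightarrow> real"
  assumes X_indep: "indep_vars (\<lambda>_. borel) X UNIV" and X_distr: "\<And>k. distr M borel (X k) = G"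
    and h [measurable]: "h \<in> borel_measurable borel" and bound: "\<And>t. \<bar>h t - mid\<bar> \<le> c / 2"
    and u: "0 \<le> u" and \<eta>: "0 < \<eta>"
  shows "eventually (\<lambda>N. normal_mass u - \<eta> \<le>
    prob {\<omega> \<in> space M. \<bar>(\<Sum>k<N. h (X k \<omega>)) / real N - (\<integral>t. h t \<partial>G)\<bar> \<le> c / 2 * u * (1 / sqrt (real N))}) sequentially"
proof -
  have X [measurable]: "X k \<in> borel_measurable M" for k
    using X_indep by (auto simp: indep_vars_def)
  define m where "m = (\<integral>t. h t \<partial>G)"
  define Y where "Y = (\<lambda>k \<omega>. h (X k \<omega>))"
  have Y [measurable]: "Y k \<in> borel_measurable M" for k unfolding Y_def by measurable
  have Y_bound: "\<bar>Y k \<omega> - mid\<bar> \<le> c / 2" for k \<omega> using bound by (simp add: Y_def)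
  have c: "0 \<le> c" using bound[of 0] by linarith
  have Y_abs: "\<bar>Y k \<omega>\<bar> \<le> \<bar>mid\<bar> + c / 2" for k \<omega> using Y_bound[of k \<omega>] by linarith
  have int: "integrable M (Y k)" for k
    using Y_abs by (intro integrable_const_bound[where B="\<bar>mid\<bar> + c / 2"]) auto
  have int2: "integrable M (\<lambda>\<omega>. (Y k \<omega>)\<^sup>2)" for k
  proof (rule integrable_const_bound[where B="(\<bar>mid\<bar> + c / 2)\<^sup>2"])
    have "(Y k \<omega>)\<^sup>2 \<le> (\<bar>mid\<bar> + c / 2)\<^sup>2" for \<omega>
      using Y_abs[of k \<omega>] c by (intro abs_le_square_iff[THEN iffD1]) auto
    then show "AE \<omega> in M. norm ((Y k \<omega>)\<^sup>2) \<le> (\<bar>mid\<bar> + c / 2)\<^sup>2" by simp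
  qed simp
  have mean: "expectation (Y k) = m" for k
    unfolding m_def X_distr[of k, symmetric] Y_def by (subst integral_distr) auto
  have var_eq: "variance (Y k) = (\<integral>t. (h t - m)\<^sup>2 \<partial>G)" for k
    unfolding mean unfolding X_distr[of k, symmetric] Y_def by (subst integral_distr) auto
  define v where "v = (\<integral>t. (h t - m)\<^sup>2 \<partial>G)"
  \<comment> \<open>The mean square distance is least around the mean, hence at most the one around
    \<open>mid\<close>.\<close>
  have v_le: "v \<le> (c / 2)\<^sup>2"
  proof -
    have "v = expectation (\<lambda>\<omega>. (Y 0 \<omega>)\<^sup>2) - m\<^sup>2"
      using var_eq[of 0] variance_eq[OF int int2, of 0] mean by (simp add: v_def)
    also have "\<dots> \<le> expectation (\<lambda>\<omega>. (Y 0 \<omega>)\<^sup>2) - m\<^sup>2 + (m - mid)\<^sup>2" by simp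
    also have "\<dots> = expectation (\<lambda>\<omega>. (Y 0 \<omega>)\<^sup>2 - 2 * mid * Y 0 \<omega> + mid\<^sup>2)"
      using int2[of 0] int[of 0] mean[of 0] prob_space by (simp add: power2_diff algebra_simps)
    also have "\<dots> = expectation (\<lambda>\<omega>. (Y 0 \<omega> - mid)\<^sup>2)" by (simp add: power2_diff algebra_simps)
    also have "\<dots> \<le> expectation (\<lambda>\<omega>. (c / 2)\<^sup>2)"
    proof (rule integral_mono)
      have "integrable M (\<lambda>\<omega>. (Y 0 \<omega>)\<^sup>2 - 2 * mid * Y 0 \<omega> + mid\<^sup>2)" using int2[of 0] int[of 0] by simp
      then show "integrable M (\<lambda>\<omega>. (Y 0 \<omega> - mid)\<^sup>2)" by (simp add: power2_diff algebra_simps)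
      show "(Y 0 \<omega> - mid)\<^sup>2 \<le> (c / 2)\<^sup>2" for \<omega>
        using Y_bound[of 0 \<omega>] c by (intro abs_le_square_iff[THEN iffD1]) auto
    qed simp
    finally show ?thesis by (simp add: prob_space)
  qed
  have v_nonneg: "0 \<le> v" unfolding v_def by simp
  let ?A = "\<lambda>N. {\<omega> \<in> space M. \<bar>(\<Sum>k<N. Y k \<omega>) / real N - m\<bar> \<le> c / 2 * u * (1 / sqrt (real N))}"
  have nm1: "normal_mass u \<le> 1"
  proof -
    interpret N: real_distribution std_normal_distribution by (rule real_dist_normal_dist)
    show ?thesis using normal_mass_eq[OF u] by simp
  qed
  have "eventually (\<lambda>N. normal_mass u - \<eta> \<le> prob (?A N)) sequentially"
  \<comment> \<open>The central limit theorem needs positive variance; if the variance vanishes, the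
    average equals its mean almost surely.\<close>
  proof (cases "v = 0")
    case True
    have "AE \<omega> in M. Y k \<omega> = m" for k
    proof -
      have "integrable M (\<lambda>\<omega>. (Y k \<omega> - m)\<^sup>2)"
      proof -
        have "integrable M (\<lambda>\<omega>. (Y k \<omega>)\<^sup>2 - 2 * m * Y k \<omega> + m\<^sup>2)" using int2[of k] int[of k] by simp
        then show ?thesis by (simp add: power2_diff algebra_simps)
      qed
      moreover have "expectation (\<lambda>\<omega>. (Y k \<omega> - m)\<^sup>2) = 0" using var_eq[of k] True by (simp add: mean v_def)
      ultimately show ?thesis by (subst (asm) integral_nonneg_eq_0_iff_AE) auto
    qed
    then have ae: "AE \<omega> in M. \<forall>k. Y k \<omega> = m" by (simp add: AE_all_countable)
    show ?thesis
    proof (rule eventually_sequentiallyI[of 1])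
      fix N :: nat assume N: "1 \<le> N"
      have "prob (?A N) = 1"
        using ae c u N by (subst prob_eq_1) (auto elim!: eventually_mono)
      then show "normal_mass u - \<eta> \<le> prob (?A N)" using nm1 \<eta> by simp
    qed
  next
    case False
    define \<sigma> where "\<sigma> = sqrt v"
    have \<sigma>: "0 < \<sigma>" "\<sigma>\<^sup>2 = v" "\<sigma> \<le> c / 2"
      using False v_nonneg real_le_lsqrt[of "c / 2" v] v_le c by (auto simp: \<sigma>_def)
    let ?S = "\<lambda>N \<omega>. (\<Sum>k<N. Y k \<omega> - m) / sqrt (real N * \<sigma>\<^sup>2)"
    have "indep_vars (\<lambda>_. borel) Y UNIV"
      unfolding Y_def using X_indep by (rule indep_vars_compose2) auto
    moreover have "distr M borel (Y k) = distr G borel h" for k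
      unfolding Y_def X_distr[of k, symmetric] by (subst distr_distr) (auto simp: comp_def)
    ultimately have "weak_conv_m (\<lambda>N. distr M borel (?S N)) std_normal_distribution"
      using mean \<sigma> int2 var_eq by (intro central_limit_theorem[where \<mu>="distr G borel h"]) (auto simp: v_def)
    then have conv: "(\<lambda>N. cdf (distr M borel (?S N)) x) \<longlonglongrightarrow> cdf std_normal_distribution x" for x
    proof -
      interpret N: real_distribution std_normal_distribution by (rule real_dist_normal_dist)
      assume "weak_conv_m (\<lambda>N. distr M borel (?S N)) std_normal_distribution"
      then show ?thesis by (simp add: weak_conv_m_def weak_conv_def N.isCont_cdf)
    qed
    have "(\<lambda>N. cdf (distr M borel (?S N)) u - cdf (distr M borel (?S N)) (- u)) \<longlonglongrightarrow> normal_mass u"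
      unfolding normal_mass_def by (intro tendsto_diff conv)
    then have "eventually (\<lambda>N. normal_mass u - \<eta> < cdf (distr M borel (?S N)) u - cdf (distr M borel (?S N)) (- u)) sequentially"
      using \<eta> by (intro order_tendstoD(1)) auto
    then show ?thesis
      using eventually_ge_at_top[of 1]
    proof eventually_elim
      fix N :: nat
      assume lt: "normal_mass u - \<eta> < cdf (distr M borel (?S N)) u - cdf (distr M borel (?S N)) (- u)"
        and N: "1 \<le> N"
      have [measurable]: "?S N \<in> borel_measurable M" by measurable
      interpret D: real_distribution "distr M borel (?S N)" by (rule real_distribution_distr) measurable
      have "cdf (distr M borel (?S N)) u - cdf (distr M borel (?S N)) (- u) \<le> measure (distr M borel (?S N)) {- u..u}"
      proof (cases "u = 0")
        case False
        then show ?thesis using u by (subst D.cdf_diff_eq) (auto intro!: D.finite_measure_mono)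
      qed simp
      also have "\<dots> = prob {\<omega> \<in> space M. \<bar>?S N \<omega>\<bar> \<le> u}"
      proof (subst measure_distr)
        show "prob (?S N -` {- u..u} \<inter> space M) = prob {\<omega> \<in> space M. \<bar>?S N \<omega>\<bar> \<le> u}"
          by (rule arg_cong[where f=prob]) (unfold abs_le_iff, auto)
      qed auto
      also have "\<dots> \<le> prob (?A N)"
      proof (rule finite_measure_mono)
        \<comment> \<open>Here \<sigma> \<le> c / 2 replaces the unknown standard deviation by its
          bound.\<close>
        show "{\<omega> \<in> space M. \<bar>?S N \<omega>\<bar> \<le> u} \<subseteq> ?A N"
        proof safe
          fix \<omega> assume S: "\<bar>?S N \<omega>\<bar> \<le> u"
          have rt: "sqrt (real N * \<sigma>\<^sup>2) = sqrt (real N) * \<sigma>" using \<sigma>(1) by (simp add: real_sqrt_mult)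
          have "(\<Sum>k<N. Y k \<omega>) / real N - m = (\<Sum>k<N. Y k \<omega> - m) / real N"
            using N by (simp add: sum_subtractf field_simps)
          also have "\<dots> = ?S N \<omega> * \<sigma> * (1 / sqrt (real N))"
          proof -
            have "real N = sqrt (real N) * sqrt (real N)" by simp
            then show ?thesis unfolding rt using \<sigma>(1) N by (simp add: field_simps)
          qed
          finally have "\<bar>(\<Sum>k<N. Y k \<omega>) / real N - m\<bar> = \<bar>?S N \<omega>\<bar> * \<sigma> * (1 / sqrt (real N))"
            using \<sigma>(1) by (simp add: abs_mult)
          also have "\<dots> \<le> u * (c / 2) * (1 / sqrt (real N))"
            using S \<sigma> u by (intro mult_right_mono mult_mono) auto
          finally show "\<bar>(\<Sum>k<N. Y k \<omega>) / real N - m\<bar> \<le> c / 2 * u * (1 / sqrt (real N))"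
            by (simp only: mult.commute)
        qed
      qed measurable
      finally show "normal_mass u - \<eta> \<le> prob (?A N)" using lt by simp
    qed
  qed
  then show ?thesis by (simp only: Y_def m_def)
qed

end

theorem theorem4p1:
  fixes M :: "'a measure"
    and X :: "nat \<Rightarrow> 'a \<Rightarrow> real"
    and G :: "real measure"
    and \<alpha> Q0 P :: real
    and Q \<epsilon> :: "nat \<Rightarrow> real"
    and n :: nat
  assumes G: "real_distribution G" "AE x in G. 0 < x"
    and alpha: "0 < \<alpha>"
    and Q: "queueing_characteristic \<alpha> G Q0 Q"
    and Q0: "0 < Q0"
    and M: "prob_space M"
    and X_indep: "prob_space.indep_vars M (\<lambda>_. borel) X UNIV"
    and X_distr: "\<And>k. distr M borel (X k) = G"
    and P: "0 < P" "P < 1"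
    and eps: "\<And>N. 1 \<le> N \<Longrightarrow> 0 < \<epsilon> N \<and> kolmogorov_K (\<epsilon> N * sqrt (real N)) = P"
    and n: "1 \<le> n"
  shows "ereal P \<le> liminf (\<lambda>N. ereal (\<P>(\<omega> in M.
      Q_lower (emp_weight \<alpha> (\<lambda>k. X k \<omega>) N) (\<epsilon> N) Q0 n < ereal (Q n) \<and>
      ereal (Q n) < Q_upper (emp_weight \<alpha> (\<lambda>k. X k \<omega>) N) (\<epsilon> N) Q0 n)))"
proof (rule ereal_le_epsilon2)
  fix \<eta> :: real assume "0 < \<eta>"
  note P01 = P
  interpret M: prob_space M by (rule M)
  interpret queue_input \<alpha> G
    by (intro queue_input.intro exponential_sequence.intro queue_input_axioms.intro alpha G)
  have X [measurable]: "X k \<in> borel_measurable M" for k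
    using X_indep by (auto simp: M.indep_vars_def)

  define q where "q = Q_point \<rho> Q0"
  have Qn: "Q n = q n" unfolding q_def by (rule queueing_characteristic_eq_Q_point[OF Q Q0])
  have q_pos: "0 < q i" for i
    unfolding q_def using Q0 mixed_poisson_0_pos
    by (intro Q_point_pos mixed_poisson_nonneg sum_mixed_poisson_le_1) auto
  have q_rec: "q m = (\<Sum>i\<le>m. \<rho> i * q (Suc m - i))" for m
    unfolding q_def using mixed_poisson_0_pos by (intro Q_point_recurrence) auto
  have \<rho>1: "\<rho> 1 < 1" using sum_mixed_poisson_le_1[of "{0, 1}"] mixed_poisson_0_pos by simp
  define c where "c = half_width \<rho> q n"
  have c_pos: "0 < c"
    using half_width_pos[of \<rho> q "n - 1"] n \<rho>1 mixed_poisson_nonneg mixed_poisson_0_pos q_pos by (simp add: c_def)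

  \<comment> \<open>The linear term at the empirical weights is the sample mean of
    \<open>h (X k)\<close>; \<open>mid\<close> belongs to weights all equal to 1 / 2, the centre of
    [0, 1].\<close>
  define h where "h = (\<lambda>t. linear_term \<rho> q (\<lambda>i. truncated_weight \<alpha> i t) n)"
  define mid where "mid = linear_term \<rho> q (\<lambda>_. 1 / 2) n"
  have tw_int: "has_bochner_integral G (truncated_weight \<alpha> i) (\<rho> i)" for i
  proof -
    have "has_bochner_integral G (poisson_weight \<alpha> i) (\<rho> i)"
      unfolding mixed_poisson_def by (intro has_bochner_integral_integrable integrable_poisson_weight)
    then show ?thesis
      using G(2) by (subst has_bochner_integral_cong_AE[where g="poisson_weight \<alpha> i"])
        (auto elim!: eventually_mono simp: truncated_weight_def)
  qed
  then have h_int: "has_bochner_integral G h (linear_term \<rho> q \<rho> n)"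
    unfolding h_def by (rule has_bochner_integral_linear_term)
  then have h_meas: "h \<in> borel_measurable borel"
    using borel_measurable_has_bochner_integral by simp
  have h_bound: "\<bar>h t - mid\<bar> \<le> c / 2" for t
  proof -
    have "h t - mid = linear_term \<rho> q (\<lambda>i. truncated_weight \<alpha> i t - 1 / 2) n"
      unfolding h_def mid_def by (rule linear_term_diff[symmetric])
    also have "\<bar>\<dots>\<bar> \<le> 1 / 2 * half_width \<rho> q n"
    proof (rule abs_linear_term_le)
      show "\<bar>truncated_weight \<alpha> i t - 1 / 2\<bar> \<le> 1 / 2" for i
        using truncated_weight_bounds[OF alpha, of i t] unfolding abs_le_iff by simp
    qed (use \<rho>1 mixed_poisson_nonneg mixed_poisson_0_pos q_pos in \<open>auto simp: less_imp_le\<close>)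
    finally show ?thesis by (simp add: c_def)
  qed

  \<comment> \<open>The minimum with \<open>P\<close> keeps the levels P - \<eta>1 / 2 and P -
    \<eta>1 / 4 positive.\<close>
  define \<eta>1 where "\<eta>1 = min \<eta> P"
  have \<eta>1: "0 < \<eta>1" "\<eta>1 \<le> \<eta>" "\<eta>1 \<le> P" using \<open>0 < \<eta>\<close> P01 by (auto simp: \<eta>1_def)
  \<comment> \<open>Half of \<eta>1 lowers the level to that of \<open>u1\<close>. The other half
    pays \<eta>2 for the event \<open>A N\<close> and 2 \<eta>2 for each of the n + 1 events
    \<open>B i N\<close>, in all (2 n + 3) \<eta>2 \<le> \<eta>1 / 2.\<close>
  define \<eta>2 where "\<eta>2 = \<eta>1 / (4 * (real n + 2))"
  have \<eta>2: "0 < \<eta>2" using \<eta>1 by (simp add: \<eta>2_def)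
  have \<eta>2_less: "\<eta>2 < 1"
    unfolding \<eta>2_def using \<eta>1 P01 by (simp add: field_simps)
  obtain u1 where u1: "0 < u1" "normal_mass u1 = P - \<eta>1 / 2"
    using normal_mass_surj[of "P - \<eta>1 / 2"] \<eta>1 P01 by auto
  obtain u2 where u2: "0 < u2" "normal_mass u2 = P - \<eta>1 / 4"
    using normal_mass_surj[of "P - \<eta>1 / 4"] \<eta>1 P01 by auto
  obtain w where w: "0 < w" "normal_mass w = 1 - \<eta>2"
    using normal_mass_surj[of "1 - \<eta>2"] \<eta>2 \<eta>2_less by auto
  have u12: "u1 < u2"
    using normal_mass_mono[of u2 u1] u1 u2 \<eta>1 by (cases "u1 < u2") auto

  define z where "z = (\<lambda>N. \<epsilon> N * sqrt (real N))"
  have z_pos: "0 < z N" if "1 \<le> N" for N using eps[OF that] that by (simp add: z_def)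
  \<comment> \<open>The normal mass at 2 z is at least K z = P, which exceeds the mass at
    \<open>u2\<close>.\<close>
  have z_lower: "u2 < 2 * z N" if "1 \<le> N" for N
  proof (rule ccontr)
    assume "\<not> u2 < 2 * z N"
    then have "normal_mass (2 * z N) \<le> normal_mass u2" by (intro normal_mass_mono) simp
    moreover have "P \<le> normal_mass (2 * z N)"
      using kolmogorov_K_le_normal_mass[OF z_pos[OF that]] eps[OF that] by (simp add: z_def)
    ultimately show False using u2 \<eta>1 by simp
  qed
  \<comment> \<open>From 1 - 2 exp (- 2 z^2) \<le> P comes a bound on z^2, and z \<le> 1 +
    z^2.\<close>
  define zmax where "zmax = 1 - ln ((1 - P) / 2) / 2"
  have z_upper: "z N \<le> zmax" if "1 \<le> N" for N
  proof -
    have "1 - 2 * exp (- 2 * (z N)\<^sup>2) \<le> P"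
      using kolmogorov_K_bounds(1)[OF z_pos[OF that]] eps[OF that] by (simp add: z_def)
    then have "(1 - P) / 2 \<le> exp (- 2 * (z N)\<^sup>2)" by simp
    then have "ln ((1 - P) / 2) \<le> ln (exp (- 2 * (z N)\<^sup>2))"
      using P01 by (intro iffD2[OF ln_le_cancel_iff]) auto
    then have "ln ((1 - P) / 2) \<le> - 2 * (z N)\<^sup>2" by (simp only: ln_exp)
    moreover have "z N \<le> 1 + (z N)\<^sup>2" using zero_le_power2[of "z N - 1 / 2"] by (simp add: power2_eq_square algebra_simps)
    ultimately show ?thesis by (simp add: zmax_def)
  qed

  \<comment> \<open>Chosen so that c u1 / 2 + \<kappa> = c u2 / 2, which is still below c z.\<close>
  define \<kappa> where "\<kappa> = c * (u2 - u1) / 2"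
  have \<kappa>: "0 < \<kappa>" using c_pos u12 by (simp add: \<kappa>_def)
  \<comment> \<open>\<open>zmax\<close> controls \<open>\<epsilon> N\<close>, and
    \<open>w / 2\<close> controls the deviations of the weights, whose oscillation is at most
    1.\<close>
  define C where "C = max zmax (w / 2)"
  obtain s0 where s0: "0 < s0" and
    est: "\<And>d e s. 0 < s \<Longrightarrow> s < s0 \<Longrightarrow> (\<And>i. i \<le> n \<Longrightarrow> \<bar>d i\<bar> \<le> C * s) \<Longrightarrow> 0 \<le> e \<Longrightarrow> e \<le> C * s \<Longrightarrow>
      \<bar>linear_term \<rho> q d n\<bar> < e * half_width \<rho> q n - \<kappa> * s \<Longrightarrow>
      Q_lower (\<lambda>i. \<rho> i + d i) e Q0 n < ereal (q n) \<and> ereal (q n) < Q_upper (\<lambda>i. \<rho> i + d i) e Q0 n"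
    using interval_estimate_small_perturbations[OF mixed_poisson_0_pos \<rho>1 q_rec _ n \<kappa>, of Q0 C]
    by (auto simp: q_def)

  \<comment> \<open>\<open>A\<close> carries the asymptotic probability near \<open>P\<close>; the
    events \<open>B i\<close> are nearly certain and confine the perturbation to the regime of the
    expansion. A union bound combines them.\<close>
  define A where "A = (\<lambda>N. {\<omega> \<in> space M. \<bar>(\<Sum>k<N. h (X k \<omega>)) / real N - (\<integral>t. h t \<partial>G)\<bar> \<le> c / 2 * u1 * (1 / sqrt (real N))})"
  define B where "B = (\<lambda>i N. {\<omega> \<in> space M. \<bar>(\<Sum>k<N. truncated_weight \<alpha> i (X k \<omega>)) / real N - (\<integral>t. truncated_weight \<alpha> i t \<partial>G)\<bar> \<le> 1 / 2 * w * (1 / sqrt (real N))})"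
  have [measurable]: "A N \<in> sets M" "B i N \<in> sets M" for i N
    using h_meas unfolding A_def B_def by measurable
  have ev_A: "eventually (\<lambda>N. normal_mass u1 - \<eta>2 \<le> M.prob (A N)) sequentially"
    unfolding A_def using u1 \<eta>2 h_bound
    by (intro M.eventually_prob_mean_deviation_ge X_indep X_distr h_meas) auto
  have ev_B: "eventually (\<lambda>N. \<forall>i\<in>{..n}. normal_mass w - \<eta>2 \<le> M.prob (B i N)) sequentially"
    unfolding B_def
  proof (intro eventually_ball_finite ballI M.eventually_prob_mean_deviation_ge X_indep X_distr)
    show "\<bar>truncated_weight \<alpha> i t - 1 / 2\<bar> \<le> 1 / 2" for i t
      using truncated_weight_bounds[OF alpha, of i t] unfolding abs_le_iff by simp
  qed (use w \<eta>2 in auto)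
  have "(\<lambda>N. 1 / sqrt (real N)) \<longlonglongrightarrow> 0"
    by (intro tendsto_divide_0[OF tendsto_const] filterlim_at_top_imp_at_infinity
        filterlim_compose[OF sqrt_at_top filterlim_real_sequentially])
  then have ev_s: "eventually (\<lambda>N. 1 / sqrt (real N) < s0) sequentially"
    using s0 by (rule order_tendstoD)

  let ?Ev = "\<lambda>N. {\<omega> \<in> space M. Q_lower (emp_weight \<alpha> (\<lambda>k. X k \<omega>) N) (\<epsilon> N) Q0 n < ereal (Q n) \<and>
      ereal (Q n) < Q_upper (emp_weight \<alpha> (\<lambda>k. X k \<omega>) N) (\<epsilon> N) Q0 n}"
  have "eventually (\<lambda>N. P - \<eta> \<le> M.prob (?Ev N)) sequentially"
    using ev_A ev_B ev_s eventually_ge_at_top[of 1]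
  proof eventually_elim
    fix N :: nat
    assume A: "normal_mass u1 - \<eta>2 \<le> M.prob (A N)" and B: "\<forall>i\<in>{..n}. normal_mass w - \<eta>2 \<le> M.prob (B i N)"
      and s: "1 / sqrt (real N) < s0" and N: "1 \<le> N"
    define s where "s = 1 / sqrt (real N)"
    have s_pos: "0 < s" using N by (simp add: s_def)
    have eps_z: "\<epsilon> N = z N * s" using N by (simp add: z_def s_def)
    have W: "emp_weight \<alpha> (\<lambda>k. X k \<omega>) N = (\<lambda>i. (\<Sum>k<N. truncated_weight \<alpha> i (X k \<omega>)) / real N)" for \<omega>
      using emp_weight_eq[OF N] by blast
    have Ev_meas: "?Ev N \<in> sets M"
    proof -
      have [measurable]: "(\<lambda>\<omega>. Q_lower (emp_weight \<alpha> (\<lambda>k. X k \<omega>) N) (\<epsilon> N) Q0 n) \<in> borel_measurable M"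
        "(\<lambda>\<omega>. Q_upper (emp_weight \<alpha> (\<lambda>k. X k \<omega>) N) (\<epsilon> N) Q0 n) \<in> borel_measurable M"
        unfolding W using Q_bounds_measurable[of "\<lambda>\<omega> i. (\<Sum>k<N. truncated_weight \<alpha> i (X k \<omega>)) / real N" M "\<epsilon> N" Q0 n]
        by simp_all
      show ?thesis by measurable
    qed
    have sub: "A N \<inter> (\<Inter>i\<in>{..n}. B i N) \<subseteq> ?Ev N"
    proof
      fix \<omega> assume \<omega>: "\<omega> \<in> A N \<inter> (\<Inter>i\<in>{..n}. B i N)"
      define d where "d = (\<lambda>i. emp_weight \<alpha> (\<lambda>k. X k \<omega>) N i - \<rho> i)"
      have d: "\<bar>d i\<bar> \<le> C * s" if "i \<le> n" for i
      proof -
        have "\<omega> \<in> B i N" using \<omega> that by auto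
        then have "\<bar>d i\<bar> \<le> 1 / 2 * w * s"
          using has_bochner_integral_integral_eq[OF tw_int[of i]] by (auto simp: B_def d_def W s_def)
        also have "\<dots> \<le> C * s" using s_pos by (intro mult_right_mono) (auto simp: C_def)
        finally show ?thesis .
      qed
      have "linear_term \<rho> q d n = linear_term \<rho> q (emp_weight \<alpha> (\<lambda>k. X k \<omega>) N) n - linear_term \<rho> q \<rho> n"
        unfolding d_def by (rule linear_term_diff)
      also have "linear_term \<rho> q (emp_weight \<alpha> (\<lambda>k. X k \<omega>) N) n = (\<Sum>k<N. h (X k \<omega>)) / real N"
      proof -
        have "emp_weight \<alpha> (\<lambda>k. X k \<omega>) N = (\<lambda>i. (1 / real N) * (\<Sum>k<N. truncated_weight \<alpha> i (X k \<omega>)))"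
          by (simp add: W)
        then show ?thesis by (simp only: linear_term_scale linear_term_sum h_def) simp
      qed
      finally have "\<bar>linear_term \<rho> q d n\<bar> \<le> c / 2 * u1 * s"
        using \<omega> has_bochner_integral_integral_eq[OF h_int] by (auto simp: A_def s_def)
      also have "\<dots> < \<epsilon> N * c - \<kappa> * s"
      proof -
        have "c / 2 * u1 * s + \<kappa> * s = (c / 2 * s) * u2" by (simp add: \<kappa>_def field_simps)
        also have "\<dots> < (c / 2 * s) * (2 * z N)"
          using z_lower[OF N] c_pos s_pos by (intro mult_strict_left_mono) auto
        finally show ?thesis by (simp add: eps_z field_simps)
      qed
      finally have L: "\<bar>linear_term \<rho> q d n\<bar> < \<epsilon> N * half_width \<rho> q n - \<kappa> * s" by (simp add: c_def)
      have "Q_lower (\<lambda>i. \<rho> i + d i) (\<epsilon> N) Q0 n < ereal (q n) \<and> ereal (q n) < Q_upper (\<lambda>i. \<rho> i + d i) (\<epsilon> N) Q0 n"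
      proof (rule est[OF s_pos _ d _ _ L])
        show "s < s0" using s by (simp add: s_def)
        show "0 \<le> \<epsilon> N" using eps[OF N] by simp
        show "\<epsilon> N \<le> C * s" unfolding eps_z using z_upper[OF N] s_pos by (intro mult_right_mono) (auto simp: C_def)
      qed
      moreover have "(\<lambda>i. \<rho> i + d i) = emp_weight \<alpha> (\<lambda>k. X k \<omega>) N" by (simp add: d_def)
      ultimately show "\<omega> \<in> ?Ev N" using \<omega> by (simp add: Qn A_def)
    qed
    have "1 - M.prob (?Ev N) = M.prob (space M - ?Ev N)"
      using M.prob_compl[OF Ev_meas] by simp
    also have "\<dots> \<le> M.prob ((space M - A N) \<union> (\<Union>i\<in>{..n}. space M - B i N))"
      using sub by (intro M.finite_measure_mono) auto
    also have "\<dots> \<le> M.prob (space M - A N) + M.prob (\<Union>i\<in>{..n}. space M - B i N)"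
      by (intro measure_Un_le) auto
    also have "\<dots> \<le> M.prob (space M - A N) + (\<Sum>i\<le>n. M.prob (space M - B i N))"
      by (intro add_left_mono measure_UNION_le) auto
    also have "\<dots> \<le> (1 - (normal_mass u1 - \<eta>2)) + (\<Sum>i\<le>n. 1 - (normal_mass w - \<eta>2))"
    proof (intro add_mono sum_mono)
      show "M.prob (space M - A N) \<le> 1 - (normal_mass u1 - \<eta>2)"
        using A by (simp add: M.prob_compl)
      fix i assume "i \<in> {..n}"
      with B have "normal_mass w - \<eta>2 \<le> M.prob (B i N)" by blast
      then show "M.prob (space M - B i N) \<le> 1 - (normal_mass w - \<eta>2)"
        by (simp add: M.prob_compl)
    qed
    also have "\<dots> = 1 - P + \<eta>1 / 2 + (2 * real n + 3) * \<eta>2"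
      unfolding u1(2) w(2) by (simp add: algebra_simps)
    also have "\<dots> \<le> 1 - P + \<eta>1 / 2 + (2 * (real n + 2)) * \<eta>2"
      using \<eta>2 by (intro add_left_mono mult_right_mono) auto
    also have "(2 * (real n + 2)) * \<eta>2 = \<eta>1 / 2"
      by (simp add: \<eta>2_def field_simps)
    finally show "P - \<eta> \<le> M.prob (?Ev N)" using \<eta>1 by simp
  qed
  then have "ereal (P - \<eta>) \<le> liminf (\<lambda>N. ereal (M.prob (?Ev N)))"
    by (intro Liminf_bounded) (auto elim!: eventually_mono)
  then have "ereal (P - \<eta>) + ereal \<eta> \<le> liminf (\<lambda>N. ereal (M.prob (?Ev N))) + ereal \<eta>"
    by (rule add_right_mono)
  then show "ereal P \<le> liminf (\<lambda>N. ereal (M.prob (?Ev N))) + ereal \<eta>" by simp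
qed

end
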